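(* For any positive integer $N$, there is a number $\varepsilon(N)$ with $0<\varepsilon(N)<1$ such that for any $\varepsilon$ with $0<\varepsilon<\varepsilon(N)$, the compact algebraic strongly pseudoconvex hypersurface $M_\varepsilon\subset\mathbb{C}^2$ cannot be locally holomorphically embedded into $\mathbb{S}^{2N-1}$. Namely, for every (nonempty, connected) open piece $U_\varepsilon$ of $M_\varepsilon$, any holomorphic map sending $U_\varepsilon$ into $\mathbb{S}^{2N-1}$ must be a constant map.
   Context: Fix real constants $c$ with $2<c<\frac{16}{7}$ and $\varepsilon_0>0$, where $\varepsilon_0$ is sufficiently small so that, for all $0\le\varepsilon<1$, the set $$M_\varepsilon=\{(z,w)\in\mathbb{C}^2:\ \varepsilon_0\big(|z|^8+c\,\mathrm{Re}(|z|^2z^6)\big)+|w|^2+|z|^{10}+\varepsilon|z|^2-1=0\}$$ is smooth. For $0<\varepsilon<1$, $M_\varepsilon$ is a compact strongly pseudoconvex real algebraic hypersurface. $\mathbb{S}^{2N-1}=\{Z\in\mathbb{C}^N:\sum_{j=1}^N|Z_j|^2=1\}$. An open piece of $M_\varepsilon$ is a nonempty relatively open subset. A holomorphic map sending an open piece $U$ of $M_\varepsilon$ into $\mathbb{S}^{2N-1}$ means a holomorphic map $F:X\to\mathbb{C}^N$ defined on a connected open neighborhood $X\subset\mathbb{C}^2$ of $U$ with $F(U)\subset\mathbb{S}^{2N-1}$; a holomorphic embedding of $U$ is such a map that is moreover a holomorphic embedding of $X$ . *)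

theory Defs
  imports "HOL-Analysis.Analysis"
begin

definition hypersurface_M :: "real \<Rightarrow> real \<Rightarrow> real \<Rightarrow> (complex ^ 2) set" where
  "hypersurface_M c e0 e =
     {Z. let z = Z $ 1; w = Z $ 2 in
        e0 * (cmod z ^ 8 + c * Re (complex_of_real (cmod z ^ 2) * z ^ 6))
          + cmod w ^ 2 + cmod z ^ 10 + e * cmod z ^ 2 - 1 = 0}"

text \<open>On an open set, the following is real differentiability of class \<open>C\<^sup>k\<close>: by differentiability,
  control of all directional derivatives amounts to control of the total derivative.\<close>

fun Ck_on :: "nat \<Rightarrow> 'a::euclidean_space set \<Rightarrow> ('a \<Rightarrow> real) \<Rightarrow> bool" where
  "Ck_on 0 V r \<longleftrightarrow> continuous_on V r"
| "Ck_on (Suc k) V r \<longleftrightarrow>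
     (\<forall>x\<in>V. r differentiable (at x)) \<and>
     (\<forall>v. Ck_on k V (\<lambda>x. frechet_derivative r (at x) v))"

definition smooth_hypersurface :: "'a::euclidean_space set \<Rightarrow> bool" where
  "smooth_hypersurface M \<longleftrightarrow>
     (\<forall>p\<in>M. \<exists>V r. open V \<and> p \<in> V \<and> (\<forall>k. Ck_on k V r) \<and>
        (\<forall>x\<in>V. frechet_derivative r (at x) \<noteq> (\<lambda>_. 0)) \<and>
        M \<inter> V = {x \<in> V. r x = 0})"

definition open_piece :: "'a::topological_space set \<Rightarrow> 'a set \<Rightarrow> bool" where
  "open_piece M U \<longleftrightarrow> U \<noteq> {} \<and> openin (top_of_set M) U"

text \<open>Holomorphy in several variables: the real total derivative exists and is complex linear;
  \<open>(*s)\<close> is complex scalar multiplication.\<close>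

definition holomorphic_map :: "(complex ^ 'm) set \<Rightarrow> (complex ^ 'm \<Rightarrow> complex ^ 'n) \<Rightarrow> bool" where
  "holomorphic_map X F \<longleftrightarrow> open X \<and>
     (\<forall>p\<in>X. \<exists>L. (F has_derivative L) (at p) \<and> Vector_Spaces.linear (*s) (*s) L)"

definition holomorphic_embedding :: "(complex ^ 'm) set \<Rightarrow> (complex ^ 'm \<Rightarrow> complex ^ 'n) \<Rightarrow> bool" where
  "holomorphic_embedding X F \<longleftrightarrow> holomorphic_map X F \<and>
     (\<forall>p\<in>X. inj (frechet_derivative F (at p))) \<and>
     (\<exists>G. homeomorphism X (F ` X) F G)"

text \<open>\<open>X\<close> is a connected open neighbourhood of \<open>U\<close>. The norm of \<open>complex ^ 'n\<close> is the Hermitian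
  one, so \<open>sphere 0 1\<close> is the real \<open>(2N - 1)\<close>-sphere with \<open>N = CARD('n)\<close>.\<close>

definition maps_into_sphere ::
  "(complex ^ 'm) set \<Rightarrow> (complex ^ 'm) set \<Rightarrow> (complex ^ 'm \<Rightarrow> complex ^ 'n) \<Rightarrow> bool" where
  "maps_into_sphere U X F \<longleftrightarrow>
     open X \<and> connected X \<and> U \<subseteq> X \<and> holomorphic_map X F \<and> F ` U \<subseteq> sphere 0 1"

text \<open>The type argument only supplies the target \<open>complex ^ 'n\<close>.\<close>

definition locally_embeddable_into_sphere :: "'n::finite itself \<Rightarrow> (complex ^ 'm) set \<Rightarrow> bool" where
  "locally_embeddable_into_sphere _ M \<longleftrightarrow>
     (\<exists>U X. \<exists>F :: complex ^ 'm \<Rightarrow> complex ^ 'n.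
        open_piece M U \<and> maps_into_sphere U X F \<and> holomorphic_embedding X F)"

end

theory Submission imports Defs "HOL-Complex_Analysis.Complex_Analysis"
begin

text \<open>
  Write the hypersurface as \<open>|w|\<^sup>2 = 1 - P(z, \<zeta>)\<close> with \<open>\<zeta>\<close> the conjugate of \<open>z\<close>, where \<open>P\<close> is a real
  symmetric polynomial that vanishes for \<open>\<zeta> = 0\<close>, and put \<open>\<rho>(z) = P(z, cnj z)\<close>. Suppose that a holomorphic
  map \<open>F = (f\<^sub>j)\<close> satisfies \<open>\<Sum>|f\<^sub>j|\<^sup>2 = 1\<close> on an open piece. The proof shows that \<open>F\<close> is rational in \<open>z\<close>,
  that it continues so far that it can be compared at the origin with itself at the other zeros of \<open>\<rho>\<close>,
  and that this comparison makes it constant.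

  Rationality. Polarization turns the hypothesis into
  \<open>\<Sum> f\<^sub>j(z, w) * cnj (f\<^sub>j(cnj \<zeta>, cnj \<eta>)) = 1\<close> whenever \<open>w * \<eta> = 1 - P(z, \<zeta>)\<close>. Differentiating along these
  relations gives, on the Segre variety \<open>w = (1 - P(z, \<zeta>)) / \<eta>\<close> of a point of the hypersurface, a
  linear system for \<open>F\<close> whose coefficients are polynomials in \<open>z\<close>, and the system has essentially only one
  solution (\<open>segre_rational\<close>). All these curves have the form \<open>w = \<kappa> * (1 - P(z, \<zeta>))\<close>. Being rational of
  bounded degree is a linear dependence, so it survives analytic continuation in the parameters
  \<open>\<zeta>\<close> and \<open>\<kappa>\<close> (\<open>rational_map_propagate\<close>). Continuing \<open>\<zeta>\<close> to \<open>0\<close> yields the lines \<open>w = \<kappa>\<close>, so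
  that \<open>f\<^sub>j = G\<^sub>j / G\<^sub>0\<close> with polynomials in \<open>z\<close> whose coefficients are holomorphic in \<open>w\<close>.

  Continuation in \<open>w\<close>. The function \<open>F\<close> is now meromorphic in \<open>z\<close> on the whole plane, so the curves can be
  looked at near \<open>z = 0\<close> as well, and \<open>\<zeta>\<close> can be continued from \<open>0\<close> to \<open>1\<close>. The real function
  \<open>s \<mapsto> P(s, 1)\<close> is increasing (this is where \<open>c > 2\<close> enters), and sliding along it continues the coefficients of
  \<open>G\<close> to a neighbourhood of a long segment of the ray through \<open>w\<close> (\<open>ray_coefficients\<close>, \<open>ray_continuation\<close>).

  Comparison. For small \<open>m > 0\<close> the region \<open>\<rho> < 1 - m\<close> is star-shaped about \<open>0\<close>, provided that \<open>e\<close> is small (\<open>rho_scale\<close>). So the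
  identity \<open>\<Sum>|G\<^sub>j|\<^sup>2 = |G\<^sub>0|\<^sup>2\<close> can be transported along the hypersurface from the open piece to points above this region,
  with the argument of \<open>w\<close> kept fixed (\<open>transport_segment\<close>). For small \<open>e\<close> the function \<open>\<rho>\<close> takes values of both signs, so it
  vanishes not only at \<open>0\<close> but on an infinite set (\<open>infinite_zeros\<close>). Above every zero \<open>z\<close> of \<open>\<rho>\<close> the hypersurface is the
  circle \<open>|w| = 1\<close>, an arc of which is reached in this way. There the vectors \<open>G(z, w)\<close> and \<open>G(0, w)\<close> are both null for the form
  \<open>\<Sum>|G\<^sub>j|\<^sup>2 - |G\<^sub>0|\<^sup>2\<close>, and they are orthogonal to each other because the polarized identity at \<open>\<zeta> = 0\<close> holds
  for all \<open>z\<close>. The equality case of the Cauchy-Schwarz inequality makes them proportional, first at the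
  infinitely many zeros of \<open>\<rho>\<close> and then, \<open>G\<close> being polynomial in \<open>z\<close>, for all \<open>z\<close>. Hence \<open>F\<close> depends on \<open>w\<close> alone,
  has norm one on an open set, and is constant by the maximum principle (\<open>sphere_map_locally_constant\<close>).
\<close>

section \<open>Linear dependence over rings of holomorphic functions\<close>

text \<open>The identity theorem in the form that is convenient here: zeros accumulating at one point are
  recorded by \<open>frequently\<close>.\<close>

lemma holomorphic_frequently_zero:
  assumes "open V" "connected V" "v \<in> V" "h holomorphic_on V"
    and "\<exists>\<^sub>F x in at v. h x = 0" "x \<in> V"
  shows "h x = 0"
proof -
  define Z where "Z = {x\<in>V. h x = 0}"
  have "eventually (\<lambda>x. x \<in> V) (at v)"
    using assms(1,3) eventually_at_in_open' by blast
  then have "\<exists>\<^sub>F x in at v. x \<in> Z"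
    using frequently_eventually_conj[OF assms(5)] unfolding Z_def by simp
  then have "v islimpt Z"
    by (simp add: islimpt_iff_eventually frequently_def)
  show ?thesis
    by (rule analytic_continuation[OF assms(4,1,2) _ assms(3) \<open>v islimpt Z\<close> _ assms(6)])
      (auto simp: Z_def)
qed

lemma holomorphic_eventually_nonzero:
  assumes "open V" "connected V" "v \<in> V" "h holomorphic_on V" "x \<in> V" "h x \<noteq> 0"
  shows "\<forall>\<^sub>F x in at v. h x \<noteq> 0"
  using holomorphic_frequently_zero[OF assms(1-4) _ assms(5)] assms(6) unfolding frequently_def by blast

text \<open>If every power of \<open>x - v\<close> divided all the \<open>h i\<close>, then so it would for \<open>h i0\<close>, which has a zero of
  finite order. The largest common power leaves quotients that do not all vanish at \<open>v\<close>.\<close>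

lemma common_zero_factor:
  fixes h :: "'i \<Rightarrow> complex \<Rightarrow> complex"
  assumes V: "open V" "connected V" "v \<in> V"
    and hol: "\<And>i. i \<in> I \<Longrightarrow> h i holomorphic_on V"
    and nz: "i0 \<in> I" "x0 \<in> V" "h i0 x0 \<noteq> 0"
  obtains m d where "\<And>i. i \<in> I \<Longrightarrow> d i holomorphic_on V"
    "\<And>i x. i \<in> I \<Longrightarrow> x \<in> V \<Longrightarrow> h i x = (x - v) ^ m * d i x"
    "\<exists>i\<in>I. d i v \<noteq> 0"
proof (rule ccontr)
  assume "\<not> thesis"
  note contr = this[unfolded not_def, rule_format, OF that]
  have *: "\<exists>d. \<forall>i\<in>I. d i holomorphic_on V \<and> (\<forall>x\<in>V. h i x = (x - v) ^ n * d i x)" for n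
  proof (induction n)
    case 0
    then show ?case using hol by (intro exI[of _ h]) auto
  next
    case (Suc n)
    then obtain d where d: "\<And>i. i \<in> I \<Longrightarrow> d i holomorphic_on V"
        "\<And>i x. i \<in> I \<Longrightarrow> x \<in> V \<Longrightarrow> h i x = (x - v) ^ n * d i x" by blast
    have dv: "d i v = 0" if "i \<in> I" for i
      using contr[of d n] d that by blast
    show ?case
    proof (intro exI ballI conjI)
      fix i assume i: "i \<in> I"
      show "(\<lambda>z. if z = v then deriv (d i) v else (d i z - d i v) / (z - v)) holomorphic_on V"
        using pole_theorem_open_0[OF d(1)[OF i] V(1)] pole_lemma_open[OF d(1)[OF i] V(1)] by blast
      fix x assume "x \<in> V"
      show "h i x = (x - v) ^ Suc n * (if x = v then deriv (d i) v else (d i x - d i v) / (x - v))"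
        using d(2)[OF i \<open>x \<in> V\<close>] dv[OF i] by auto
    qed
  qed
  show False
  proof (cases "h i0 v = 0")
    case False
    then show ?thesis using *[of 1] nz V(3) by fastforce
  next
    case True
    have "\<not> h i0 constant_on V"
      using nz True V(3) unfolding constant_on_def by metis
    then obtain g r n where g: "0 < n" "0 < r" "ball v r \<subseteq> V" "g holomorphic_on ball v r"
        "\<And>w. w \<in> ball v r \<Longrightarrow> h i0 w = (w - v)^n * g w" "\<And>w. w \<in> ball v r \<Longrightarrow> g w \<noteq> 0"
      using holomorphic_factor_zero_nonconstant[OF hol[OF nz(1)] V True] by metis
    obtain d where d: "d holomorphic_on V" "\<And>x. x \<in> V \<Longrightarrow> h i0 x = (x - v) ^ Suc n * d x"
      using *[of "Suc n"] nz(1) by blast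
    have hol': "(\<lambda>w. g w - (w - v) * d w) holomorphic_on ball v r"
      using g(3,4) d(1) by (intro holomorphic_intros) (auto intro: holomorphic_on_subset)
    have "\<forall>\<^sub>F w in at v. w \<in> ball v r" "\<forall>\<^sub>F w in at v. w \<noteq> v"
      using g(2) eventually_at_in_open'[of "ball v r" v] by (simp_all add: eventually_neq_at_within)
    then have "\<forall>\<^sub>F w in at v. g w - (w - v) * d w = 0"
    proof eventually_elim
      case (elim w)
      then have "(w - v)^n * g w = (w - v)^n * ((w - v) * d w)"
        using g(5)[of w] d(2)[of w] g(3) by (auto simp: algebra_simps)
      then show ?case using elim(2) by auto
    qed
    then have "\<exists>\<^sub>F w in at v. g w - (w - v) * d w = 0"
      by (simp add: eventually_frequently)
    then have "g v - (v - v) * d v = 0"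
      using holomorphic_frequently_zero[OF _ _ _ hol', of v v] g(2) by auto
    then show ?thesis using g(6)[of v] g(2) by auto
  qed
qed

text \<open>Constant-coefficient dependences that exist separately at each \<open>v\<close> of an accumulating set combine into one
  dependence whose coefficients vary in the ring \<open>R\<close> of holomorphic functions. This is Gaussian
  elimination without division, by induction on the number of columns: a nonzero entry \<open>g m x0\<close> serves as pivot, and
  the elimination preserves both \<open>R\<close> and dependence wherever the pivot does not vanish. It is used with all
  holomorphic functions (for continuation in a parameter) and with polynomials (for rationality).\<close>

lemma analytic_dependence:
  fixes g :: "'i \<Rightarrow> 'x \<Rightarrow> complex \<Rightarrow> complex"
  assumes fin: "finite I" and V: "open V" "connected V" "v0 \<in> V"
    and R: "\<And>a. a \<in> R \<Longrightarrow> a holomorphic_on V" "(\<lambda>_. 1) \<in> R" "(\<lambda>_. 0) \<in> R"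
      "\<And>a b. a \<in> R \<Longrightarrow> b \<in> R \<Longrightarrow> (\<lambda>v. a v * b v) \<in> R"
      "\<And>a b. a \<in> R \<Longrightarrow> b \<in> R \<Longrightarrow> (\<lambda>v. a v - b v) \<in> R"
    and g: "\<And>i x. i \<in> I \<Longrightarrow> x \<in> X \<Longrightarrow> g i x \<in> R"
    and dep: "\<exists>\<^sub>F v in at v0. \<exists>c. (\<exists>i\<in>I. c i \<noteq> 0) \<and> (\<forall>x\<in>X. (\<Sum>i\<in>I. c i * g i x v) = 0)"
  obtains c where "\<And>i. i \<in> I \<Longrightarrow> c i \<in> R" "\<exists>i\<in>I. \<exists>v\<in>V. c i v \<noteq> 0"
    "\<And>x v. x \<in> X \<Longrightarrow> v \<in> V \<Longrightarrow> (\<Sum>i\<in>I. c i v * g i x v) = 0"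
proof -
  have "\<exists>c. (\<forall>i\<in>I. c i \<in> R) \<and> (\<exists>i\<in>I. \<exists>v\<in>V. c i v \<noteq> 0) \<and>
     (\<forall>x\<in>X. \<forall>v\<in>V. (\<Sum>i\<in>I. c i v * g i x v) = 0)"
    using fin g dep
  proof (induction I arbitrary: g rule: finite_induct)
    case empty
    then show ?case by simp
  next
    case (insert m I)
    show ?case
    proof (cases "\<forall>x\<in>X. \<forall>v\<in>V. g m x v = 0")
      case True
      define c :: "'i \<Rightarrow> complex \<Rightarrow> complex" where "c = (\<lambda>i _. if i = m then 1 else 0)"
      have "c i \<in> R" for i using R(2,3) by (cases "i = m") (auto simp: c_def)
      moreover have "(\<Sum>i\<in>insert m I. c i v * g i x v) = 0" if "x \<in> X" "v \<in> V" for x v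
        using True that by (intro sum.neutral) (auto simp: c_def)
      moreover have "c m v0 \<noteq> 0" by (simp add: c_def)
      ultimately show ?thesis using V(3) by (intro exI[of _ c]) blast
    next
      case False
      then obtain x0 v1 where x0: "x0 \<in> X" "v1 \<in> V" "g m x0 v1 \<noteq> 0" by blast
      have gR: "g i x \<in> R" if "i \<in> insert m I" "x \<in> X" for i x using insert.prems(1) that by blast
      \<comment> \<open>column \<open>m\<close> is eliminated with the pivot row \<open>x0\<close>\<close>
      define h where "h = (\<lambda>i x v. g m x0 v * g i x v - g i x0 v * g m x v)"
      have hR: "h i x \<in> R" if "i \<in> I" "x \<in> X" for i x
        unfolding h_def using that x0(1) by (intro R gR) auto
      have key: "(\<Sum>i\<in>I. c i * h i x v) =
          g m x0 v * (\<Sum>i\<in>I. c i * g i x v) - (\<Sum>i\<in>I. c i * g i x0 v) * g m x v" for c x v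
        by (simp add: h_def sum_subtractf sum_distrib_left sum_distrib_right algebra_simps)
      have "\<forall>\<^sub>F v in at v0. g m x0 v \<noteq> 0"
        using holomorphic_eventually_nonzero[OF V R(1)[OF gR[OF _ x0(1)]]] x0(2,3) by auto
      with insert.prems(2) have "\<exists>\<^sub>F v in at v0. g m x0 v \<noteq> 0 \<and>
          (\<exists>c. (\<exists>i\<in>insert m I. c i \<noteq> 0) \<and> (\<forall>x\<in>X. (\<Sum>i\<in>insert m I. c i * g i x v) = 0))"
        by (simp add: frequently_eventually_conj)
      then have "\<exists>\<^sub>F v in at v0. \<exists>c. (\<exists>i\<in>I. c i \<noteq> 0) \<and> (\<forall>x\<in>X. (\<Sum>i\<in>I. c i * h i x v) = 0)"
      proof (rule frequently_elim1, elim conjE exE)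
        fix v c assume gm: "g m x0 v \<noteq> 0" and ex: "\<exists>i\<in>insert m I. c i \<noteq> 0"
          and s: "\<forall>x\<in>X. (\<Sum>i\<in>insert m I. c i * g i x v) = 0"
        have s': "(\<Sum>i\<in>I. c i * g i x v) = - c m * g m x v" if "x \<in> X" for x
          using s that insert.hyps by (auto simp: add_eq_0_iff2)
        have "\<exists>i\<in>I. c i \<noteq> 0"
        proof (rule ccontr)
          assume "\<not> ?thesis"
          then have "c m * g m x0 v = 0" using s'[OF x0(1)] by auto
          with gm ex \<open>\<not> ?thesis\<close> show False by auto
        qed
        moreover have "(\<Sum>i\<in>I. c i * h i x v) = 0" if "x \<in> X" for x
          unfolding key s'[OF that] s'[OF x0(1)] by simp
        ultimately show "\<exists>c. (\<exists>i\<in>I. c i \<noteq> 0) \<and> (\<forall>x\<in>X. (\<Sum>i\<in>I. c i * h i x v) = 0)" by blast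
      qed
      from insert.IH[OF hR this] obtain c where
        c: "\<forall>i\<in>I. c i \<in> R" "\<exists>i\<in>I. \<exists>v\<in>V. c i v \<noteq> 0" "\<forall>x\<in>X. \<forall>v\<in>V. (\<Sum>i\<in>I. c i v * h i x v) = 0"
        by blast
      have sumR: "(\<lambda>v. (\<Sum>i\<in>J. c i v * g i x0 v)) \<in> R" if "J \<subseteq> I" for J
        using finite_subset[OF that insert.hyps(1)] that
      proof (induction J rule: finite_induct)
        case empty then show ?case using R(3) by simp
      next
        case (insert i J)
        have neg: "(\<lambda>v. 0 - a v) \<in> R" if "a \<in> R" for a using R(3,5) that by blast
        have "(\<lambda>v. c i v * g i x0 v - (0 - (\<Sum>i\<in>J. c i v * g i x0 v))) \<in> R"
          using insert c(1) x0(1) gR by (intro R(5) R(4) neg) auto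
        then show ?case using insert by simp
      qed
      \<comment> \<open>back substitution: the pivot row determines the coefficient of column \<open>m\<close>\<close>
      define c' where "c' = (\<lambda>i v. if i = m then 0 - (\<Sum>i\<in>I. c i v * g i x0 v) else g m x0 v * c i v)"
      have "\<forall>i\<in>insert m I. c' i \<in> R"
      proof
        fix i assume i: "i \<in> insert m I"
        show "c' i \<in> R"
        proof (cases "i = m")
          case True
          then show ?thesis unfolding c'_def using R(5)[OF R(3) sumR[of I]] by simp
        next
          case False
          then show ?thesis unfolding c'_def using R(4)[OF gR[OF _ x0(1)]] c(1) i by simp
        qed
      qed
      moreover have "\<exists>i\<in>insert m I. \<exists>v\<in>V. c' i v \<noteq> 0"
      proof -
        obtain i v where iv: "i \<in> I" "v \<in> V" "c i v \<noteq> 0" using c(2) by blast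
        have "\<forall>\<^sub>F v in at v0. c i v \<noteq> 0" "\<forall>\<^sub>F v in at v0. g m x0 v \<noteq> 0" "\<forall>\<^sub>F v in at v0. v \<in> V"
          using holomorphic_eventually_nonzero[OF V R(1), of "c i" v] iv c(1)
            holomorphic_eventually_nonzero[OF V R(1)[OF gR[OF _ x0(1)]]] x0(2,3)
            eventually_at_in_open'[OF V(1,3)] by auto
        then have "\<forall>\<^sub>F v in at v0. c i v \<noteq> 0 \<and> g m x0 v \<noteq> 0 \<and> v \<in> V" by (intro eventually_conj)
        then obtain u where "c i u \<noteq> 0" "g m x0 u \<noteq> 0" "u \<in> V"
          using eventually_happens'[OF at_neq_bot] by blast
        then show ?thesis using iv insert.hyps(2)
          by (intro bexI[of _ i] bexI[of _ u]) (auto simp: c'_def)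
      qed
      moreover have "(\<Sum>i\<in>insert m I. c' i v * g i x v) = 0" if "x \<in> X" "v \<in> V" for x v
      proof -
        have "(\<Sum>i\<in>I. c' i v * g i x v) = (\<Sum>i\<in>I. g m x0 v * (c i v * g i x v))"
          using insert.hyps(2) by (intro sum.cong) (auto simp: c'_def)
        then have "(\<Sum>i\<in>insert m I. c' i v * g i x v) = (\<Sum>i\<in>I. c i v * h i x v)"
          unfolding key using insert.hyps by (simp add: c'_def sum_distrib_left)
        then show ?thesis using c(3) that by simp
      qed
      ultimately show ?thesis by blast
    qed
  qed
  then show thesis using that by blast
qed

section \<open>Rational maps depending on a parameter\<close>

text \<open>The tuple \<open>\<phi>\<close> consists of homogeneous coordinates, \<open>None\<close> being the denominator. It agrees, as a point of projective
  space, with polynomials of degree at most \<open>d\<close> in the coordinate \<open>pos\<close>. The polynomials \<open>\<psi>\<close> may be degenerate with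
  \<open>\<psi> None = 0\<close>; this makes the condition a nontrivial linear dependence, which is what can be continued
  analytically.\<close>

definition rational_map :: "nat \<Rightarrow> 'x set \<Rightarrow> ('x \<Rightarrow> complex) \<Rightarrow> ('n option \<Rightarrow> 'x \<Rightarrow> complex) \<Rightarrow> bool" where
  "rational_map d X pos \<phi> \<longleftrightarrow> (\<exists>\<psi>. (\<exists>k. \<psi> k \<noteq> 0) \<and> (\<forall>k. degree (\<psi> k) \<le> d) \<and>
     (\<forall>x\<in>X. \<forall>k. poly (\<psi> None) (pos x) * \<phi> k x = poly (\<psi> k) (pos x) * \<phi> None x))"

lemma poly_eq_sum_le:
  fixes p :: "complex poly"
  assumes "degree p \<le> d"
  shows "poly p x = (\<Sum>i\<le>d. coeff p i * x ^ i)"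
proof -
  have "(\<Sum>i\<le>degree p. coeff p i * x ^ i) = (\<Sum>i\<le>d. coeff p i * x ^ i)"
    using assms by (intro sum.mono_neutral_left) (auto simp: coeff_eq_0)
  then show ?thesis by (simp add: poly_altdef)
qed

lemma coeff_sum_monom:
  fixes a :: "nat \<Rightarrow> complex"
  shows "coeff (\<Sum>i\<le>d. monom (a i) i) j = (if j \<le> d then a j else 0)"
  by (simp add: coeff_sum if_distrib cong: if_cong)

lemma rational_map_sumI:
  assumes "\<And>x k. x \<in> X \<Longrightarrow>
      (\<Sum>i\<le>d. a None i * pos x ^ i) * \<phi> k x = (\<Sum>i\<le>d. a k i * pos x ^ i) * \<phi> None x"
    and "a m j \<noteq> 0" "j \<le> d"
  shows "rational_map d X pos \<phi>"
  unfolding rational_map_def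
proof (intro exI[of _ "\<lambda>k. \<Sum>i\<le>d. monom (a k i) i"] conjI ballI allI exI[of _ m])
  have "coeff (\<Sum>i\<le>d. monom (a m i) i) j \<noteq> 0"
    using assms(2,3) by (simp add: coeff_sum_monom)
  then show "(\<Sum>i\<le>d. monom (a m i) i) \<noteq> 0" by auto
  show "degree (\<Sum>i\<le>d. monom (a k i) i) \<le> d" for k
    by (rule degree_le) (simp add: coeff_sum_monom)
  show "poly (\<Sum>i\<le>d. monom (a None i) i) (pos x) * \<phi> k x =
      poly (\<Sum>i\<le>d. monom (a k i) i) (pos x) * \<phi> None x" if "x \<in> X" for x k
    using assms(1)[OF that] by (simp add: poly_sum poly_monom)
qed

lemma rational_map_sumE:
  assumes "rational_map d X pos \<phi>"
  obtains a k0 i0 where "\<And>x k. x \<in> X \<Longrightarrow>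
      (\<Sum>i\<le>d. a None i * pos x ^ i) * \<phi> k x = (\<Sum>i\<le>d. a k i * pos x ^ i) * \<phi> None x"
    "a k0 i0 \<noteq> 0" "i0 \<le> d"
proof -
  obtain \<psi> k0 where \<psi>: "\<psi> k0 \<noteq> 0" "\<And>k. degree (\<psi> k) \<le> d"
      "\<And>x k. x \<in> X \<Longrightarrow> poly (\<psi> None) (pos x) * \<phi> k x = poly (\<psi> k) (pos x) * \<phi> None x"
    using assms unfolding rational_map_def by blast
  show ?thesis
  proof (rule that[of "\<lambda>k. coeff (\<psi> k)" k0 "degree (\<psi> k0)"])
    show "coeff (\<psi> k0) (degree (\<psi> k0)) \<noteq> 0" using \<psi>(1) by simp
    show "degree (\<psi> k0) \<le> d" by (rule \<psi>(2))
    show "(\<Sum>i\<le>d. coeff (\<psi> None) i * pos x ^ i) * \<phi> k x = (\<Sum>i\<le>d. coeff (\<psi> k) i * pos x ^ i) * \<phi> None x"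
      if "x \<in> X" for x k
      using \<psi>(3)[OF that] by (simp add: poly_eq_sum_le[OF \<psi>(2)])
  qed
qed

lemma rational_map_scale:
  assumes "rational_map d X pos \<phi>" "\<And>k x. x \<in> X \<Longrightarrow> \<phi>' k x = l x * \<phi> k x"
  shows "rational_map d X pos \<phi>'"
proof -
  obtain \<psi> where \<psi>: "\<exists>k. \<psi> k \<noteq> 0" "\<forall>k. degree (\<psi> k) \<le> d"
      "\<And>x k. x \<in> X \<Longrightarrow> poly (\<psi> None) (pos x) * \<phi> k x = poly (\<psi> k) (pos x) * \<phi> None x"
    using assms(1) unfolding rational_map_def by blast
  have "poly (\<psi> None) (pos x) * \<phi>' k x = poly (\<psi> k) (pos x) * \<phi>' None x" if "x \<in> X" for x k
    using \<psi>(3)[OF that, of k] by (simp add: assms(2)[OF that] mult.left_commute)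
  then show ?thesis unfolding rational_map_def using \<psi> by blast
qed

lemma rational_map_subset: "rational_map d X pos \<phi> \<Longrightarrow> Y \<subseteq> X \<Longrightarrow> rational_map d Y pos \<phi>"
  unfolding rational_map_def by blast

lemma rational_map_extend:
  assumes "rational_map d X (\<lambda>x. x) \<phi>" "open Y" "connected Y" "x0 \<in> Y" "\<forall>\<^sub>F x in at x0. x \<in> X"
    and "\<And>k. \<phi> k holomorphic_on Y"
  shows "rational_map d Y (\<lambda>x. x) \<phi>"
proof -
  obtain \<psi> k0 where \<psi>: "\<psi> k0 \<noteq> 0" "\<And>k. degree (\<psi> k) \<le> d"
      "\<And>x k. x \<in> X \<Longrightarrow> poly (\<psi> None) x * \<phi> k x = poly (\<psi> k) x * \<phi> None x"
    using assms(1) unfolding rational_map_def by blast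
  have "poly (\<psi> None) x * \<phi> k x - poly (\<psi> k) x * \<phi> None x = 0" if "x \<in> Y" for x k
  proof (rule holomorphic_frequently_zero[OF assms(2-4) _ _ that])
    show "(\<lambda>x. poly (\<psi> None) x * \<phi> k x - poly (\<psi> k) x * \<phi> None x) holomorphic_on Y"
      by (intro holomorphic_intros assms)
    show "\<exists>\<^sub>F x in at x0. poly (\<psi> None) x * \<phi> k x - poly (\<psi> k) x * \<phi> None x = 0"
      by (rule eventually_frequently[OF at_neq_bot eventually_mono[OF assms(5)]]) (simp add: \<psi>(3))
  qed
  then show ?thesis unfolding rational_map_def using \<psi> by (intro exI[of _ \<psi>]) auto
qed

lemma sum_option_pairs:
  fixes c :: "'n::finite option \<times> nat \<Rightarrow> complex"
  shows "(\<Sum>p\<in>UNIV \<times> {..d}. c p * (t ^ snd p * (if fst p = None then u else if fst p = Some j then - w else 0)))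
    = (\<Sum>i\<le>d. c (None, i) * t ^ i) * u - (\<Sum>i\<le>d. c (Some j, i) * t ^ i) * w"
proof -
  have "(\<Sum>p\<in>UNIV \<times> {..d}. c p * (t ^ snd p * (if fst p = None then u else if fst p = Some j then - w else 0)))
     = (\<Sum>k\<in>UNIV. \<Sum>i\<le>d. c (k, i) * (t ^ i * (if k = None then u else if k = Some j then - w else 0)))"
    by (simp add: sum.cartesian_product split_beta)
  also have "\<dots> = (\<Sum>i\<le>d. c (None, i) * (t ^ i * u)) +
      (\<Sum>k\<in>UNIV. \<Sum>i\<le>d. c (Some k, i) * (t ^ i * (if k = j then - w else 0)))"
    by (simp add: UNIV_option_conv sum.reindex)
  also have "(\<Sum>k\<in>UNIV. \<Sum>i\<le>d. c (Some k, i) * (t ^ i * (if k = j then - w else 0))) =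
      (\<Sum>k\<in>UNIV. if k = j then (\<Sum>i\<le>d. c (Some k, i) * (t ^ i * (- w))) else 0)"
    by (intro sum.cong) auto
  also have "\<dots> = (\<Sum>i\<le>d. c (Some j, i) * (t ^ i * (- w)))" by simp
  finally show ?thesis by (simp add: sum_distrib_right sum_negf mult.assoc)
qed

text \<open>For fixed \<open>v\<close>, the existence of \<open>\<psi>\<close> is a linear dependence between the finitely many functions
  \<open>pos x v ^ i * \<phi> k x v\<close>, with one equation for every \<open>x\<close> and \<open>k\<close>. So \<open>analytic_dependence\<close> gives coefficients that are
  holomorphic in \<open>v\<close>, and dividing out their common zero at \<open>v1\<close> keeps the relation nontrivial there.\<close>

lemma rational_map_propagate:
  fixes \<phi> :: "'n::finite option \<Rightarrow> 'x \<Rightarrow> complex \<Rightarrow> complex" and pos :: "'x \<Rightarrow> complex \<Rightarrow> complex"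
  assumes V: "open V" "connected V" "v0 \<in> V" "v1 \<in> V"
    and hol: "\<And>x. x \<in> X \<Longrightarrow> pos x holomorphic_on V" "\<And>k x. x \<in> X \<Longrightarrow> \<phi> k x holomorphic_on V"
    and rat: "\<exists>\<^sub>F v in at v0. rational_map d X (\<lambda>x. pos x v) (\<lambda>k x. \<phi> k x v)"
  obtains a k0 i0 where "\<And>k i. i \<le> d \<Longrightarrow> a k i holomorphic_on V" "a k0 i0 v1 \<noteq> 0" "i0 \<le> d"
    "\<And>x v k. x \<in> X \<Longrightarrow> v \<in> V \<Longrightarrow> (\<Sum>i\<le>d. a None i v * pos x v ^ i) * \<phi> k x v =
        (\<Sum>i\<le>d. a k i v * pos x v ^ i) * \<phi> None x v"
proof -
  define I where "I = (UNIV :: 'n option set) \<times> {..d}"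
  \<comment> \<open>the unknowns are the pairs (component, exponent), the equations the pairs (point, component)\<close>
  define g where "g = (\<lambda>p (x, j) v. pos x v ^ snd p *
     (if fst p = None then \<phi> (Some j) x v else if fst p = Some j then - \<phi> None x v else 0))"
  have sumg: "(\<Sum>p\<in>I. c p * g p (x, j) v) = (\<Sum>i\<le>d. c (None, i) * pos x v ^ i) * \<phi> (Some j) x v
      - (\<Sum>i\<le>d. c (Some j, i) * pos x v ^ i) * \<phi> None x v" for c x j v
    unfolding I_def g_def prod.case by (rule sum_option_pairs)
  have gR: "g p y holomorphic_on V" if yX: "y \<in> X \<times> UNIV" for p y
  proof -
    obtain x j where y: "y = (x, j)" "x \<in> X" using yX by blast
    show ?thesis
      unfolding g_def y prod.case using hol[OF y(2)]
      by (cases "fst p = None"; cases "fst p = Some j") (auto intro!: holomorphic_intros)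
  qed
  have "\<exists>\<^sub>F v in at v0. \<exists>c. (\<exists>p\<in>I. c p \<noteq> 0) \<and> (\<forall>y\<in>X \<times> UNIV. (\<Sum>p\<in>I. c p * g p y v) = 0)"
    using rat
  proof (rule frequently_elim1)
    fix v assume "rational_map d X (\<lambda>x. pos x v) (\<lambda>k x. \<phi> k x v)"
    then obtain a k0 i0 where a: "\<And>x k. x \<in> X \<Longrightarrow>
        (\<Sum>i\<le>d. a None i * pos x v ^ i) * \<phi> k x v = (\<Sum>i\<le>d. a k i * pos x v ^ i) * \<phi> None x v"
      "a k0 i0 \<noteq> 0" "i0 \<le> d"
      by (erule rational_map_sumE)
    have "(k0, i0) \<in> I" using a(3) by (simp add: I_def)
    then have "\<exists>p\<in>I. a (fst p) (snd p) \<noteq> 0" using a(2) by force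
    then show "\<exists>c. (\<exists>p\<in>I. c p \<noteq> 0) \<and> (\<forall>y\<in>X \<times> UNIV. (\<Sum>p\<in>I. c p * g p y v) = 0)"
      by (intro exI[of _ "\<lambda>p. a (fst p) (snd p)"]) (use a(1) in \<open>auto simp: sumg\<close>)
  qed
  note dep = this
  obtain c where c: "\<And>p. p \<in> I \<Longrightarrow> c p holomorphic_on V" "\<exists>p\<in>I. \<exists>v\<in>V. c p v \<noteq> 0"
      "\<And>y v. y \<in> X \<times> UNIV \<Longrightarrow> v \<in> V \<Longrightarrow> (\<Sum>p\<in>I. c p v * g p y v) = 0"
  proof (rule analytic_dependence[of I V v0 "{h. h holomorphic_on V}" "X \<times> UNIV" g])
    show "finite I" by (simp add: I_def)
    fix c assume "\<And>p. p \<in> I \<Longrightarrow> c p \<in> {h. h holomorphic_on V}" "\<exists>p\<in>I. \<exists>v\<in>V. c p v \<noteq> 0"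
      "\<And>y v. y \<in> X \<times> UNIV \<Longrightarrow> v \<in> V \<Longrightarrow> (\<Sum>p\<in>I. c p v * g p y v) = 0"
    then show thesis using that by blast
  qed (use V gR dep in \<open>auto intro!: holomorphic_intros\<close>)
  from c(2) obtain p0 x0 where p0: "p0 \<in> I" "x0 \<in> V" "c p0 x0 \<noteq> 0" by blast
  obtain m b where b: "\<And>p. p \<in> I \<Longrightarrow> b p holomorphic_on V"
      "\<And>p x. p \<in> I \<Longrightarrow> x \<in> V \<Longrightarrow> c p x = (x - v1) ^ m * b p x" "\<exists>p\<in>I. b p v1 \<noteq> 0"
    by (rule common_zero_factor[of V v1 I c p0 x0]) (use V c(1) p0 in blast)+
  have zero: "(\<Sum>p\<in>I. b p v * g p y v) = 0" if "y \<in> X \<times> UNIV" "v \<in> V" for y v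
  proof (rule holomorphic_frequently_zero[OF V(1,2,4) _ _ that(2)])
    show "(\<lambda>v. \<Sum>p\<in>I. b p v * g p y v) holomorphic_on V"
      by (intro holomorphic_intros gR b that)
    have "\<forall>\<^sub>F v in at v1. v \<in> V" "\<forall>\<^sub>F v in at v1. v \<noteq> v1"
      using V(1,4) eventually_at_in_open'[of V v1] by (simp_all add: eventually_neq_at_within)
    then have "\<forall>\<^sub>F v in at v1. (\<Sum>p\<in>I. b p v * g p y v) = 0"
    proof eventually_elim
      case (elim v)
      have "(v - v1) ^ m * (\<Sum>p\<in>I. b p v * g p y v) = (\<Sum>p\<in>I. c p v * g p y v)"
        unfolding sum_distrib_left using b(2) elim(1) by (intro sum.cong) auto
      then show ?case using c(3)[OF that(1) elim(1)] elim(2) by auto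
    qed
    then show "\<exists>\<^sub>F v in at v1. (\<Sum>p\<in>I. b p v * g p y v) = 0"
      by (rule eventually_frequently[OF at_neq_bot])
  qed
  from b(3) obtain k0 i0 where k0: "(k0, i0) \<in> I" "b (k0, i0) v1 \<noteq> 0" by auto
  show ?thesis
  proof (rule that[of "\<lambda>k i. b (k, i)" k0 i0])
    show "b (k, i) holomorphic_on V" if "i \<le> d" for k i using b(1) that by (auto simp: I_def)
    show "b (k0, i0) v1 \<noteq> 0" "i0 \<le> d" using k0 by (auto simp: I_def)
    fix x v k assume "x \<in> X" "v \<in> V"
    then show "(\<Sum>i\<le>d. b (None, i) v * pos x v ^ i) * \<phi> k x v =
        (\<Sum>i\<le>d. b (k, i) v * pos x v ^ i) * \<phi> None x v"
      using zero[of "(x, the k)" v] by (cases k) (auto simp: sumg)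
  qed
qed

lemma rational_map_continue:
  fixes \<phi> :: "'n::finite option \<Rightarrow> 'x \<Rightarrow> complex \<Rightarrow> complex" and pos :: "'x \<Rightarrow> complex \<Rightarrow> complex"
  assumes V: "open V" "connected V" "v0 \<in> V" "v1 \<in> V"
    and hol: "\<And>x. x \<in> X \<Longrightarrow> pos x holomorphic_on V" "\<And>k x. x \<in> X \<Longrightarrow> \<phi> k x holomorphic_on V"
    and rat: "\<exists>\<^sub>F v in at v0. rational_map d X (\<lambda>x. pos x v) (\<lambda>k x. \<phi> k x v)"
  shows "rational_map d X (\<lambda>x. pos x v1) (\<lambda>k x. \<phi> k x v1)"
proof -
  obtain a k0 i0 where "a k0 i0 v1 \<noteq> 0" "i0 \<le> d"
    "\<And>x v k. x \<in> X \<Longrightarrow> v \<in> V \<Longrightarrow> (\<Sum>i\<le>d. a None i v * pos x v ^ i) * \<phi> k x v =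
        (\<Sum>i\<le>d. a k i v * pos x v ^ i) * \<phi> None x v"
    by (rule rational_map_propagate[OF assms]) blast+
  then show ?thesis using V(4) by (intro rational_map_sumI[where a = "\<lambda>k i. a k i v1" and m = k0 and j = i0]) auto
qed

section \<open>Holomorphic functions of two variables\<close>

text \<open>Joint complex differentiability; \<open>a\<close> and \<open>b\<close> are the two partial derivatives.\<close>

definition hol2 :: "(complex \<times> complex) set \<Rightarrow> (complex \<Rightarrow> complex \<Rightarrow> complex) \<Rightarrow> bool" where
  "hol2 N g \<longleftrightarrow> open N \<and>
     (\<forall>p\<in>N. \<exists>a b. (case_prod g has_derivative (\<lambda>q. a * fst q + b * snd q)) (at p))"

lemma hol2_subset: "hol2 N g \<Longrightarrow> open M \<Longrightarrow> M \<subseteq> N \<Longrightarrow> hol2 M g"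
  unfolding hol2_def by blast

lemma hol2_continuous_on: "hol2 N g \<Longrightarrow> continuous_on N (case_prod g)"
  unfolding hol2_def by (meson continuous_at_imp_continuous_on has_derivative_continuous)

lemma hol2_chain:
  assumes "(case_prod g has_derivative (\<lambda>q. a * fst q + b * snd q)) (at (\<alpha> t, \<beta> t))"
    and "(\<alpha> has_field_derivative \<alpha>') (at t)" "(\<beta> has_field_derivative \<beta>') (at t)"
  shows "((\<lambda>t. g (\<alpha> t) (\<beta> t)) has_field_derivative (a * \<alpha>' + b * \<beta>')) (at t)"
proof -
  have "((\<lambda>t. (\<alpha> t, \<beta> t)) has_derivative (\<lambda>h. (\<alpha>' * h, \<beta>' * h))) (at t)"
    using assms(2,3) by (intro has_derivative_Pair) (auto simp: has_field_derivative_def)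
  from has_derivative_compose[OF this assms(1)]
  have "((\<lambda>t. g (\<alpha> t) (\<beta> t)) has_derivative (\<lambda>h. a * (\<alpha>' * h) + b * (\<beta>' * h))) (at t)" by simp
  also have "(\<lambda>h. a * (\<alpha>' * h) + b * (\<beta>' * h)) = (*) (a * \<alpha>' + b * \<beta>')"
    by (simp add: fun_eq_iff algebra_simps)
  finally show ?thesis by (simp add: has_field_derivative_def)
qed

lemma hol2_compose:
  assumes "hol2 N g" "\<alpha> holomorphic_on S" "\<beta> holomorphic_on S" "open S"
    "\<And>t. t \<in> S \<Longrightarrow> (\<alpha> t, \<beta> t) \<in> N"
  shows "(\<lambda>t. g (\<alpha> t) (\<beta> t)) holomorphic_on S"
  unfolding holomorphic_on_open[OF assms(4)]
proof
  fix t assume t: "t \<in> S"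
  obtain a b where "(case_prod g has_derivative (\<lambda>q. a * fst q + b * snd q)) (at (\<alpha> t, \<beta> t))"
    using assms(1,5) t unfolding hol2_def by blast
  from hol2_chain[OF this holomorphic_derivI[OF assms(2,4) t] holomorphic_derivI[OF assms(3,4) t]]
  show "\<exists>f'. ((\<lambda>t. g (\<alpha> t) (\<beta> t)) has_field_derivative f') (at t)" by blast
qed

lemma hol2_cnj:
  assumes "hol2 N g"
  shows "hol2 {p. (cnj (fst p), cnj (snd p)) \<in> N} (\<lambda>z w. cnj (g (cnj z) (cnj w)))"
  unfolding hol2_def
proof (intro conjI ballI)
  have "continuous_on UNIV (\<lambda>p. (cnj (fst p), cnj (snd p)))" by (intro continuous_intros)
  then show "open {p. (cnj (fst p), cnj (snd p)) \<in> N}"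
    using assms open_vimage[of N] unfolding hol2_def vimage_def by blast
  fix p assume "p \<in> {p. (cnj (fst p), cnj (snd p)) \<in> N}"
  then obtain a b where ab: "(case_prod g has_derivative (\<lambda>q. a * fst q + b * snd q)) (at (cnj (fst p), cnj (snd p)))"
    using assms unfolding hol2_def by blast
  have "((\<lambda>p. (cnj (fst p), cnj (snd p))) has_derivative (\<lambda>q. (cnj (fst q), cnj (snd q)))) (at p)"
    by (intro has_derivative_Pair has_derivative_cnj has_derivative_fst has_derivative_snd has_derivative_ident)
  from has_derivative_cnj[OF has_derivative_compose[OF this ab]]
  have "((\<lambda>(z, w). cnj (g (cnj z) (cnj w))) has_derivative (\<lambda>q. cnj a * fst q + cnj b * snd q)) (at p)"
    by (simp add: case_prod_unfold)
  then show "\<exists>a b. ((\<lambda>(z, w). cnj (g (cnj z) (cnj w))) has_derivative (\<lambda>q. a * fst q + b * snd q)) (at p)"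
    by blast
qed

text \<open>Cauchy's inequality bounds the difference of two derivatives by the difference of the functions on a circle,
  which is small by uniform continuity on a compact product.\<close>

lemma deriv_jointly_continuous:
  fixes g :: "'a::{metric_space,heine_borel} \<Rightarrow> complex \<Rightarrow> complex"
  assumes "open A" "open B" and cont: "continuous_on (A \<times> B) (case_prod g)"
    and hol: "\<And>z. z \<in> A \<Longrightarrow> g z holomorphic_on B"
  shows "continuous_on (A \<times> B) (\<lambda>(z, w). deriv (g z) w)"
  unfolding continuous_on_iff
proof clarify
  fix z0 w0 and e :: real assume z0: "z0 \<in> A" and w0: "w0 \<in> B" and e: "0 < e"
  obtain s where s: "s > 0" "cball z0 s \<subseteq> A" using assms(1) z0 open_contains_cball by blast
  obtain r where r: "r > 0" "cball w0 r \<subseteq> B" using assms(2) w0 open_contains_cball by blast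
  have "uniformly_continuous_on (cball z0 s \<times> cball w0 r) (case_prod g)"
    by (intro compact_uniformly_continuous continuous_on_subset[OF cont] compact_Times) (use s r in auto)
  then obtain d where d: "d > 0" "\<And>z w z' w'. z \<in> cball z0 s \<Longrightarrow> w \<in> cball w0 r \<Longrightarrow> z' \<in> cball z0 s \<Longrightarrow>
      w' \<in> cball w0 r \<Longrightarrow> dist (z', w') (z, w) < d \<Longrightarrow> dist (g z' w') (g z w) < e * r / 8"
    unfolding uniformly_continuous_on_def using e r(1)
    by (metis (no_types, lifting) case_prod_conv divide_pos_pos mem_Sigma_iff mult_pos_pos zero_less_numeral)
  have "continuous_on B (deriv (g z0))"
    by (intro holomorphic_on_imp_continuous_on holomorphic_deriv hol z0 assms(2))
  then obtain d' where d': "d' > 0" "\<And>w. w \<in> B \<Longrightarrow> dist w w0 < d' \<Longrightarrow> dist (deriv (g z0) w) (deriv (g z0) w0) < e / 2"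
    using w0 e unfolding continuous_on_iff by (metis half_gt_zero)
  show "\<exists>d>0. \<forall>x'\<in>A \<times> B. dist x' (z0, w0) < d \<longrightarrow>
      dist (case x' of (z, w) \<Rightarrow> deriv (g z) w) (deriv (g z0) w0) < e"
  proof (intro exI[of _ "min (min d d') (min s (r/2))"] conjI ballI impI)
    show "0 < min (min d d') (min s (r/2))" using d d' s r by auto
    fix x' assume x': "x' \<in> A \<times> B" "dist x' (z0, w0) < min (min d d') (min s (r/2))"
    obtain z w where zw: "x' = (z, w)" "z \<in> A" "w \<in> B" using x'(1) by (meson SigmaE)
    have dz: "dist z z0 < min (min d d') (min s (r/2))" "dist w w0 < min (min d d') (min s (r/2))"
      using x'(2) dist_fst_le[of x' "(z0,w0)"] dist_snd_le[of x' "(z0,w0)"] zw(1) by auto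
    have sub: "cball w (r/2) \<subseteq> cball w0 r"
    proof
      fix u assume "u \<in> cball w (r/2)"
      then show "u \<in> cball w0 r" using dz(2) dist_triangle[of w0 u w] by (simp add: dist_commute)
    qed
    have "norm ((deriv ^^ 1) (\<lambda>u. g z u - g z0 u) w) \<le> fact 1 * (e * r / 8) / (r/2) ^ 1"
    proof (rule Cauchy_inequality)
      have *: "(\<lambda>u. g z u - g z0 u) holomorphic_on cball w (r/2)"
        by (intro holomorphic_intros holomorphic_on_subset[OF hol]) (use zw z0 sub r in auto)
      then show "(\<lambda>u. g z u - g z0 u) holomorphic_on ball w (r/2)"
        by (rule holomorphic_on_subset) auto
      show "continuous_on (cball w (r/2)) (\<lambda>u. g z u - g z0 u)"
        using * by (rule holomorphic_on_imp_continuous_on)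
      show "0 < r/2" using r by simp
      fix u assume "cmod (w - u) = r/2"
      then have "u \<in> cball w0 r" using sub by (auto simp: dist_norm)
      then have "dist (g z u) (g z0 u) < e * r / 8"
        using dz(1) s(1) d(2)[of z0 u z u] by (auto simp: dist_Pair_Pair dist_commute)
      then show "cmod (g z u - g z0 u) \<le> e * r / 8" by (simp add: dist_norm)
    qed
    moreover have "deriv (\<lambda>u. g z u - g z0 u) w = deriv (g z) w - deriv (g z0) w"
      using hol[OF zw(2)] hol[OF z0] zw(3) assms(2) holomorphic_on_imp_differentiable_at by (intro deriv_diff) auto
    ultimately have "dist (deriv (g z) w) (deriv (g z0) w) \<le> e / 4"
      using r(1) by (simp add: dist_norm field_simps)
    moreover have "dist (deriv (g z0) w) (deriv (g z0) w0) < e / 2"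
      using d'(2)[OF zw(3)] dz(2) by auto
    ultimately have "dist (deriv (g z) w) (deriv (g z0) w0) < e"
      using dist_triangle[of "deriv (g z) w" "deriv (g z0) w0" "deriv (g z0) w"] e by linarith
    then show "dist (case x' of (z, w) \<Rightarrow> deriv (g z) w) (deriv (g z0) w0) < e" by (simp add: zw)
  qed
qed

text \<open>Joint continuity of the function makes one partial derivative jointly continuous, and this already gives total
  differentiability.\<close>

lemma hol2I:
  assumes AB: "open A" "open B" and cont: "continuous_on (A \<times> B) (case_prod g)"
    and hol1: "\<And>w. w \<in> B \<Longrightarrow> (\<lambda>z. g z w) holomorphic_on A"
    and hol2: "\<And>z. z \<in> A \<Longrightarrow> g z holomorphic_on B"
  shows "hol2 (A \<times> B) g"
  unfolding hol2_def
proof (intro conjI ballI)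
  show "open (A \<times> B)" using AB by (rule open_Times)
  fix p assume "p \<in> A \<times> B"
  then obtain z w where zw: "p = (z, w)" "z \<in> A" "w \<in> B" by (meson SigmaE)
  obtain s where s: "s > 0" "ball z s \<subseteq> A" using AB(1) zw(2) open_contains_ball by blast
  obtain r where r: "r > 0" "ball w r \<subseteq> B" using AB(2) zw(3) open_contains_ball by blast
  have c: "continuous_on (A \<times> B) (\<lambda>(z, w). deriv (g z) w)"
    by (rule deriv_jointly_continuous[OF AB cont hol2])
  have "continuous (at (z, w)) (\<lambda>(z, w). deriv (g z) w)"
    using c zw AB by (auto simp: continuous_on_eq_continuous_at open_Times)
  then have c': "continuous (at (z, w)) (\<lambda>(z, w). blinfun_mult_right (deriv (g z) w))"
    unfolding split_beta by (intro bounded_linear.continuous[OF bounded_linear_blinfun_mult_right]) (simp add: split_beta)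
  have "((\<lambda>(x, y). g x y) has_derivative
     (\<lambda>(tx, ty). deriv (\<lambda>z. g z w) z * tx + blinfun_apply (blinfun_mult_right (deriv (g z) w)) ty)) (at (z, w) within ball z s \<times> ball w r)"
  proof (rule has_derivative_partialsI)
    show "((\<lambda>x. g x w) has_derivative (*) (deriv (\<lambda>z. g z w) z)) (at z within ball z s)"
      using holomorphic_derivI[OF hol1[OF zw(3)] AB(1) zw(2)]
      by (auto simp: has_field_derivative_def intro: has_derivative_at_withinI)
    show "(g x has_derivative blinfun_apply (blinfun_mult_right (deriv (g x) y))) (at y within ball w r)"
      if "x \<in> ball z s" "y \<in> ball w r" for x y
      using holomorphic_derivI[OF hol2[of x] AB(2), of y "ball w r"] that s r
      unfolding has_field_derivative_def blinfun_mult_right.rep_eq by blast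
    show "continuous (at (z, w) within ball z s \<times> ball w r) (\<lambda>(x, y). blinfun_mult_right (deriv (g x) y))"
      using c' by (rule continuous_at_imp_continuous_at_within)
  qed (use r in auto)
  moreover have "at (z, w) within ball z s \<times> ball w r = at (z, w)"
    using s r by (intro at_within_open open_Times) auto
  ultimately have "(case_prod g has_derivative
      (\<lambda>q. deriv (\<lambda>z. g z w) z * fst q + deriv (g z) w * snd q)) (at (z, w))"
    by (simp add: case_prod_unfold)
  then show "\<exists>a b. (case_prod g has_derivative (\<lambda>q. a * fst q + b * snd q)) (at p)"
    unfolding zw by blast
qed

lemma hol2_sections:
  assumes "hol2 (A \<times> B) g" "open A" "open B"
  shows "w \<in> B \<Longrightarrow> (\<lambda>z. g z w) holomorphic_on A" "z \<in> A \<Longrightarrow> g z holomorphic_on B"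
  using hol2_compose[OF assms(1), of "\<lambda>z. z" A "\<lambda>_. w"] hol2_compose[OF assms(1), of "\<lambda>_. z" B "\<lambda>w. w"]
    assms(2,3) by (auto intro!: holomorphic_intros)

lemma hol2_swap: "hol2 (A \<times> B) g \<Longrightarrow> open A \<Longrightarrow> open B \<Longrightarrow> hol2 (B \<times> A) (\<lambda>w z. g z w)"
proof (rule hol2I)
  assume h: "hol2 (A \<times> B) g" and AB: "open A" "open B"
  show "continuous_on (B \<times> A) (\<lambda>(w, z). g z w)"
    using continuous_on_swap_args[of A B g] hol2_continuous_on[OF h]
    by (simp add: split_beta)
qed (use hol2_sections in blast)+

text \<open>Holomorphy in the first variable holds because the derivative is a locally uniform limit of difference
  quotients.\<close>

lemma hol2_deriv2:
  assumes g: "hol2 (A \<times> B) g" and AB: "open A" "open B"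
  shows "hol2 (A \<times> B) (\<lambda>z w. deriv (g z) w)"
proof (rule hol2I[OF AB])
  note sec = hol2_sections[OF g AB]
  show cont: "continuous_on (A \<times> B) (\<lambda>(z, w). deriv (g z) w)"
    by (rule deriv_jointly_continuous[OF AB hol2_continuous_on[OF g]]) (rule sec)
  show "deriv (g z) holomorphic_on B" if "z \<in> A" for z
    by (rule holomorphic_deriv[OF sec(2)[OF that] AB(2)])
  fix w assume w: "w \<in> B"
  obtain r where r: "r > 0" "cball w r \<subseteq> B" using AB(2) w open_contains_cball by blast
  define h where "h = (\<lambda>n. of_real (r / (real n + 1)) :: complex)"
  have nh: "norm (h n) = r / (real n + 1)" for n using r(1) unfolding h_def norm_of_real by simp
  have h: "h n \<noteq> 0" "w + h n \<in> cball w r" for n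
    using r(1) nh[of n] by (auto simp: dist_norm field_simps)
  show "(\<lambda>z. deriv (g z) w) holomorphic_on A"
  proof (rule holomorphic_uniform_sequence[OF AB(1)])
    show "(\<lambda>z. (g z (w + h n) - g z w) / h n) holomorphic_on A" for n
      using h[of n] r w by (intro holomorphic_intros sec(1)) auto
    fix z assume z: "z \<in> A"
    obtain s where s: "s > 0" "cball z s \<subseteq> A" using AB(1) z open_contains_cball by blast
    have uc: "uniformly_continuous_on (cball z s \<times> cball w r) (\<lambda>(z, w). deriv (g z) w)"
      by (intro compact_uniformly_continuous continuous_on_subset[OF cont] compact_Times) (use s r in auto)
    have "uniform_limit (cball z s) (\<lambda>n z. (g z (w + h n) - g z w) / h n) (\<lambda>z. deriv (g z) w) sequentially"
      unfolding uniform_limit_iff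
    proof (intro allI impI)
      fix e :: real assume e: "e > 0"
      obtain d where d: "d > 0" "\<And>x y. x \<in> cball z s \<times> cball w r \<Longrightarrow> y \<in> cball z s \<times> cball w r \<Longrightarrow> dist y x < d \<Longrightarrow>
         dist (case y of (z, w) \<Rightarrow> deriv (g z) w) (case x of (z, w) \<Rightarrow> deriv (g z) w) < e/2"
        using uc e unfolding uniformly_continuous_on_def by (meson half_gt_zero)
      have "(\<lambda>n. r / (real n + 1)) \<longlonglongrightarrow> 0" by real_asymp
      then have "\<forall>\<^sub>F n in sequentially. r / (real n + 1) < d" using d(1) by (rule order_tendstoD)
      then show "\<forall>\<^sub>F n in sequentially. \<forall>x\<in>cball z s. dist ((g x (w + h n) - g x w) / h n) (deriv (g x) w) < e"
      proof (eventually_elim, intro ballI)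
        fix n x assume n: "r / (real n + 1) < d" and x: "x \<in> cball z s"
        have "norm ((g x (w + h n) - deriv (g x) w * (w + h n)) - (g x w - deriv (g x) w * w)) \<le> e/2 * norm (w + h n - w)"
        proof (rule field_differentiable_bound[of "closed_segment w (w + h n)"])
          fix u assume u: "u \<in> closed_segment w (w + h n)"
          have ucb: "u \<in> cball w r" using u h(2)[of n] r(1) closed_segment_subset[of w "cball w r" "w + h n"] by auto
          have "dist u w \<le> norm (h n)" using u dist_in_closed_segment[of u w "w + h n"] by (simp add: dist_norm)
          then have "dist (x, u) (x, w) < d" using n nh[of n] by (simp add: dist_Pair_Pair)
          then have "dist (deriv (g x) u) (deriv (g x) w) < e/2"
            using d(2)[of "(x, w)" "(x, u)"] x ucb r(1) by auto
          then show "norm (deriv (g x) u - deriv (g x) w) \<le> e/2" by (simp add: dist_norm)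
          have xA: "x \<in> A" and uB: "u \<in> B" using x s ucb r by auto
          have "(g x has_field_derivative deriv (g x) u) (at u)"
            by (rule holomorphic_derivI[OF sec(2)[OF xA] AB(2) uB])
          from DERIV_diff[OF this DERIV_cmult[OF DERIV_ident]]
          have "((\<lambda>u. g x u - deriv (g x) w * u) has_field_derivative deriv (g x) u - deriv (g x) w) (at u)"
            by simp
          then show "((\<lambda>u. g x u - deriv (g x) w * u) has_field_derivative deriv (g x) u - deriv (g x) w) (at u within closed_segment w (w + h n))"
            by (rule has_field_derivative_at_within)
        qed auto
        then have *: "norm (g x (w + h n) - g x w - deriv (g x) w * h n) \<le> e/2 * norm (h n)"
          by (simp add: algebra_simps)
        have "dist ((g x (w + h n) - g x w) / h n) (deriv (g x) w)
            = norm (g x (w + h n) - g x w - deriv (g x) w * h n) / norm (h n)"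
          using h(1)[of n] by (simp add: dist_norm norm_divide[symmetric] diff_divide_distrib)
        also have "\<dots> \<le> e/2" using * h(1)[of n] by (simp add: divide_le_eq)
        finally show "dist ((g x (w + h n) - g x w) / h n) (deriv (g x) w) < e" using e by simp
      qed
    qed
    then show "\<exists>d>0. cball z d \<subseteq> A \<and> uniform_limit (cball z d) (\<lambda>n z. (g z (w + h n) - g z w) / h n) (\<lambda>z. deriv (g z) w) sequentially"
      using s by blast
  qed
qed

lemma hol2_deriv1:
  assumes g: "hol2 (A \<times> B) g" and AB: "open A" "open B"
  shows "hol2 (A \<times> B) (\<lambda>z w. deriv (\<lambda>z. g z w) z)"
  using hol2_swap[OF hol2_deriv2[OF hol2_swap[OF g AB] AB(2,1)] AB(2,1)] .

lemma hol2_chain_deriv: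
  assumes g: "hol2 (A \<times> B) g" and AB: "open A" "open B" and t: "t \<in> A" "\<beta> t \<in> B"
    and \<beta>: "(\<beta> has_field_derivative \<beta>') (at t)"
  shows "((\<lambda>t. g t (\<beta> t)) has_field_derivative
     (deriv (\<lambda>z. g z (\<beta> t)) t + deriv (g t) (\<beta> t) * \<beta>')) (at t)"
proof -
  obtain a b where ab: "(case_prod g has_derivative (\<lambda>q. a * fst q + b * snd q)) (at (t, \<beta> t))"
    using g t unfolding hol2_def by (metis SigmaI)
  have "((\<lambda>z. g z (\<beta> t)) has_field_derivative a * 1 + b * 0) (at t)"
    by (rule hol2_chain[of g a b "\<lambda>z. z" t "\<lambda>_. \<beta> t"]) (use ab in \<open>auto intro!: derivative_eq_intros\<close>)
  moreover have "(g t has_field_derivative a * 0 + b * 1) (at (\<beta> t))"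
    by (rule hol2_chain[of g a b "\<lambda>_. t" _ "\<lambda>w. w"]) (use ab in \<open>auto intro!: derivative_eq_intros\<close>)
  ultimately have "deriv (\<lambda>z. g z (\<beta> t)) t = a" "deriv (g t) (\<beta> t) = b"
    by (auto intro: DERIV_imp_deriv)
  moreover have "((\<lambda>t. g t (\<beta> t)) has_field_derivative a * 1 + b * \<beta>') (at t)"
    by (rule hol2_chain[of g a b "\<lambda>z. z" t \<beta>]) (use ab \<beta> in \<open>auto intro!: derivative_eq_intros\<close>)
  ultimately show ?thesis by simp
qed

lemma hol2_poly:
  assumes "open V" "\<And>i. i \<le> d \<Longrightarrow> a i holomorphic_on V"
  shows "hol2 (UNIV \<times> V) (\<lambda>z w. \<Sum>i\<le>d. a i w * z ^ i)"
proof (rule hol2I)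
  have "continuous_on (UNIV \<times> V) (\<lambda>p. a i (snd p))" if "i \<le> d" for i
    by (rule continuous_on_compose2[OF holomorphic_on_imp_continuous_on[OF assms(2)[OF that]]])
      (auto intro!: continuous_intros)
  then show "continuous_on (UNIV \<times> V) (\<lambda>(z, w). \<Sum>i\<le>d. a i w * z ^ i)"
    unfolding split_beta by (intro continuous_intros) auto
qed (use assms in \<open>auto intro!: holomorphic_intros\<close>)

section \<open>Polarization and Segre varieties\<close>

text \<open>A Hermitian form of signature \<open>sg\<close> in \<open>G\<close>, with the conjugated argument \<open>(\<zeta>, \<eta>)\<close> treated as independent.
  It is holomorphic in all four variables.\<close>

definition pairing :: "('k::finite \<Rightarrow> complex) \<Rightarrow> ('k \<Rightarrow> complex \<Rightarrow> complex \<Rightarrow> complex) \<Rightarrow>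
    complex \<Rightarrow> complex \<Rightarrow> complex \<Rightarrow> complex \<Rightarrow> complex" where
  "pairing sg G z w \<zeta> \<eta> = (\<Sum>k\<in>UNIV. sg k * (G k z w * cnj (G k (cnj \<zeta>) (cnj \<eta>))))"

lemma holomorphic_pairing:
  assumes "\<And>k. hol2 N (G k)" "open S"
    and "\<alpha> holomorphic_on S" "\<omega> holomorphic_on S" "\<beta> holomorphic_on S" "\<eta> holomorphic_on S"
    and "\<And>t. t \<in> S \<Longrightarrow> (\<alpha> t, \<omega> t) \<in> N" "\<And>t. t \<in> S \<Longrightarrow> (cnj (\<beta> t), cnj (\<eta> t)) \<in> N"
  shows "(\<lambda>t. pairing sg G (\<alpha> t) (\<omega> t) (\<beta> t) (\<eta> t)) holomorphic_on S"
  unfolding pairing_def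
proof (intro holomorphic_intros)
  fix k
  show "(\<lambda>t. G k (\<alpha> t) (\<omega> t)) holomorphic_on S"
    by (rule hol2_compose[OF assms(1,3,4,2,7)])
  show "(\<lambda>t. cnj (G k (cnj (\<beta> t)) (cnj (\<eta> t)))) holomorphic_on S"
    by (rule hol2_compose[OF hol2_cnj[OF assms(1)] assms(5,6,2)]) (simp add: assms(8))
qed

lemma frequently_filterlim:
  assumes "filterlim f F G" "G \<noteq> bot" "\<And>x. Q (f x)"
  shows "frequently Q F"
  unfolding frequently_def
proof
  assume "eventually (\<lambda>x. \<not> Q x) F"
  then have "eventually (\<lambda>x. \<not> Q (f x)) G" using assms(1) by (rule eventually_compose_filterlim)
  with assms(2,3) show False by simp
qed

text \<open>The real axis and circles (the next lemma) are sets of uniqueness for holomorphic functions.\<close>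

lemma frequently_real: "\<exists>\<^sub>F x in at (complex_of_real r). x \<in> \<real>"
proof -
  have "filterlim (\<lambda>n. complex_of_real (r + 1 / (real n + 1))) (at (complex_of_real r)) sequentially"
  proof (rule filterlim_atI)
    have "(\<lambda>n. r + 1 / (real n + 1)) \<longlonglongrightarrow> r" by real_asymp
    then show "(\<lambda>n. complex_of_real (r + 1 / (real n + 1))) \<longlonglongrightarrow> complex_of_real r" by (rule tendsto_of_real)
    show "\<forall>\<^sub>F n in sequentially. complex_of_real (r + 1 / (real n + 1)) \<noteq> complex_of_real r"
      by (intro always_eventually allI) (simp add: add_nonneg_eq_0_iff del: of_real_add of_real_divide)
  qed
  then show ?thesis by (rule frequently_filterlim) auto
qed

lemma frequently_circle:
  assumes "v \<noteq> 0"
  shows "\<exists>\<^sub>F w in at v. w * cnj w = v * cnj v"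
proof -
  have lim: "filterlim (\<lambda>n. v * cis (1 / (real n + 1))) (at v) sequentially"
  proof (rule filterlim_atI)
    have "(\<lambda>n. 1 / (real n + 1)) \<longlonglongrightarrow> 0" by real_asymp
    then have "(\<lambda>n. v * cis (1 / (real n + 1))) \<longlonglongrightarrow> v * exp (\<i> * of_real 0)"
      unfolding cis_conv_exp by (intro tendsto_intros)
    then show "(\<lambda>n. v * cis (1 / (real n + 1))) \<longlonglongrightarrow> v" by simp
    have "cis (1 / (real n + 1)) \<noteq> 1" for n
    proof -
      have "0 < 1 / (real n + 1)" "1 / (real n + 1) \<le> 1" by auto
      then have "0 < sin (1 / (real n + 1))" using pi_gt3 by (intro sin_gt_zero) linarith+
      then show ?thesis by (auto simp: complex_eq_iff)
    qed
    then show "\<forall>\<^sub>F n in sequentially. v * cis (1 / (real n + 1)) \<noteq> v"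
      using assms by (intro always_eventually allI) auto
  qed
  have "cis t * cnj (cis t) = 1" for t by (simp add: cis_cnj cis_mult)
  then have "v * cis t * cnj (v * cis t) = v * cnj v" for t by (simp add: algebra_simps)
  then show ?thesis
    by (intro frequently_filterlim[OF lim]) auto
qed

text \<open>\<open>P\<close> is a polynomial with symmetric real coefficients, sorted by powers of the second variable.\<close>

locale segre =
  fixes pc :: "nat \<Rightarrow> complex poly" and deg :: nat and P :: "complex \<Rightarrow> complex \<Rightarrow> complex"
  assumes P_eq: "P z \<zeta> = (\<Sum>j\<le>deg. poly (pc j) z * \<zeta> ^ j)"
    and P_sym: "P z \<zeta> = P \<zeta> z"
    and P_cnj: "cnj (P z \<zeta>) = P (cnj z) (cnj \<zeta>)"
begin

lemma P_diag_real: "P z (cnj z) \<in> \<real>"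
  using P_cnj[of z "cnj z"] P_sym by (simp add: Reals_cnj_iff)

lemma P_holomorphic [holomorphic_intros]:
  "f holomorphic_on S \<Longrightarrow> g holomorphic_on S \<Longrightarrow> (\<lambda>t. P (f t) (g t)) holomorphic_on S"
  unfolding P_eq by (intro holomorphic_intros)

lemma P_continuous [continuous_intros]:
  "continuous_on S f \<Longrightarrow> continuous_on S g \<Longrightarrow> continuous_on S (\<lambda>t. P (f t) (g t))"
  unfolding P_eq by (intro continuous_intros)

text \<open>The hypersurface \<open>|w|\<^sup>2 = 1 - P(z, cnj z)\<close>, written with conjugates so that it polarizes to
  \<open>w * \<eta> = 1 - P z \<zeta>\<close>.\<close>

definition on_M :: "complex \<Rightarrow> complex \<Rightarrow> bool" where
  "on_M z w \<longleftrightarrow> w * cnj w = 1 - P z (cnj z)"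

lemma holomorphic_segre_pairing:
  assumes "\<And>k. hol2 (A \<times> B) (G k)" "open S"
    and "\<alpha> holomorphic_on S" "\<beta> holomorphic_on S" "\<gamma> holomorphic_on S"
    and mem: "\<And>t. t \<in> S \<Longrightarrow> \<alpha> t \<in> A \<and> \<gamma> t \<in> B \<and> \<gamma> t \<noteq> 0 \<and> cnj (\<beta> t) \<in> A \<and>
        cnj ((1 - P (\<alpha> t) (\<beta> t)) / \<gamma> t) \<in> B"
  shows "(\<lambda>t. pairing sg G (\<alpha> t) (\<gamma> t) (\<beta> t) ((1 - P (\<alpha> t) (\<beta> t)) / \<gamma> t)) holomorphic_on S"
proof (rule holomorphic_pairing[OF assms(1,2,3,5,4)])
  show "(\<lambda>t. (1 - P (\<alpha> t) (\<beta> t)) / \<gamma> t) holomorphic_on S"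
    using mem by (intro holomorphic_intros assms) blast
qed (use mem in blast)+

text \<open>The hypersurface is a maximally totally real submanifold of its complexification
  \<open>w * \<eta> = 1 - P z \<zeta>\<close>, on which \<open>(z, \<zeta>, w)\<close> are coordinates for \<open>w \<noteq> 0\<close>. For fixed \<open>z\<close> the identity first spreads from a circle in \<open>w\<close>
  to a disc, and then in the coordinates \<open>x = (z + \<zeta>) / 2\<close> and \<open>y = (z - \<zeta>) / 2i\<close> from real to complex
  values.\<close>

lemma polarization:
  assumes AB: "open A" "open B" and G: "\<And>k. hol2 (A \<times> B) (G k)"
    and p: "z1 \<in> A" "w1 \<in> B" "w1 \<noteq> 0" "on_M z1 w1"
    and zero: "\<And>z w. z \<in> A \<Longrightarrow> w \<in> B \<Longrightarrow> on_M z w \<Longrightarrow> pairing sg G z w (cnj z) (cnj w) = 0"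
  shows "\<exists>\<delta>>0. \<forall>z \<zeta> w. dist z z1 < \<delta> \<longrightarrow> dist \<zeta> (cnj z1) < \<delta> \<longrightarrow> dist w w1 < \<delta> \<longrightarrow>
       z \<in> A \<and> w \<in> B \<and> w \<noteq> 0 \<and> cnj \<zeta> \<in> A \<and> cnj ((1 - P z \<zeta>) / w) \<in> B \<and>
       pairing sg G z w \<zeta> ((1 - P z \<zeta>) / w) = 0"
proof -
  define U where "U = A \<times> {\<zeta>. cnj \<zeta> \<in> A} \<times> (B - {0})"
  have opA: "open {\<zeta>. cnj \<zeta> \<in> A}" "open {\<zeta>. cnj \<zeta> \<in> B}"
    using open_vimage[OF AB(1), of cnj] open_vimage[OF AB(2), of cnj]
    by (auto simp: vimage_def intro!: continuous_intros)
  have U: "open U" unfolding U_def using AB opA by (intro open_Times) auto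
  have "open (U \<inter> (\<lambda>t. (1 - P (fst t) (fst (snd t))) / snd (snd t)) -` {\<zeta>. cnj \<zeta> \<in> B})"
    by (rule continuous_open_preimage[OF _ U opA(2)]) (auto intro!: continuous_intros simp: U_def)
  also have "U \<inter> (\<lambda>t. (1 - P (fst t) (fst (snd t))) / snd (snd t)) -` {\<zeta>. cnj \<zeta> \<in> B} =
      {t \<in> U. (1 - P (fst t) (fst (snd t))) / snd (snd t) \<in> {\<zeta>. cnj \<zeta> \<in> B}}" by auto
  finally have "open {t \<in> U. (1 - P (fst t) (fst (snd t))) / snd (snd t) \<in> {\<zeta>. cnj \<zeta> \<in> B}}" .
  moreover have "(z1, cnj z1, w1) \<in> {t \<in> U. (1 - P (fst t) (fst (snd t))) / snd (snd t) \<in> {\<zeta>. cnj \<zeta> \<in> B}}"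
  proof -
    have "(1 - P z1 (cnj z1)) / w1 = cnj w1" using p(3,4) by (simp add: on_M_def field_simps)
    then have "cnj ((1 - P z1 (cnj z1)) / w1) \<in> B" using p(2) by (simp only: complex_cnj_cnj)
    then show ?thesis using p by (simp add: U_def)
  qed
  ultimately obtain r where r: "r > 0"
      "ball (z1, cnj z1, w1) r \<subseteq> {t \<in> U. (1 - P (fst t) (fst (snd t))) / snd (snd t) \<in> {\<zeta>. cnj \<zeta> \<in> B}}"
    using open_contains_ball by blast
  define r0 where "r0 = r / 3"
  have r0: "r0 > 0" using r(1) by (simp add: r0_def)
  have mem: "z \<in> A \<and> w \<in> B \<and> w \<noteq> 0 \<and> cnj \<zeta> \<in> A \<and> cnj ((1 - P z \<zeta>) / w) \<in> B"
    if "dist z z1 < r0" "dist \<zeta> (cnj z1) < r0" "dist w w1 < r0" for z \<zeta> w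
  proof -
    have "dist (z, \<zeta>, w) (z1, cnj z1, w1) \<le> dist z z1 + dist (\<zeta>, w) (cnj z1, w1)"
      unfolding dist_Pair_Pair[of z] by (rule sqrt_sum_squares_le_sum) auto
    also have "dist (\<zeta>, w) (cnj z1, w1) \<le> dist \<zeta> (cnj z1) + dist w w1"
      unfolding dist_Pair_Pair by (rule sqrt_sum_squares_le_sum) auto
    finally have "(z, \<zeta>, w) \<in> ball (z1, cnj z1, w1) r" using that by (simp add: dist_commute r0_def)
    then show ?thesis using r(2) by (auto simp: U_def)
  qed
  define rho where "rho = (\<lambda>z. sqrt (Re (1 - P z (cnj z))))"
  have "1 - P z1 (cnj z1) = of_real ((cmod w1)\<^sup>2)"
    using p(4) unfolding on_M_def complex_norm_square by simp
  then have rho1: "rho z1 = cmod w1" unfolding rho_def by (simp only: Re_complex_of_real real_sqrt_abs abs_norm_cancel)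
  have "continuous_on UNIV rho" unfolding rho_def by (intro continuous_intros)
  then have "isCont rho z1" by (simp add: continuous_on_eq_continuous_at)
  then obtain s where s: "s > 0" "\<And>z. dist z z1 < s \<Longrightarrow> dist (rho z) (rho z1) < min r0 (cmod w1)"
    using r0 p(3) unfolding continuous_at_eps_delta by (metis min_less_iff_conj zero_less_norm_iff)
  define \<delta>0 where "\<delta>0 = min r0 s"
  have \<delta>0: "\<delta>0 > 0" "\<delta>0 \<le> r0" "\<delta>0 \<le> s" using r0 s by (auto simp: \<delta>0_def)
  define \<Psi> where "\<Psi> = (\<lambda>z \<zeta> w. pairing sg G z w \<zeta> ((1 - P z \<zeta>) / w))"
  have stepa: "\<Psi> z (cnj z) w = 0" if z: "dist z z1 < \<delta>0" and w: "dist w w1 < r0" for z w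
  proof -
    have dc: "dist (cnj z) (cnj z1) < r0" using z \<delta>0 by (simp add: dist_norm flip: complex_cnj_diff)
    have rz: "\<bar>rho z - cmod w1\<bar> < r0" "rho z > 0"
      using s(2)[of z] z \<delta>0(3) rho1 by (auto simp: dist_real_def)
    then have rz2: "complex_of_real (rho z) ^ 2 = 1 - P z (cnj z)"
      using P_diag_real[of z] by (auto simp: rho_def complex_eq_iff complex_is_Real_iff simp flip: of_real_power)
    \<comment> \<open>the point of the hypersurface above \<open>z\<close> that has the same argument as \<open>w1\<close>\<close>
    define v where "v = of_real (rho z / cmod w1) * w1"
    have "v - w1 = of_real ((rho z - cmod w1) / cmod w1) * w1"
      using p(3) by (simp add: v_def field_simps)
    then have "norm (v - w1) = \<bar>(rho z - cmod w1) / cmod w1\<bar> * cmod w1"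
      by (simp only: norm_mult norm_of_real)
    then have "norm (v - w1) = \<bar>rho z - cmod w1\<bar>" using p(3) by simp
    then have vb: "v \<in> ball w1 r0" using rz(1) by (simp add: dist_norm norm_minus_commute)
    have v0: "v \<noteq> 0" using rz(2) p(3) by (simp add: v_def)
    have vv: "v * cnj v = 1 - P z (cnj z)"
    proof -
      have "v * cnj v = of_real ((rho z / cmod w1)\<^sup>2) * (w1 * cnj w1)" by (simp add: v_def power2_eq_square algebra_simps)
      also have "\<dots> = of_real (rho z ^ 2)" using p(3) by (simp add: complex_norm_square[symmetric] field_simps)
      finally show ?thesis using rz2 by simp
    qed
    show ?thesis
    proof (rule holomorphic_frequently_zero[OF open_ball _ vb, where h = "\<lambda>w. \<Psi> z (cnj z) w"])
      show "(\<lambda>w. \<Psi> z (cnj z) w) holomorphic_on ball w1 r0"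
        unfolding \<Psi>_def
      proof (rule holomorphic_segre_pairing[OF G])
        fix w assume "w \<in> ball w1 r0"
        then show "z \<in> A \<and> w \<in> B \<and> w \<noteq> 0 \<and> cnj (cnj z) \<in> A \<and> cnj ((1 - P z (cnj z)) / w) \<in> B"
          using mem[OF _ dc, of z w] z \<delta>0 by (simp add: dist_commute)
      qed (auto intro!: holomorphic_intros)
      have "\<forall>\<^sub>F w in at v. w \<in> ball w1 r0" using vb by (intro eventually_at_in_open') auto
      with frequently_circle[OF v0] have "\<exists>\<^sub>F w in at v. w \<in> ball w1 r0 \<and> w * cnj w = v * cnj v"
        by (rule frequently_eventually_conj)
      then show "\<exists>\<^sub>F w in at v. \<Psi> z (cnj z) w = 0"
      proof (rule frequently_elim1, elim conjE)
        fix w assume w: "w \<in> ball w1 r0" "w * cnj w = v * cnj v"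
        then have m: "z \<in> A" "w \<in> B" "w \<noteq> 0" using mem[OF _ dc, of z w] z \<delta>0 by (simp_all add: dist_commute)
        have "(1 - P z (cnj z)) / w = cnj w" using w(2) vv m(3) by (simp add: field_simps)
        then show "\<Psi> z (cnj z) w = 0"
          using zero[OF m(1,2)] w(2) vv by (simp add: \<Psi>_def on_M_def)
      qed
    qed (use w in \<open>auto simp: dist_commute\<close>)
  qed
  define \<delta> where "\<delta> = \<delta>0 / 2"
  have \<delta>: "\<delta> > 0" using \<delta>0 by (simp add: \<delta>_def)
  show ?thesis
  proof (intro exI[of _ \<delta>] conjI allI impI \<delta>)
    fix z \<zeta> w assume z: "dist z z1 < \<delta>" and \<zeta>: "dist \<zeta> (cnj z1) < \<delta>" and w: "dist w w1 < \<delta>"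
    have m: "z \<in> A \<and> w \<in> B \<and> w \<noteq> 0 \<and> cnj \<zeta> \<in> A \<and> cnj ((1 - P z \<zeta>) / w) \<in> B"
      using mem[of z \<zeta> w] z \<zeta> w \<delta>0 by (auto simp: \<delta>_def)
    then show "z \<in> A" "w \<in> B" "w \<noteq> 0" "cnj \<zeta> \<in> A" "cnj ((1 - P z \<zeta>) / w) \<in> B" by auto
    have w': "dist w w1 < r0" using w \<delta>0 by (simp add: \<delta>_def)
    define x0 y0 where "x0 = complex_of_real (Re z1)" and "y0 = complex_of_real (Im z1)"
    have z1: "z1 = x0 + \<i> * y0" "cnj z1 = x0 - \<i> * y0"
      by (auto simp: x0_def y0_def complex_eq_iff)
    have near: "dist (x + \<i> * y) z1 < \<delta>0" "dist (x - \<i> * y) (cnj z1) < \<delta>0"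
      if "x \<in> ball x0 \<delta>" "y \<in> ball y0 \<delta>" for x y
    proof -
      have *: "norm (x - x0) < \<delta>" "norm (\<i> * (y - y0)) < \<delta>" using that by (auto simp: dist_norm norm_minus_commute norm_mult)
      have e1: "x + \<i> * y - z1 = (x - x0) + \<i> * (y - y0)"
        by (subst z1(1)) (simp add: algebra_simps)
      have e2: "x - \<i> * y - cnj z1 = (x - x0) - \<i> * (y - y0)"
        by (subst z1(2)) (simp add: algebra_simps)
      show "dist (x + \<i> * y) z1 < \<delta>0" "dist (x - \<i> * y) (cnj z1) < \<delta>0"
        unfolding dist_norm e1 e2
        using norm_triangle_ineq[of "x - x0" "\<i> * (y - y0)"] norm_triangle_ineq4[of "x - x0" "\<i> * (y - y0)"] *
        unfolding \<delta>_def by linarith+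
    qed
    have hol: "(\<lambda>t. \<Psi> (\<alpha> t) (\<beta> t) w) holomorphic_on S"
      if "open S" "\<alpha> holomorphic_on S" "\<beta> holomorphic_on S" "\<And>t. t \<in> S \<Longrightarrow> dist (\<alpha> t) z1 < \<delta>0 \<and> dist (\<beta> t) (cnj z1) < \<delta>0" for S \<alpha> \<beta>
    proof -
      have mm: "\<alpha> t \<in> A \<and> w \<in> B \<and> w \<noteq> 0 \<and> cnj (\<beta> t) \<in> A \<and> cnj ((1 - P (\<alpha> t) (\<beta> t)) / w) \<in> B" if "t \<in> S" for t
        using \<open>\<And>t. t \<in> S \<Longrightarrow> _ t\<close>[OF that] \<delta>0 w' by (intro mem) auto
      show ?thesis
        unfolding \<Psi>_def
        by (rule holomorphic_segre_pairing[OF G that(1-3) _ mm]) (auto intro!: holomorphic_intros)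
    qed
    have x0b: "x0 \<in> ball x0 \<delta>" "y0 \<in> ball y0 \<delta>" using \<delta> by auto
    have R: "\<Psi> (x + \<i> * y) (x - \<i> * y) w = 0" if "x \<in> ball x0 \<delta>" "x \<in> \<real>" "y \<in> ball y0 \<delta>" "y \<in> \<real>" for x y
    proof -
      have "cnj (x + \<i> * y) = x - \<i> * y" using that by (simp add: Reals_cnj_iff)
      then show ?thesis using stepa[OF near(1)[OF that(1,3)] w'] by simp
    qed
    have Rx: "\<Psi> (x + \<i> * y) (x - \<i> * y) w = 0" if x: "x \<in> ball x0 \<delta>" and y: "y \<in> ball y0 \<delta>" "y \<in> \<real>" for x y
    proof (rule holomorphic_frequently_zero[OF open_ball _ x0b(1), where h = "\<lambda>x. \<Psi> (x + \<i> * y) (x - \<i> * y) w"])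
      show "(\<lambda>x. \<Psi> (x + \<i> * y) (x - \<i> * y) w) holomorphic_on ball x0 \<delta>"
        by (rule hol) (use near y in \<open>auto intro!: holomorphic_intros\<close>)
      have "\<forall>\<^sub>F x in at x0. x \<in> ball x0 \<delta>" using x0b by (intro eventually_at_in_open') auto
      with frequently_real[of "Re z1"] have "\<exists>\<^sub>F x in at x0. x \<in> ball x0 \<delta> \<and> x \<in> \<real>"
        unfolding x0_def[symmetric] by (rule frequently_eventually_conj)
      then show "\<exists>\<^sub>F x in at x0. \<Psi> (x + \<i> * y) (x - \<i> * y) w = 0"
        by (rule frequently_elim1) (use R y in blast)
    qed (use x in auto)
    have Rxy: "\<Psi> (x + \<i> * y) (x - \<i> * y) w = 0" if x: "x \<in> ball x0 \<delta>" and y: "y \<in> ball y0 \<delta>" for x y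
    proof (rule holomorphic_frequently_zero[OF open_ball _ x0b(2), where h = "\<lambda>y. \<Psi> (x + \<i> * y) (x - \<i> * y) w"])
      show "(\<lambda>y. \<Psi> (x + \<i> * y) (x - \<i> * y) w) holomorphic_on ball y0 \<delta>"
        by (rule hol) (use near x in \<open>auto intro!: holomorphic_intros\<close>)
      have "\<forall>\<^sub>F y in at y0. y \<in> ball y0 \<delta>" using x0b by (intro eventually_at_in_open') auto
      with frequently_real[of "Im z1"] have "\<exists>\<^sub>F y in at y0. y \<in> ball y0 \<delta> \<and> y \<in> \<real>"
        unfolding y0_def[symmetric] by (rule frequently_eventually_conj)
      then show "\<exists>\<^sub>F y in at y0. \<Psi> (x + \<i> * y) (x - \<i> * y) w = 0"
        by (rule frequently_elim1) (use Rx x in blast)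
    qed (use y in auto)
    define x y where "x = (z + \<zeta>) / 2" and "y = (z - \<zeta>) / (2 * \<i>)"
    have "(z - z1) + (\<zeta> - cnj z1) = z + \<zeta> - 2 * x0"
      by (subst z1(2), subst z1(1)) (simp add: algebra_simps)
    then have "x - x0 = ((z - z1) + (\<zeta> - cnj z1)) / 2" by (simp add: x_def field_simps)
    then have nx: "norm (x - x0) = norm ((z - z1) + (\<zeta> - cnj z1)) / 2" by (simp only: norm_divide) simp
    have "(z - z1) - (\<zeta> - cnj z1) = z - \<zeta> - 2 * \<i> * y0"
      by (subst z1(2), subst z1(1)) (simp add: algebra_simps)
    then have "y - y0 = ((z - z1) - (\<zeta> - cnj z1)) / (2 * \<i>)" by (simp add: y_def field_simps)
    then have ny: "norm (y - y0) = norm ((z - z1) - (\<zeta> - cnj z1)) / 2"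
      by (simp only: norm_divide norm_mult) simp
    have "norm (x - x0) < \<delta>" "norm (y - y0) < \<delta>"
      using z \<zeta> norm_triangle_ineq[of "z - z1" "\<zeta> - cnj z1"] norm_triangle_ineq4[of "z - z1" "\<zeta> - cnj z1"]
      unfolding nx ny dist_norm by linarith+
    then have "\<Psi> (x + \<i> * y) (x - \<i> * y) w = 0" by (intro Rxy) (auto simp: dist_norm norm_minus_commute)
    moreover have "x + \<i> * y = z" "x - \<i> * y = \<zeta>" by (simp_all add: x_def y_def field_simps)
    ultimately show "pairing sg G z w \<zeta> ((1 - P z \<zeta>) / w) = 0" by (simp add: \<Psi>_def)
  qed
qed

end

section \<open>Derivatives along Segre varieties\<close>

context segre begin

text \<open>Functions of \<open>(z, \<zeta>)\<close> obtained by evaluating holomorphic functions along the curve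
  \<open>\<zeta> \<mapsto> (\<zeta>, \<eta> z \<zeta>)\<close> and multiplying by polynomials. All derivatives of such evaluations are, up to powers of
  \<open>1 - P z a\<close>, of the same kind.\<close>

inductive_set segre_ring :: "complex set \<Rightarrow> complex set \<Rightarrow> (complex \<Rightarrow> complex \<Rightarrow> complex) \<Rightarrow>
    (complex \<Rightarrow> complex \<Rightarrow> complex) set" for A B \<eta> where
  comp: "hol2 (A \<times> B) g \<Longrightarrow> (\<lambda>z \<zeta>. g \<zeta> (\<eta> z \<zeta>)) \<in> segre_ring A B \<eta>"
| add: "\<Theta> \<in> segre_ring A B \<eta> \<Longrightarrow> \<Theta>' \<in> segre_ring A B \<eta> \<Longrightarrow> (\<lambda>z \<zeta>. \<Theta> z \<zeta> + \<Theta>' z \<zeta>) \<in> segre_ring A B \<eta>"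
| mult: "\<Theta> \<in> segre_ring A B \<eta> \<Longrightarrow> (\<lambda>z \<zeta>. poly p z * \<Theta> z \<zeta>) \<in> segre_ring A B \<eta>"
| shift: "\<Theta> \<in> segre_ring A B \<eta> \<Longrightarrow> (\<lambda>z \<zeta>. \<zeta> * \<Theta> z \<zeta>) \<in> segre_ring A B \<eta>"

definition P_deriv :: "complex \<Rightarrow> complex \<Rightarrow> complex" where
  "P_deriv z \<zeta> = (\<Sum>j\<le>deg. poly (pc j) z * (of_nat j * \<zeta> ^ (j - 1)))"

lemma P_has_field_derivative: "(P z has_field_derivative P_deriv z \<zeta>) (at \<zeta>)"
proof -
  have "((\<lambda>\<zeta>. \<Sum>j\<le>deg. poly (pc j) z * \<zeta> ^ j) has_field_derivative P_deriv z \<zeta>) (at \<zeta>)"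
    unfolding P_deriv_def by (intro DERIV_sum DERIV_cmult) (auto intro!: derivative_eq_intros)
  then show ?thesis by (simp add: P_eq[abs_def])
qed

lemma segre_ring_power:
  "\<Theta> \<in> segre_ring A B \<eta> \<Longrightarrow> (\<lambda>z \<zeta>. \<zeta> ^ k * \<Theta> z \<zeta>) \<in> segre_ring A B \<eta>"
proof (induction k)
  case (Suc k)
  from segre_ring.shift[OF Suc.IH[OF Suc.prems]] show ?case by (simp add: mult.assoc)
qed simp

lemma segre_ring_sum:
  assumes "\<And>j. j \<in> J \<Longrightarrow> \<Theta> j \<in> segre_ring A B \<eta>" "finite J" "\<Theta>0 \<in> segre_ring A B \<eta>"
  shows "(\<lambda>z \<zeta>. \<Sum>j\<in>J. \<Theta> j z \<zeta>) \<in> segre_ring A B \<eta>"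
  using assms(2,1)
proof (induction J rule: finite_induct)
  case empty
  from segre_ring.mult[OF assms(3), of 0] show ?case by simp
next
  case (insert j J)
  then have "(\<lambda>z \<zeta>. \<Theta> j z \<zeta> + (\<Sum>j\<in>J. \<Theta> j z \<zeta>)) \<in> segre_ring A B \<eta>" by (intro segre_ring.add) auto
  with insert show ?case by simp
qed

lemma segre_ring_P_deriv:
  assumes "\<Theta> \<in> segre_ring A B \<eta>"
  shows "(\<lambda>z \<zeta>. P_deriv z \<zeta> * \<Theta> z \<zeta>) \<in> segre_ring A B \<eta>"
proof -
  have "(\<lambda>z \<zeta>. \<Sum>j\<in>{..deg}. poly (smult (of_nat j) (pc j)) z * (\<zeta> ^ (j - 1) * \<Theta> z \<zeta>)) \<in> segre_ring A B \<eta>"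
    by (intro segre_ring_sum[OF _ _ assms] segre_ring.mult segre_ring_power assms) auto
  also have "(\<lambda>z \<zeta>. \<Sum>j\<in>{..deg}. poly (smult (of_nat j) (pc j)) z * (\<zeta> ^ (j - 1) * \<Theta> z \<zeta>)) =
      (\<lambda>z \<zeta>. P_deriv z \<zeta> * \<Theta> z \<zeta>)"
    by (simp add: fun_eq_iff P_deriv_def sum_distrib_left sum_distrib_right mult_ac)
  finally show ?thesis .
qed

lemma P_poly_section: "\<exists>p. \<forall>z. P z \<zeta> = poly p z"
proof (intro exI allI)
  show "P z \<zeta> = poly (\<Sum>j\<le>deg. smult (\<zeta> ^ j) (pc j)) z" for z
    by (simp add: P_eq poly_sum mult_ac)
qed

text \<open>The factor \<open>1 - P z a\<close> is the denominator of \<open>\<eta>\<close>; multiplying the derivative by it keeps the coefficients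
  polynomial in \<open>z\<close>.\<close>

lemma segre_ring_deriv:
  assumes AB: "open A" "open B" and "\<Theta> \<in> segre_ring A B (\<lambda>z \<zeta>. b * (1 - P z \<zeta>) / (1 - P z a))"
  shows "\<exists>\<Theta>'\<in>segre_ring A B (\<lambda>z \<zeta>. b * (1 - P z \<zeta>) / (1 - P z a)). \<forall>z \<zeta>. P z a \<noteq> 1 \<longrightarrow> \<zeta> \<in> A \<longrightarrow>
     b * (1 - P z \<zeta>) / (1 - P z a) \<in> B \<longrightarrow> (\<Theta> z has_field_derivative \<Theta>' z \<zeta> / (1 - P z a)) (at \<zeta>)"
  using assms(3)
proof (induction rule: segre_ring.induct)
  case (comp g)
  define \<eta> where "\<eta> = (\<lambda>z \<zeta>. b * (1 - P z \<zeta>) / (1 - P z a))"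
  obtain p where p: "\<And>z. P z a = poly p z" using P_poly_section by blast
  define g1 where "g1 = (\<lambda>z w. deriv (\<lambda>z. g z w) z)"
  define g2 where "g2 = (\<lambda>z w. deriv (g z) w)"
  define \<Theta>' where "\<Theta>' = (\<lambda>z \<zeta>. poly (1 - p) z * g1 \<zeta> (\<eta> z \<zeta>) + poly [:- b:] z * (P_deriv z \<zeta> * g2 \<zeta> (\<eta> z \<zeta>)))"
  have "\<Theta>' \<in> segre_ring A B \<eta>"
    unfolding \<Theta>'_def
    by (intro segre_ring.add segre_ring.mult segre_ring_P_deriv segre_ring.comp)
      (simp_all add: g1_def g2_def hol2_deriv1 hol2_deriv2 comp AB)
  moreover have "((\<lambda>\<zeta>. g \<zeta> (\<eta> z \<zeta>)) has_field_derivative \<Theta>' z \<zeta> / (1 - P z a)) (at \<zeta>)"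
    if "P z a \<noteq> 1" "\<zeta> \<in> A" "\<eta> z \<zeta> \<in> B" for z \<zeta>
  proof -
    have "(\<eta> z has_field_derivative b * (0 - P_deriv z \<zeta>) / (1 - P z a)) (at \<zeta>)"
      unfolding \<eta>_def by (intro DERIV_cdivide DERIV_cmult DERIV_diff DERIV_const P_has_field_derivative)
    from hol2_chain_deriv[OF comp AB that(2,3) this]
    have "((\<lambda>\<zeta>. g \<zeta> (\<eta> z \<zeta>)) has_field_derivative
        g1 \<zeta> (\<eta> z \<zeta>) + g2 \<zeta> (\<eta> z \<zeta>) * (b * (0 - P_deriv z \<zeta>) / (1 - P z a))) (at \<zeta>)"
      by (simp add: g1_def g2_def)
    also have "g1 \<zeta> (\<eta> z \<zeta>) + g2 \<zeta> (\<eta> z \<zeta>) * (b * (0 - P_deriv z \<zeta>) / (1 - P z a)) = \<Theta>' z \<zeta> / (1 - P z a)"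
      using that(1) by (simp add: \<Theta>'_def p field_simps)
    finally show ?thesis .
  qed
  ultimately show ?case unfolding \<eta>_def by (intro bexI[of _ \<Theta>']) auto
next
  case (add \<Theta>1 \<Theta>2)
  from add.IH(1) obtain D1 where D1: "D1 \<in> segre_ring A B (\<lambda>z \<zeta>. b * (1 - P z \<zeta>) / (1 - P z a))"
      "\<forall>z \<zeta>. P z a \<noteq> 1 \<longrightarrow> \<zeta> \<in> A \<longrightarrow> b * (1 - P z \<zeta>) / (1 - P z a) \<in> B \<longrightarrow>
        (\<Theta>1 z has_field_derivative D1 z \<zeta> / (1 - P z a)) (at \<zeta>)" ..
  from add.IH(2) obtain D2 where D2: "D2 \<in> segre_ring A B (\<lambda>z \<zeta>. b * (1 - P z \<zeta>) / (1 - P z a))"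
      "\<forall>z \<zeta>. P z a \<noteq> 1 \<longrightarrow> \<zeta> \<in> A \<longrightarrow> b * (1 - P z \<zeta>) / (1 - P z a) \<in> B \<longrightarrow>
        (\<Theta>2 z has_field_derivative D2 z \<zeta> / (1 - P z a)) (at \<zeta>)" ..
  show ?case
  proof (rule bexI[OF _ segre_ring.add[OF D1(1) D2(1)]], intro allI impI)
    fix z \<zeta> assume *: "P z a \<noteq> 1" "\<zeta> \<in> A" "b * (1 - P z \<zeta>) / (1 - P z a) \<in> B"
    show "((\<lambda>\<zeta>. \<Theta>1 z \<zeta> + \<Theta>2 z \<zeta>) has_field_derivative (D1 z \<zeta> + D2 z \<zeta>) / (1 - P z a)) (at \<zeta>)"
      unfolding add_divide_distrib using * D1(2) D2(2) by (intro DERIV_add) blast+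
  qed
next
  case (mult \<Theta>1 p)
  from mult.IH obtain D1 where D1: "D1 \<in> segre_ring A B (\<lambda>z \<zeta>. b * (1 - P z \<zeta>) / (1 - P z a))"
      "\<forall>z \<zeta>. P z a \<noteq> 1 \<longrightarrow> \<zeta> \<in> A \<longrightarrow> b * (1 - P z \<zeta>) / (1 - P z a) \<in> B \<longrightarrow>
        (\<Theta>1 z has_field_derivative D1 z \<zeta> / (1 - P z a)) (at \<zeta>)" ..
  show ?case
  proof (rule bexI[OF _ segre_ring.mult[OF D1(1), of p]], intro allI impI)
    fix z \<zeta> assume *: "P z a \<noteq> 1" "\<zeta> \<in> A" "b * (1 - P z \<zeta>) / (1 - P z a) \<in> B"
    show "((\<lambda>\<zeta>. poly p z * \<Theta>1 z \<zeta>) has_field_derivative poly p z * D1 z \<zeta> / (1 - P z a)) (at \<zeta>)"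
      unfolding times_divide_eq_right[symmetric] using * D1(2) by (intro DERIV_cmult) blast
  qed
next
  case (shift \<Theta>1)
  from shift.IH obtain D1 where D1: "D1 \<in> segre_ring A B (\<lambda>z \<zeta>. b * (1 - P z \<zeta>) / (1 - P z a))"
      "\<forall>z \<zeta>. P z a \<noteq> 1 \<longrightarrow> \<zeta> \<in> A \<longrightarrow> b * (1 - P z \<zeta>) / (1 - P z a) \<in> B \<longrightarrow>
        (\<Theta>1 z has_field_derivative D1 z \<zeta> / (1 - P z a)) (at \<zeta>)" ..
  obtain p where p: "\<And>z. P z a = poly p z" using P_poly_section by blast
  show ?case
  proof (rule bexI[OF _ segre_ring.add[OF segre_ring.mult[OF shift(1), of "1 - p"] segre_ring.shift[OF D1(1)]]], intro allI impI)
    fix z \<zeta> assume *: "P z a \<noteq> 1" "\<zeta> \<in> A" "b * (1 - P z \<zeta>) / (1 - P z a) \<in> B"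
    have "((\<lambda>\<zeta>. \<zeta> * \<Theta>1 z \<zeta>) has_field_derivative (1 * \<Theta>1 z \<zeta> + D1 z \<zeta> / (1 - P z a) * \<zeta>)) (at \<zeta>)"
      using * D1(2) by (intro DERIV_mult DERIV_ident) blast
    also have "1 * \<Theta>1 z \<zeta> + D1 z \<zeta> / (1 - P z a) * \<zeta> = (poly (1 - p) z * \<Theta>1 z \<zeta> + \<zeta> * D1 z \<zeta>) / (1 - P z a)"
      using *(1) by (simp add: p field_simps)
    finally show "((\<lambda>\<zeta>. \<zeta> * \<Theta>1 z \<zeta>) has_field_derivative
        (poly (1 - p) z * \<Theta>1 z \<zeta> + \<zeta> * D1 z \<zeta>) / (1 - P z a)) (at \<zeta>)" .
  qed
qed

text \<open>At the base point \<open>\<zeta> = a\<close> the curve passes through \<open>(a, b)\<close> for every \<open>z\<close>, so that the transcendental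
  ingredients become constants and only polynomials in \<open>z\<close> remain.\<close>

lemma segre_ring_base_poly:
  assumes "\<Theta> \<in> segre_ring A B (\<lambda>z \<zeta>. b * (1 - P z \<zeta>) / (1 - P z a))"
  shows "\<exists>p. \<forall>z. P z a \<noteq> 1 \<longrightarrow> \<Theta> z a = poly p z"
  using assms
proof (induction rule: segre_ring.induct)
  case (comp g)
  show ?case by (rule exI[of _ "[:g a b:]"]) simp
next
  case (add \<Theta>1 \<Theta>2)
  then obtain p1 p2 where "\<forall>z. P z a \<noteq> 1 \<longrightarrow> \<Theta>1 z a = poly p1 z" "\<forall>z. P z a \<noteq> 1 \<longrightarrow> \<Theta>2 z a = poly p2 z" by blast
  then show ?case by (intro exI[of _ "p1 + p2"]) simp
next
  case (mult \<Theta>1 p)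
  then obtain p1 where "\<forall>z. P z a \<noteq> 1 \<longrightarrow> \<Theta>1 z a = poly p1 z" by blast
  then show ?case by (intro exI[of _ "p * p1"]) simp
next
  case (shift \<Theta>1)
  then obtain p1 where "\<forall>z. P z a \<noteq> 1 \<longrightarrow> \<Theta>1 z a = poly p1 z" by blast
  then show ?case by (intro exI[of _ "smult a p1"]) simp
qed


end

section \<open>Rationality along a Segre variety\<close>

lemma sum_mult_cnj_eq_0D:
  fixes x :: "'n::finite \<Rightarrow> complex"
  assumes "(\<Sum>j\<in>UNIV. x j * cnj (x j)) = 0"
  shows "x j = 0"
proof -
  have "of_real (\<Sum>j\<in>UNIV. (cmod (x j))\<^sup>2) = (0::complex)"
    using assms by (simp only: of_real_sum complex_norm_square)
  then have "(\<Sum>j\<in>UNIV. (cmod (x j))\<^sup>2) = 0" by (simp only: of_real_eq_0_iff)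
  then show ?thesis by (simp add: sum_nonneg_eq_0_iff)
qed

context segre begin

text \<open>On the Segre variety of the point \<open>(z1, w1)\<close>, the polarized sphere equation and all its derivatives at the point
  form a linear system with polynomial coefficients \<open>\<pi>\<close> for the components of \<open>f\<close>. Together with the linear relations
  that hold on this curve, it determines the components: a homogeneous solution has a leading vector at \<open>z1\<close> that is
  orthogonal to the curve and hence, by the relations, to itself. By \<open>analytic_dependence\<close> over the polynomials the
  system also has a polynomial solution, which must then be proportional to \<open>f\<close>.\<close>

lemma segre_rational:
  fixes f :: "'n::finite \<Rightarrow> complex \<Rightarrow> complex \<Rightarrow> complex"
  assumes AB: "open A" "open B" and f: "\<And>j. hol2 (A \<times> B) (f j)"
    and p: "z1 \<in> A" "w1 \<in> B" "w1 \<noteq> 0" "on_M z1 w1"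
    and sph: "\<And>z w. z \<in> A \<Longrightarrow> w \<in> B \<Longrightarrow> on_M z w \<Longrightarrow> (\<Sum>j\<in>UNIV. f j z w * cnj (f j z w)) = 1"
  shows "\<exists>d \<delta>. \<delta> > 0 \<and> rational_map d (ball z1 \<delta>) (\<lambda>z. z)
     (\<lambda>k z. case k of None \<Rightarrow> 1 | Some j \<Rightarrow> f j z ((1 - P z (cnj z1)) / cnj w1))"
proof -
  define G :: "'n option \<Rightarrow> complex \<Rightarrow> complex \<Rightarrow> complex" where "G = case_option (\<lambda>z w. 1) f"
  define sg :: "'n option \<Rightarrow> complex" where "sg = case_option (-1) (\<lambda>_. 1)"
  have pair: "pairing sg G z w \<zeta> \<eta> = (\<Sum>j\<in>UNIV. f j z w * cnj (f j (cnj \<zeta>) (cnj \<eta>))) - 1" for z w \<zeta> \<eta>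
    by (simp add: pairing_def UNIV_option_conv sum.reindex G_def sg_def)
  have G: "hol2 (A \<times> B) (G k)" for k
  proof (cases k)
    case None
    then show ?thesis unfolding G_def by (auto intro!: hol2I AB)
  qed (simp add: G_def f)
  have zero: "pairing sg G z w (cnj z) (cnj w) = 0" if "z \<in> A" "w \<in> B" "on_M z w" for z w
    using sph[OF that] by (simp add: pair)
  obtain \<delta> where \<delta>: "\<delta> > 0" "\<And>z \<zeta> w. dist z z1 < \<delta> \<Longrightarrow> dist \<zeta> (cnj z1) < \<delta> \<Longrightarrow> dist w w1 < \<delta> \<Longrightarrow>
       z \<in> A \<and> w \<in> B \<and> w \<noteq> 0 \<and> cnj \<zeta> \<in> A \<and> cnj ((1 - P z \<zeta>) / w) \<in> B \<and>
       pairing sg G z w \<zeta> ((1 - P z \<zeta>) / w) = 0"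
    using polarization[of A B G z1 w1 sg, OF AB G p zero] by blast
  \<comment> \<open>\<open>cp\<close> parametrizes the Segre variety of \<open>(z1, w1)\<close>, and \<open>\<eta> z\<close> that of the conjugate of the point
    \<open>(z, cp z)\<close> on it; the latter passes through \<open>(a, b)\<close>\<close>
  define a b where "a = cnj z1" and "b = cnj w1"
  define cp where "cp = (\<lambda>z. (1 - P z a) / b)"
  have b0: "b \<noteq> 0" using p(3) by (simp add: b_def)
  have P1: "1 - P z1 a = w1 * b" using p(4) by (simp add: on_M_def a_def b_def)
  then have cp1: "cp z1 = w1" using b0 by (simp add: cp_def)
  have "continuous_on UNIV cp" unfolding cp_def using b0 by (intro continuous_intros) auto
  then have "isCont cp z1" by (simp add: continuous_on_eq_continuous_at)
  then obtain s where s: "s > 0" "\<And>z. dist z z1 < s \<Longrightarrow> dist (cp z) w1 < \<delta>"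
    using \<delta>(1) cp1 unfolding continuous_at_eps_delta by metis
  define \<delta>1 where "\<delta>1 = min s \<delta>"
  define Z where "Z = ball z1 \<delta>1"
  define D where "D = ball a \<delta>"
  have Z: "open Z" "connected Z" "z1 \<in> Z" using s \<delta> by (auto simp: Z_def \<delta>1_def)
  have D: "open D" "a \<in> D" using \<delta> by (auto simp: D_def)
  define A' B' where "A' = {\<zeta>. cnj \<zeta> \<in> A}" and "B' = {\<zeta>. cnj \<zeta> \<in> B}"
  have AB': "open A'" "open B'" unfolding A'_def B'_def
    using open_vimage[OF AB(1), of cnj] open_vimage[OF AB(2), of cnj]
    by (auto simp: vimage_def intro!: continuous_intros)
  define fs where "fs = (\<lambda>j z w. cnj (f j (cnj z) (cnj w)))"
  have fs: "hol2 (A' \<times> B') (fs j)" for j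
    unfolding fs_def
    by (rule hol2_subset[OF hol2_cnj[OF f]]) (auto simp: A'_def B'_def intro!: open_Times AB'[unfolded A'_def B'_def])
  define \<eta> where "\<eta> = (\<lambda>z \<zeta>. b * (1 - P z \<zeta>) / (1 - P z a))"
  define F where "F = (\<lambda>j z. f j z (cp z))"
  have ZD: "P z a \<noteq> 1 \<and> cp z \<in> B \<and> z \<in> A \<and> \<zeta> \<in> A' \<and> \<eta> z \<zeta> \<in> B' \<and> (\<Sum>j\<in>UNIV. F j z * fs j \<zeta> (\<eta> z \<zeta>)) = 1"
    if "z \<in> Z" "\<zeta> \<in> D" for z \<zeta>
  proof -
    have z: "dist z z1 < s" "dist z z1 < \<delta>" using that by (auto simp: Z_def \<delta>1_def dist_commute)
    have h: "z \<in> A \<and> cp z \<in> B \<and> cp z \<noteq> 0 \<and> cnj \<zeta> \<in> A \<and> cnj ((1 - P z \<zeta>) / cp z) \<in> B \<and>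
       pairing sg G z (cp z) \<zeta> ((1 - P z \<zeta>) / cp z) = 0"
      using that(2) s(2)[OF z(1)] z(2) by (intro \<delta>(2)) (auto simp: D_def dist_commute a_def)
    then have "P z a \<noteq> 1" by (auto simp: cp_def)
    moreover have "(1 - P z \<zeta>) / cp z = \<eta> z \<zeta>" by (simp add: cp_def \<eta>_def)
    ultimately show ?thesis using h by (simp only: pair) (simp add: A'_def B'_def F_def fs_def)
  qed
  let ?C = "segre_ring A' B' \<eta>"
  \<comment> \<open>\<open>\<Theta> j k z\<close> is \<open>(1 - P z a) ^ k\<close> times the \<open>k\<close>-th derivative of the \<open>j\<close>-th conjugate component along \<open>\<eta> z\<close>\<close>
  have "\<exists>\<Theta>. \<forall>k. (\<Theta> k \<in> ?C \<and> (k = 0 \<longrightarrow> \<Theta> k = (\<lambda>z \<zeta>. fs j \<zeta> (\<eta> z \<zeta>)))) \<and>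
      (\<forall>z\<in>Z. \<forall>\<zeta>\<in>D. (\<Theta> k z has_field_derivative \<Theta> (Suc k) z \<zeta> / (1 - P z a)) (at \<zeta>))" for j
  proof (rule dependent_nat_choice)
    show "\<exists>x. x \<in> ?C \<and> (0 = (0::nat) \<longrightarrow> x = (\<lambda>z \<zeta>. fs j \<zeta> (\<eta> z \<zeta>)))"
      using segre_ring.comp[OF fs] by blast
    fix x and k :: nat assume "x \<in> ?C \<and> (k = 0 \<longrightarrow> x = (\<lambda>z \<zeta>. fs j \<zeta> (\<eta> z \<zeta>)))"
    then obtain y where y: "y \<in> ?C" "\<forall>z \<zeta>. P z a \<noteq> 1 \<longrightarrow> \<zeta> \<in> A' \<longrightarrow> \<eta> z \<zeta> \<in> B' \<longrightarrow>
        (x z has_field_derivative y z \<zeta> / (1 - P z a)) (at \<zeta>)"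
      using segre_ring_deriv[OF AB', of x b a] unfolding \<eta>_def by blast
    then show "\<exists>y. (y \<in> ?C \<and> (Suc k = 0 \<longrightarrow> y = (\<lambda>z \<zeta>. fs j \<zeta> (\<eta> z \<zeta>)))) \<and>
        (\<forall>z\<in>Z. \<forall>\<zeta>\<in>D. (x z has_field_derivative y z \<zeta> / (1 - P z a)) (at \<zeta>))"
      using ZD by (intro exI[of _ y]) auto
  qed
  then obtain \<Theta> where \<Theta>: "\<And>j k. \<Theta> j k \<in> ?C" "\<And>j. \<Theta> j 0 = (\<lambda>z \<zeta>. fs j \<zeta> (\<eta> z \<zeta>))"
      "\<And>j k z \<zeta>. z \<in> Z \<Longrightarrow> \<zeta> \<in> D \<Longrightarrow> (\<Theta> j k z has_field_derivative \<Theta> j (Suc k) z \<zeta> / (1 - P z a)) (at \<zeta>)"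
    by metis
  have "\<exists>\<pi>. \<forall>z. P z a \<noteq> 1 \<longrightarrow> \<Theta> j k z a = poly \<pi> z" for j k
    using segre_ring_base_poly \<Theta>(1) unfolding \<eta>_def by blast
  then obtain \<pi> where \<pi>: "\<And>j k z. P z a \<noteq> 1 \<Longrightarrow> \<Theta> j k z a = poly (\<pi> j k) z" by metis
  have id: "\<forall>z\<in>Z. \<forall>\<zeta>\<in>D. (\<Sum>j\<in>UNIV. F j z * \<Theta> j k z \<zeta>) = (if k = 0 then 1 else 0)" for k
  proof (induction k)
    case 0
    then show ?case using ZD by (simp add: \<Theta>(2))
  next
    case (Suc k)
    show ?case
    proof (intro ballI)
      fix z \<zeta> assume z: "z \<in> Z" and \<zeta>: "\<zeta> \<in> D"
      have "((\<lambda>\<zeta>. \<Sum>j\<in>UNIV. F j z * \<Theta> j k z \<zeta>) has_field_derivative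
          (\<Sum>j\<in>UNIV. F j z * (\<Theta> j (Suc k) z \<zeta> / (1 - P z a)))) (at \<zeta>)"
        by (intro DERIV_sum DERIV_cmult \<Theta>(3) z \<zeta>)
      moreover have "((\<lambda>\<zeta>. \<Sum>j\<in>UNIV. F j z * \<Theta> j k z \<zeta>) has_field_derivative 0) (at \<zeta>)"
        by (rule has_field_derivative_transform_within_open[OF DERIV_const D(1) \<zeta>]) (use Suc z in auto)
      ultimately have "(\<Sum>j\<in>UNIV. F j z * (\<Theta> j (Suc k) z \<zeta> / (1 - P z a))) = 0" by (rule DERIV_unique)
      then have "(\<Sum>j\<in>UNIV. F j z * \<Theta> j (Suc k) z \<zeta>) / (1 - P z a) = 0" by (simp add: sum_divide_distrib)
      then show "(\<Sum>j\<in>UNIV. F j z * \<Theta> j (Suc k) z \<zeta>) = (if Suc k = 0 then 1 else 0)"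
        using ZD[OF z \<zeta>] by simp
    qed
  qed
  have idp: "(\<Sum>j\<in>UNIV. F j z * poly (\<pi> j k) z) = (if k = 0 then 1 else 0)" if "z \<in> Z" for z k
  proof -
    have "P z a \<noteq> 1" using ZD[OF that D(2)] by blast
    then have "\<Theta> j k z a = poly (\<pi> j k) z" for j by (rule \<pi>)
    then show ?thesis using bspec[OF bspec[OF id[of k] that] D(2)] by simp
  qed
  \<comment> \<open>a vector that is orthogonal to all derivatives at \<open>a\<close> is orthogonal to the whole conjugate curve\<close>
  have taylor: "(\<Sum>j\<in>UNIV. y j * fs j \<zeta> (\<eta> z1 \<zeta>)) = 0"
    if y: "\<And>k. (\<Sum>j\<in>UNIV. y j * poly (\<pi> j k) z1) = 0" and \<zeta>: "\<zeta> \<in> D" for y \<zeta>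
  proof -
    define u where "u = (\<lambda>k \<zeta>. \<Sum>j\<in>UNIV. y j * \<Theta> j k z1 \<zeta>)"
    have der: "(u k has_field_derivative u (Suc k) \<zeta> / (1 - P z1 a)) (at \<zeta>)" if "\<zeta> \<in> D" for k \<zeta>
    proof -
      have "(u k has_field_derivative (\<Sum>j\<in>UNIV. y j * (\<Theta> j (Suc k) z1 \<zeta> / (1 - P z1 a)))) (at \<zeta>)"
        unfolding u_def by (intro DERIV_sum DERIV_cmult \<Theta>(3) Z that)
      then show ?thesis by (simp add: u_def sum_divide_distrib)
    qed
    have hd: "(deriv ^^ k) (u 0) \<zeta> = u k \<zeta> / (1 - P z1 a) ^ k" if "\<zeta> \<in> D" for k \<zeta>
      using that
    proof (induction k arbitrary: \<zeta>)
      case (Suc k)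
      have "((deriv ^^ k) (u 0) has_field_derivative u (Suc k) \<zeta> / (1 - P z1 a) / (1 - P z1 a) ^ k) (at \<zeta>)"
        by (rule has_field_derivative_transform_within_open[OF DERIV_cdivide[OF der[OF Suc.prems]] D(1) Suc.prems])
          (simp add: Suc.IH)
      from DERIV_imp_deriv[OF this] show ?case by (simp add: field_simps)
    qed simp
    have "u 0 \<zeta> = 0"
    proof (rule holomorphic_fun_eq_0_on_ball[of "u 0" a \<delta>])
      show "u 0 holomorphic_on ball a \<delta>"
        unfolding D_def[symmetric] holomorphic_on_open[OF D(1)] using der[of _ 0] by blast
      fix k
      have "P z1 a \<noteq> 1" using ZD[OF Z(3) D(2)] by blast
      then have "\<Theta> j k z1 a = poly (\<pi> j k) z1" for j by (rule \<pi>)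
      then have "u k a = 0" using y[of k] by (simp add: u_def)
      then show "(deriv ^^ k) (u 0) a = 0" using hd[OF D(2)] by simp
    qed (use \<zeta> in \<open>simp add: D_def\<close>)
    then show ?thesis by (simp add: u_def \<Theta>(2))
  qed
  \<comment> \<open>the constant linear relations between the components of \<open>f\<close> on the curve; each is one more equation of the system\<close>
  define E where "E = {e. \<forall>z\<in>Z. (\<Sum>j\<in>UNIV. e j * F j z) = 0}"
  define g :: "'n option \<Rightarrow> nat + ('n \<Rightarrow> complex) \<Rightarrow> complex poly" where
    "g = (\<lambda>i x. case x of Inl k \<Rightarrow> (case i of None \<Rightarrow> (if k = 0 then - 1 else 0) | Some j \<Rightarrow> \<pi> j k)
                     | Inr e \<Rightarrow> (case i of None \<Rightarrow> 0 | Some j \<Rightarrow> [:e j:]))"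
  have sumg: "(\<Sum>i\<in>UNIV. c i * poly (g i (Inl k)) v) = (\<Sum>j\<in>UNIV. c (Some j) * poly (\<pi> j k) v) - (if k = 0 then c None else 0)"
      "(\<Sum>i\<in>UNIV. c i * poly (g i (Inr e)) v) = (\<Sum>j\<in>UNIV. c (Some j) * e j)" for c k v e
    by (simp_all add: UNIV_option_conv sum.reindex g_def)
  obtain c :: "'n option \<Rightarrow> complex \<Rightarrow> complex" where c: "\<And>i. c i \<in> range poly" "\<exists>i. \<exists>v. c i v \<noteq> 0"
      "\<And>x v. x \<in> range Inl \<union> Inr ` E \<Longrightarrow> (\<Sum>i\<in>UNIV. c i v * poly (g i x) v) = 0"
  proof (rule analytic_dependence[of UNIV UNIV z1 "range poly" "range Inl \<union> Inr ` E" "\<lambda>i x. poly (g i x)"])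
    show "a holomorphic_on UNIV" if "a \<in> range poly" for a
      using that by (auto intro!: holomorphic_intros)
    show "(\<lambda>_. 1) \<in> range (poly :: complex poly \<Rightarrow> _)"
      by (rule range_eqI[where x = 1]) (simp add: fun_eq_iff)
    show "(\<lambda>_. 0) \<in> range (poly :: complex poly \<Rightarrow> _)"
      by (rule range_eqI[where x = 0]) (simp add: fun_eq_iff)
    show "(\<lambda>v. a v * b v) \<in> range poly" if "a \<in> range poly" "b \<in> range poly" for a b :: "complex \<Rightarrow> complex"
    proof -
      obtain p q where "a = poly p" "b = poly q" using \<open>a \<in> range poly\<close> \<open>b \<in> range poly\<close> by blast
      then show ?thesis by (intro range_eqI[of _ _ "p * q"]) auto
    qed
    show "(\<lambda>v. a v - b v) \<in> range poly" if "a \<in> range poly" "b \<in> range poly" for a b :: "complex \<Rightarrow> complex"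
    proof -
      obtain p q where "a = poly p" "b = poly q" using \<open>a \<in> range poly\<close> \<open>b \<in> range poly\<close> by blast
      then show ?thesis by (intro range_eqI[of _ _ "p - q"]) auto
    qed
    have "\<forall>\<^sub>F v in at z1. v \<in> Z" using Z by (intro eventually_at_in_open') auto
    then have "\<forall>\<^sub>F v in at z1. \<exists>c. (\<exists>i\<in>UNIV. c i \<noteq> 0) \<and>
        (\<forall>x\<in>range Inl \<union> Inr ` E. (\<Sum>i\<in>UNIV. c i * poly (g i x) v) = 0)"
    proof eventually_elim
      case (elim v)
      show ?case
      proof (intro exI[of _ "case_option 1 (\<lambda>j. F j v)"] conjI ballI)
        show "\<exists>i\<in>UNIV. (case i of None \<Rightarrow> 1 | Some j \<Rightarrow> F j v) \<noteq> 0" by (intro bexI[of _ None]) auto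
        fix x :: "nat + ('n \<Rightarrow> complex)" assume "x \<in> range Inl \<union> Inr ` E"
        then consider k where "x = Inl k" | e where "x = Inr e" "e \<in> E" by blast
        then show "(\<Sum>i\<in>UNIV. (case i of None \<Rightarrow> 1 | Some j \<Rightarrow> F j v) * poly (g i x) v) = 0"
        proof cases
          case 1 then show ?thesis using idp[OF elim, of k] by (simp add: sumg)
        next
          case 2
          then have "(\<Sum>j\<in>UNIV. e j * F j v) = 0" using elim by (simp add: E_def)
          then show ?thesis unfolding 2(1) sumg(2) by (simp add: mult.commute)
        qed
      qed
    qed
    then show "\<exists>\<^sub>F v in at z1. \<exists>c. (\<exists>i\<in>UNIV. c i \<noteq> 0) \<and>
        (\<forall>x\<in>range Inl \<union> Inr ` E. (\<Sum>i\<in>UNIV. c i * poly (g i x) v) = 0)"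
      by (rule eventually_frequently[OF at_neq_bot])
    fix c :: "'n option \<Rightarrow> complex \<Rightarrow> complex"
    assume "\<And>i. i \<in> UNIV \<Longrightarrow> c i \<in> range poly" "\<exists>i\<in>UNIV. \<exists>v\<in>UNIV. c i v \<noteq> 0"
      "\<And>x v. x \<in> range Inl \<union> Inr ` E \<Longrightarrow> v \<in> UNIV \<Longrightarrow> (\<Sum>i\<in>UNIV. c i v * poly (g i x) v) = 0"
    then show thesis using that[of c] by simp
  qed auto
  have "\<forall>i. \<exists>C. c i = poly C" using c(1) by blast
  then obtain C where C: "\<And>i. c i = poly (C i)" by metis
  have cI: "(\<Sum>j\<in>UNIV. poly (C (Some j)) v * poly (\<pi> j k) v) = (if k = 0 then poly (C None) v else 0)" for k v
    using c(3)[of "Inl k" v] by (simp add: C sumg split: if_splits)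
  have cE: "(\<Sum>j\<in>UNIV. poly (C (Some j)) v * e j) = 0" if "e \<in> E" for e v
    using c(3)[of "Inr e" v] that by (simp add: C sumg)
  \<comment> \<open>the polynomial solution minus a multiple of \<open>f\<close> solves the homogeneous system\<close>
  define u where "u = (\<lambda>j z. poly (C (Some j)) z - poly (C None) z * F j z)"
  have Fhol: "F j holomorphic_on Z" for j
    unfolding F_def
  proof (rule hol2_compose[OF f])
    show "cp holomorphic_on Z" unfolding cp_def using b0 by (intro holomorphic_intros) auto
  qed (use ZD[OF _ D(2)] Z in \<open>auto intro!: holomorphic_intros\<close>)
  have uhol: "u j holomorphic_on Z" for j unfolding u_def by (intro holomorphic_intros Fhol)
  have uI: "(\<Sum>j\<in>UNIV. u j z * poly (\<pi> j k) z) = 0" if "z \<in> Z" for z k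
  proof -
    have "(\<Sum>j\<in>UNIV. u j z * poly (\<pi> j k) z) = (\<Sum>j\<in>UNIV. poly (C (Some j)) z * poly (\<pi> j k) z)
       - poly (C None) z * (\<Sum>j\<in>UNIV. F j z * poly (\<pi> j k) z)"
      by (simp add: u_def algebra_simps sum_subtractf sum_distrib_left)
    then show ?thesis using cI[of z k] idp[OF that, of k] by simp
  qed
  have uE: "(\<Sum>j\<in>UNIV. u j z * e j) = 0" if "z \<in> Z" "e \<in> E" for z e
  proof -
    have "(\<Sum>j\<in>UNIV. u j z * e j) = (\<Sum>j\<in>UNIV. poly (C (Some j)) z * e j) - poly (C None) z * (\<Sum>j\<in>UNIV. e j * F j z)"
      by (simp add: u_def algebra_simps sum_subtractf sum_distrib_left)
    then show ?thesis using cE[OF that(2), of z] that by (simp add: E_def)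
  qed
  have u0: "u j z = 0" if zZ: "z \<in> Z" for j z
  proof (rule ccontr)
    assume nz: "u j z \<noteq> 0"
    obtain m d where d: "\<And>j. d j holomorphic_on Z" "\<And>j x. x \<in> Z \<Longrightarrow> u j x = (x - z1) ^ m * d j x"
        "\<exists>j. d j z1 \<noteq> 0"
      by (rule common_zero_factor[of Z z1 UNIV u j z]) (use Z uhol nz zZ in auto)
    \<comment> \<open>every homogeneous equation passes to the leading vector of \<open>u\<close> at \<open>z1\<close>\<close>
    have lim: "(\<Sum>j\<in>UNIV. d j z1 * h j z1) = 0"
      if h: "\<And>j. h j holomorphic_on Z" "\<And>x. x \<in> Z \<Longrightarrow> (\<Sum>j\<in>UNIV. u j x * h j x) = 0" for h :: "'n \<Rightarrow> complex \<Rightarrow> complex"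
    proof (rule holomorphic_frequently_zero[OF Z _ _ Z(3), where h = "\<lambda>x. \<Sum>j\<in>UNIV. d j x * h j x"])
      show "(\<lambda>x. \<Sum>j\<in>UNIV. d j x * h j x) holomorphic_on Z" by (intro holomorphic_intros h d)
      have "\<forall>\<^sub>F x in at z1. x \<in> Z" "\<forall>\<^sub>F x in at z1. x \<noteq> z1"
        using Z eventually_at_in_open'[of Z z1] by (simp_all add: eventually_neq_at_within)
      then have "\<forall>\<^sub>F x in at z1. (\<Sum>j\<in>UNIV. d j x * h j x) = 0"
      proof eventually_elim
        case (elim x)
        have "(x - z1) ^ m * (\<Sum>j\<in>UNIV. d j x * h j x) = 0"
          using h(2)[OF elim(1)] d(2)[OF elim(1)] by (simp add: sum_distrib_left mult.assoc)
        then show ?case using elim(2) by simp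
      qed
      then show "\<exists>\<^sub>F x in at z1. (\<Sum>j\<in>UNIV. d j x * h j x) = 0" by (rule eventually_frequently[OF at_neq_bot])
    qed
    have "(\<Sum>j\<in>UNIV. d j z1 * poly (\<pi> j k) z1) = 0" for k
      by (rule lim) (auto intro!: holomorphic_intros uI)
    note ty = taylor[OF this]
    have "(\<lambda>j. cnj (d j z1)) \<in> E"
      unfolding E_def
    proof (intro CollectI ballI)
      fix z assume z: "z \<in> Z"
      have zD: "cnj z \<in> D"
        using z by (simp add: Z_def D_def \<delta>1_def a_def dist_norm flip: complex_cnj_diff)
      \<comment> \<open>the Segre variety of \<open>(z1, w1)\<close> is conjugate to the curve \<open>\<eta> z1\<close>\<close>
      have "\<eta> z1 (cnj z) = cnj (cp z)"
        using P1 b0 p(3) by (simp add: \<eta>_def cp_def P_cnj P_sym a_def b_def)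
      then have "fs j (cnj z) (\<eta> z1 (cnj z)) = cnj (F j z)" for j
        by (simp add: fs_def F_def)
      then have "(\<Sum>j\<in>UNIV. d j z1 * cnj (F j z)) = 0" using ty[OF zD] by simp
      then have "cnj (\<Sum>j\<in>UNIV. d j z1 * cnj (F j z)) = 0" by (simp only: complex_cnj_zero)
      then show "(\<Sum>j\<in>UNIV. cnj (d j z1) * F j z) = 0" by simp
    qed
    then have "(\<Sum>j\<in>UNIV. d j z1 * cnj (d j z1)) = 0"
      by (intro lim[of "\<lambda>j _. cnj (d j z1)"]) (auto intro: uE)
    then have "d j z1 = 0" for j by (rule sum_mult_cnj_eq_0D)
    then show False using d(3) by blast
  qed
  define dd where "dd = Max (range (\<lambda>i. degree (C i)))"
  show ?thesis
  proof (intro exI[of _ dd] exI[of _ \<delta>1] conjI)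
    show "0 < \<delta>1" using s \<delta> by (simp add: \<delta>1_def)
    show "rational_map dd (ball z1 \<delta>1) (\<lambda>z. z)
       (\<lambda>k z. case k of None \<Rightarrow> 1 | Some j \<Rightarrow> f j z ((1 - P z (cnj z1)) / cnj w1))"
      unfolding rational_map_def
    proof (intro exI[of _ C] conjI allI ballI)
      show "\<exists>k. C k \<noteq> 0" using c(2) unfolding C by (metis poly_0)
      show "degree (C k) \<le> dd" for k unfolding dd_def by (intro Max_ge) auto
      fix z k assume "z \<in> ball z1 \<delta>1"
      then have "z \<in> Z" by (simp add: Z_def)
      then show "poly (C None) z * (case k of None \<Rightarrow> 1 | Some j \<Rightarrow> f j z ((1 - P z (cnj z1)) / cnj w1)) =
         poly (C k) z * (case None of None \<Rightarrow> 1 | Some j \<Rightarrow> f j z ((1 - P z (cnj z1)) / cnj w1))"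
        using u0[of z "the k"] by (cases k) (auto simp: u_def F_def cp_def a_def b_def)
    qed
  qed
qed

end

section \<open>Rationality on horizontal lines\<close>

text \<open>Pigeonhole: one of countably many degrees serves an uncountable, hence accumulating, set of parameters.\<close>

lemma uncountable_frequently:
  fixes K :: "complex set"
  assumes "uncountable Z" "compact K" "Z \<subseteq> K" "\<And>v. v \<in> Z \<Longrightarrow> \<exists>d::nat. Q d v"
  shows "\<exists>d. \<exists>v0\<in>K. \<exists>\<^sub>F v in at v0. v \<in> Z \<and> Q d v"
proof -
  have "Z = (\<Union>d. {v\<in>Z. Q d v})" using assms(4) by blast
  moreover have "countable (\<Union>d. {v\<in>Z. Q d v})" if "\<And>d. countable {v\<in>Z. Q d v}"
    using that by (intro countable_UN) auto
  ultimately obtain d where "uncountable {v\<in>Z. Q d v}" using assms(1) by force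
  then have "infinite {v\<in>Z. Q d v}" using countable_finite by blast
  then obtain v0 where "v0 \<in> K" "v0 islimpt {v\<in>Z. Q d v}"
    using assms(2,3) unfolding compact_eq_Bolzano_Weierstrass by (metis (no_types, lifting) mem_Collect_eq subsetD subsetI)
  then show ?thesis
    by (intro exI[of _ d] bexI[of _ v0]) (auto simp: islimpt_iff_eventually frequently_def)
qed

lemma compact_tube3:
  fixes g :: "complex \<times> complex \<times> complex \<Rightarrow> complex"
  assumes K: "compact K" and U: "open U" "continuous_on U g" "open B"
    and mem: "\<And>y. y \<in> K \<Longrightarrow> (x0, y, z0) \<in> U \<and> g (x0, y, z0) \<in> B"
  shows "\<exists>e>0. \<forall>y0\<in>K. \<forall>x y z. dist x x0 < e \<longrightarrow> dist y y0 < e \<longrightarrow> dist z z0 < e \<longrightarrow>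
     (x, y, z) \<in> U \<and> g (x, y, z) \<in> B"
proof -
  have "open (U \<inter> g -` B)" by (rule continuous_open_preimage[OF U(2,1,3)])
  moreover have "compact ({x0} \<times> K \<times> {z0})" by (intro compact_Times K) auto
  moreover have "{x0} \<times> K \<times> {z0} \<subseteq> U \<inter> g -` B" using mem by auto
  ultimately obtain e where e: "e > 0" "(\<Union>t\<in>{x0} \<times> K \<times> {z0}. ball t e) \<subseteq> U \<inter> g -` B"
    using compact_subset_open_imp_ball_epsilon_subset by metis
  show ?thesis
  proof (intro exI[of _ "e/3"] conjI ballI allI impI)
    show "e/3 > 0" using e by simp
    fix y0 x y z assume "y0 \<in> K" "dist x x0 < e/3" "dist y y0 < e/3" "dist z z0 < e/3"
    moreover have "dist (x, y, z) (x0, y0, z0) \<le> dist x x0 + dist (y, z) (y0, z0)"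
      unfolding dist_Pair_Pair[of x] by (rule sqrt_sum_squares_le_sum) auto
    moreover have "dist (y, z) (y0, z0) \<le> dist y y0 + dist z z0"
      unfolding dist_Pair_Pair by (rule sqrt_sum_squares_le_sum) auto
    ultimately have "(x, y, z) \<in> ball (x0, y0, z0) e" by (simp add: dist_commute)
    then have "(x, y, z) \<in> U \<inter> g -` B" using e(2) \<open>y0 \<in> K\<close> by blast
    then show "(x, y, z) \<in> U" "g (x, y, z) \<in> B" by auto
  qed
qed

text \<open>The denominator of the affine map \<open>f\<close> is \<open>1\<close>.\<close>

definition homog :: "('n \<Rightarrow> complex \<Rightarrow> complex \<Rightarrow> complex) \<Rightarrow> 'n option \<Rightarrow> complex \<Rightarrow> complex \<Rightarrow> complex" where
  "homog f = case_option (\<lambda>z w. 1) f"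

lemma hol2_homog: "open A \<Longrightarrow> open B \<Longrightarrow> (\<And>j. hol2 (A \<times> B) (f j)) \<Longrightarrow> hol2 (A \<times> B) (homog f k)"
  by (cases k) (auto simp: homog_def intro!: hol2I)

context segre begin

text \<open>For fixed \<open>\<kappa>\<close>, the curve \<open>w = \<kappa> * (1 - P z \<zeta>)\<close> is the Segre variety of a point of the hypersurface whenever
  \<open>cnj \<zeta>\<close> lies on a certain level curve of \<open>P z (cnj z)\<close>. The level curve is uncountable, so a common degree works on an
  accumulating set of \<open>\<zeta>\<close> and then, by continuation, for all \<open>\<zeta>\<close>; the same argument in \<open>\<kappa>\<close> makes the degree
  independent of \<open>\<kappa>\<close>.\<close>

lemma segre_family_rational:
  fixes f :: "'n::finite \<Rightarrow> complex \<Rightarrow> complex \<Rightarrow> complex"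
  assumes AB: "open A" "open B" and f: "\<And>j. hol2 (A \<times> B) (f j)"
    and p: "z0 \<in> A" "w0 \<in> B" "w0 \<noteq> 0" "on_M z0 w0"
    and sph: "\<And>z w. z \<in> A \<Longrightarrow> w \<in> B \<Longrightarrow> on_M z w \<Longrightarrow> (\<Sum>j\<in>UNIV. f j z w * cnj (f j z w)) = 1"
    and level: "\<And>r. r > 0 \<Longrightarrow> \<exists>e>0. \<forall>t. dist t (P z0 (cnj z0)) < e \<longrightarrow> t \<in> \<real> \<longrightarrow>
        uncountable {z \<in> cball z0 r. P z (cnj z) = t}"
  shows "\<exists>d r. r > 0 \<and> (\<forall>\<zeta>\<in>ball (cnj z0) r. \<forall>\<kappa>\<in>ball (1 / cnj w0) r.
     rational_map d (ball z0 r) (\<lambda>z. z) (\<lambda>k z. homog f k z (\<kappa> * (1 - P z \<zeta>))))"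
proof -
  define \<kappa>0 where "\<kappa>0 = 1 / cnj w0"
  have \<kappa>0: "\<kappa>0 \<noteq> 0" "\<kappa>0 * (1 - P z0 (cnj z0)) = w0"
    using p(3,4) by (auto simp: \<kappa>0_def on_M_def field_simps)
  have "\<exists>e>0. \<forall>y0\<in>{cnj z0}. \<forall>x y z. dist x z0 < e \<longrightarrow> dist y y0 < e \<longrightarrow> dist z \<kappa>0 < e \<longrightarrow>
     (x, y, z) \<in> A \<times> UNIV \<times> (- {0}) \<and> (\<lambda>t. snd (snd t) * (1 - P (fst t) (fst (snd t)))) (x, y, z) \<in> B"
    by (rule compact_tube3) (use AB p \<kappa>0 in \<open>auto intro!: open_Times continuous_intros\<close>)
  then obtain r where r: "r > 0" and mem: "\<And>z \<zeta> \<kappa>. dist z z0 < r \<Longrightarrow> dist \<zeta> (cnj z0) < r \<Longrightarrow> dist \<kappa> \<kappa>0 < r \<Longrightarrow>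
      z \<in> A \<and> \<kappa> \<noteq> 0 \<and> \<kappa> * (1 - P z \<zeta>) \<in> B" by auto
  define X where "X = ball z0 r"
  define V where "V = ball (cnj z0) r"
  define \<phi> where "\<phi> = (\<lambda>\<kappa> \<zeta> k z. homog f k z (\<kappa> * (1 - P z \<zeta>)))"
  have hol: "(\<lambda>t. \<phi> (\<gamma> t) (\<beta> t) k (\<alpha> t)) holomorphic_on S"
    if "open S" "\<alpha> holomorphic_on S" "\<beta> holomorphic_on S" "\<gamma> holomorphic_on S"
      "\<And>t. t \<in> S \<Longrightarrow> dist (\<alpha> t) z0 < r \<and> dist (\<beta> t) (cnj z0) < r \<and> dist (\<gamma> t) \<kappa>0 < r" for \<alpha> \<beta> \<gamma> k S
    unfolding \<phi>_def
    by (rule hol2_compose[OF hol2_homog[OF AB f] that(2) _ that(1)])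
      (use that mem in \<open>auto intro!: holomorphic_intros\<close>)
  obtain e where e: "e > 0" "\<And>t. dist t (P z0 (cnj z0)) < e \<Longrightarrow> t \<in> \<real> \<Longrightarrow>
        uncountable {z \<in> cball z0 (r/2). P z (cnj z) = t}"
    using level[of "r/2"] r by auto
  have "isCont (\<lambda>\<kappa>. 1 - 1 / (\<kappa> * cnj \<kappa>)) \<kappa>0" using \<kappa>0(1) by (intro continuous_intros) auto
  moreover have "1 - 1 / (\<kappa>0 * cnj \<kappa>0) = P z0 (cnj z0)"
    using p(4) by (simp add: \<kappa>0_def on_M_def mult.commute)
  ultimately obtain r2' where r2': "r2' > 0" "\<And>\<kappa>. dist \<kappa> \<kappa>0 < r2' \<Longrightarrow> dist (1 - 1 / (\<kappa> * cnj \<kappa>)) (P z0 (cnj z0)) < e"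
    using e(1) unfolding continuous_at_eps_delta by metis
  define r2 where "r2 = min r r2'"
  have r2: "r2 > 0" "r2 \<le> r" "r2 \<le> r2'" using r r2' by (auto simp: r2_def)
  have C1: "\<exists>d. \<forall>\<zeta>\<in>V. rational_map d X (\<lambda>z. z) (\<phi> \<kappa> \<zeta>)" if \<kappa>: "dist \<kappa> \<kappa>0 < r2" for \<kappa>
  proof -
    define Z where "Z = cnj ` {z \<in> cball z0 (r/2). P z (cnj z) = 1 - 1 / (\<kappa> * cnj \<kappa>)}"
    have "1 - 1 / (\<kappa> * cnj \<kappa>) \<in> \<real>" by (simp add: complex_mult_cnj)
    then have "uncountable {z \<in> cball z0 (r/2). P z (cnj z) = 1 - 1 / (\<kappa> * cnj \<kappa>)}"
      using \<kappa> r2 r2' by (intro e) auto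
    then have unc: "uncountable Z"
      unfolding Z_def by (subst countable_image_inj_eq) (auto intro!: inj_onI)
    have ZK: "Z \<subseteq> cball (cnj z0) (r/2)"
      by (auto simp: Z_def dist_norm simp flip: complex_cnj_diff)
    have "\<exists>d. rational_map d X (\<lambda>z. z) (\<phi> \<kappa> \<zeta>)" if \<zeta>Z: "\<zeta> \<in> Z" for \<zeta>
    proof -
      obtain z1 where z1: "\<zeta> = cnj z1" "dist z0 z1 \<le> r/2" "P z1 (cnj z1) = 1 - 1 / (\<kappa> * cnj \<kappa>)"
        using \<zeta>Z unfolding Z_def by auto
      \<comment> \<open>\<open>(z1, w1)\<close> lies on the hypersurface, and its Segre variety is the curve with parameters \<open>\<zeta>\<close> and \<open>\<kappa>\<close>\<close>
      define w1 where "w1 = 1 / cnj \<kappa>"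
      have d1: "dist z1 z0 < r" "dist (cnj z1) (cnj z0) < r" "dist \<kappa> \<kappa>0 < r"
        using z1(2) r \<kappa> r2 by (auto simp: dist_commute dist_norm simp flip: complex_cnj_diff)
      from mem[OF this] have m1: "z1 \<in> A" "\<kappa> \<noteq> 0" "\<kappa> * (1 - P z1 (cnj z1)) \<in> B" by auto
      have "\<kappa> * (1 - P z1 (cnj z1)) = w1" using m1(2) by (simp add: z1(3) w1_def)
      then have w1: "w1 \<in> B" "w1 \<noteq> 0" "on_M z1 w1" "cnj w1 = 1 / \<kappa>"
        using m1 by (auto simp: w1_def on_M_def z1(3))
      obtain d \<delta> where d: "\<delta> > 0" "rational_map d (ball z1 \<delta>) (\<lambda>z. z)
         (\<lambda>k z. case k of None \<Rightarrow> 1 | Some j \<Rightarrow> f j z ((1 - P z (cnj z1)) / cnj w1))"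
        using segre_rational[OF AB f m1(1) w1(1-3) sph] by blast
      have "(case k of None \<Rightarrow> 1 | Some j \<Rightarrow> f j z ((1 - P z (cnj z1)) / cnj w1)) = \<phi> \<kappa> \<zeta> k z" for k z
        by (cases k) (auto simp: \<phi>_def homog_def w1(4) z1(1) mult.commute)
      with d(2) have "rational_map d (ball z1 \<delta>) (\<lambda>z. z) (\<phi> \<kappa> \<zeta>)" by simp
      then have "rational_map d X (\<lambda>z. z) (\<phi> \<kappa> \<zeta>)"
      proof (rule rational_map_extend)
        show "open X" "connected X" "z1 \<in> X" using d1 by (auto simp: X_def dist_commute)
        show "\<forall>\<^sub>F x in at z1. x \<in> ball z1 \<delta>" using d(1) by (intro eventually_at_in_open') auto
        show "\<phi> \<kappa> \<zeta> k holomorphic_on X" for k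
          by (rule hol) (use d1 z1(1) in \<open>auto simp: X_def dist_commute intro!: holomorphic_intros\<close>)
      qed
      then show ?thesis by blast
    qed
    from uncountable_frequently[of Z _ "\<lambda>d \<zeta>. rational_map d X (\<lambda>z. z) (\<phi> \<kappa> \<zeta>)", OF unc compact_cball ZK this]
    obtain d v0 where d: "v0 \<in> cball (cnj z0) (r/2)" "\<exists>\<^sub>F \<zeta> in at v0. \<zeta> \<in> Z \<and> rational_map d X (\<lambda>z. z) (\<phi> \<kappa> \<zeta>)" by blast
    show ?thesis
    proof (intro exI[of _ d] ballI)
      fix \<zeta> assume \<zeta>: "\<zeta> \<in> V"
      show "rational_map d X (\<lambda>z. z) (\<phi> \<kappa> \<zeta>)"
      proof (rule rational_map_continue[of V v0 \<zeta> X "\<lambda>x _. x" "\<lambda>k x \<zeta>. \<phi> \<kappa> \<zeta> k x"])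
        show "\<exists>\<^sub>F v in at v0. rational_map d X (\<lambda>z. z) (\<lambda>k x. \<phi> \<kappa> v k x)"
          using d(2) by (rule frequently_elim1) auto
        show "(\<lambda>\<zeta>. \<phi> \<kappa> \<zeta> k x) holomorphic_on V" if "x \<in> X" for k x
          by (rule hol) (use that \<kappa> r2 in \<open>auto simp: X_def V_def dist_commute intro!: holomorphic_intros\<close>)
      qed (use d(1) r \<zeta> in \<open>auto simp: V_def intro!: holomorphic_intros\<close>)
    qed
  qed
  have "uncountable (cball \<kappa>0 (r2/2))" using r2 by (simp add: uncountable_cball)
  then have "\<exists>d. \<exists>v0\<in>cball \<kappa>0 (r2/2). \<exists>\<^sub>F \<kappa> in at v0. \<kappa> \<in> cball \<kappa>0 (r2/2) \<and> (\<forall>\<zeta>\<in>V. rational_map d X (\<lambda>z. z) (\<phi> \<kappa> \<zeta>))"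
    by (rule uncountable_frequently[OF _ compact_cball subset_refl]) (use C1 r2 in \<open>auto simp: dist_commute\<close>)
  then obtain d v0 where d: "v0 \<in> cball \<kappa>0 (r2/2)" "\<exists>\<^sub>F \<kappa> in at v0. \<kappa> \<in> cball \<kappa>0 (r2/2) \<and> (\<forall>\<zeta>\<in>V. rational_map d X (\<lambda>z. z) (\<phi> \<kappa> \<zeta>))"
    by blast
  have "rational_map d X (\<lambda>z. z) (\<phi> \<kappa> \<zeta>)" if \<zeta>: "\<zeta> \<in> V" and \<kappa>: "\<kappa> \<in> ball \<kappa>0 r" for \<zeta> \<kappa>
  proof (rule rational_map_continue[of "ball \<kappa>0 r" v0 \<kappa> X "\<lambda>x _. x" "\<lambda>k x \<kappa>. \<phi> \<kappa> \<zeta> k x"])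
    show "\<exists>\<^sub>F v in at v0. rational_map d X (\<lambda>z. z) (\<lambda>k x. \<phi> v \<zeta> k x)"
      using d(2) by (rule frequently_elim1) (use \<zeta> in auto)
    show "(\<lambda>\<kappa>. \<phi> \<kappa> \<zeta> k x) holomorphic_on ball \<kappa>0 r" if "x \<in> X" for k x
      by (rule hol) (use that \<zeta> in \<open>auto simp: X_def V_def dist_commute intro!: holomorphic_intros\<close>)
  qed (use d(1) r2 \<kappa> in \<open>auto intro!: holomorphic_intros\<close>)
  then show ?thesis
    using r unfolding X_def V_def \<kappa>0_def \<phi>_def by blast
qed

text \<open>Continuation of \<open>\<zeta>\<close> from \<open>cnj z0\<close> to \<open>0\<close>, where the curves degenerate to horizontal lines. Along the way the curve
  is normalized to pass through a fixed point \<open>(z0, w)\<close>, so that it stays in the domain of \<open>f\<close>; this needs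
  \<open>P z0 \<zeta> \<noteq> 1\<close> on the segment.\<close>

lemma horizontal_rational:
  fixes f :: "'n::finite \<Rightarrow> complex \<Rightarrow> complex \<Rightarrow> complex"
  assumes AB: "open A" "open B" and f: "\<And>j. hol2 (A \<times> B) (f j)"
    and p: "z0 \<in> A" "w0 \<in> B" "w0 \<noteq> 0" "on_M z0 w0"
    and sph: "\<And>z w. z \<in> A \<Longrightarrow> w \<in> B \<Longrightarrow> on_M z w \<Longrightarrow> (\<Sum>j\<in>UNIV. f j z w * cnj (f j z w)) = 1"
    and level: "\<And>r. r > 0 \<Longrightarrow> \<exists>e>0. \<forall>t. dist t (P z0 (cnj z0)) < e \<longrightarrow> t \<in> \<real> \<longrightarrow>
        uncountable {z \<in> cball z0 r. P z (cnj z) = t}"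
    and P0: "P z0 0 = 0"
    and seg: "\<And>\<zeta>. \<zeta> \<in> closed_segment 0 (cnj z0) \<Longrightarrow> P z0 \<zeta> \<noteq> 1"
  shows "\<exists>d r. r > 0 \<and> (\<forall>z\<in>ball z0 r. \<forall>\<zeta>\<in>ball 0 r. \<forall>\<kappa>\<in>ball w0 r. z \<in> A \<and> \<kappa> * (1 - P z \<zeta>) \<in> B) \<and>
     (\<forall>\<zeta>\<in>ball 0 r. \<forall>\<kappa>\<in>ball w0 r. rational_map d (ball z0 r) (\<lambda>z. z) (\<lambda>k z. homog f k z (\<kappa> * (1 - P z \<zeta>))))"
proof -
  obtain d r where r: "r > 0" "\<And>\<zeta> \<kappa>. \<zeta> \<in> ball (cnj z0) r \<Longrightarrow> \<kappa> \<in> ball (1 / cnj w0) r \<Longrightarrow>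
     rational_map d (ball z0 r) (\<lambda>z. z) (\<lambda>k z. homog f k z (\<kappa> * (1 - P z \<zeta>)))"
    using segre_family_rational[OF AB f p sph level] by blast
  define K where "K = closed_segment 0 (cnj z0)"
  \<comment> \<open>the height above \<open>z\<close> of the curve with parameter \<open>\<zeta>\<close> through \<open>(z0, w)\<close>\<close>
  define g where "g = (\<lambda>z \<zeta> w. w * (1 - P z \<zeta>) / (1 - P z0 \<zeta>))"
  have opU: "open (A \<times> {\<zeta>. P z0 \<zeta> \<noteq> 1} \<times> UNIV)"
    by (intro open_Times AB(1) open_Collect_neq continuous_intros) auto
  have "\<exists>e>0. \<forall>y0\<in>K. \<forall>x y z. dist x z0 < e \<longrightarrow> dist y y0 < e \<longrightarrow> dist z w0 < e \<longrightarrow>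
     (x, y, z) \<in> A \<times> {\<zeta>. P z0 \<zeta> \<noteq> 1} \<times> UNIV \<and> (\<lambda>t. g (fst t) (fst (snd t)) (snd (snd t))) (x, y, z) \<in> B"
    by (rule compact_tube3[OF _ opU _ AB(2)]) (use p seg in \<open>auto intro!: continuous_intros simp: g_def K_def\<close>)
  then obtain e where e: "e > 0" "\<And>y0 z \<zeta> w. y0 \<in> K \<Longrightarrow> dist z z0 < e \<Longrightarrow> dist \<zeta> y0 < e \<Longrightarrow> dist w w0 < e \<Longrightarrow>
      z \<in> A \<and> P z0 \<zeta> \<noteq> 1 \<and> g z \<zeta> w \<in> B" by auto
  define V where "V = (\<Union>x\<in>K. \<Union>y\<in>ball 0 e. {x + y})"
  have V: "open V" "connected V" "K \<subseteq> V"
  proof -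
    show "open V" unfolding V_def by (rule open_sums) auto
    show "connected V" unfolding V_def
      by (intro convex_connected convex_sums) (auto simp: K_def)
    show "K \<subseteq> V" unfolding V_def using e(1) by force
  qed
  have Vmem: "z \<in> A \<and> P z0 \<zeta> \<noteq> 1 \<and> g z \<zeta> w \<in> B" if "\<zeta> \<in> V" "dist z z0 < e" "dist w w0 < e" for z \<zeta> w
  proof -
    from that(1) obtain x y where "x \<in> K" "y \<in> ball 0 e" "\<zeta> = x + y" unfolding V_def by auto
    then show ?thesis using that by (intro e(2)[of x]) (auto simp: dist_norm)
  qed
  define \<kappa>0 where "\<kappa>0 = 1 / cnj w0"
  have P1: "1 - P z0 (cnj z0) = w0 * cnj w0" using p(4) by (simp add: on_M_def)
  have "isCont (\<lambda>t. snd t / (1 - P z0 (fst t))) (cnj z0, w0)"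
    using P1 p(3) by (intro continuous_intros continuous_on_interior[of UNIV]) auto
  moreover have "snd (cnj z0, w0) / (1 - P z0 (fst (cnj z0, w0))) = \<kappa>0" using p(3) P1 by (simp add: \<kappa>0_def)
  ultimately obtain m where m: "m > 0" "\<And>t. dist t (cnj z0, w0) < m \<Longrightarrow> dist (snd t / (1 - P z0 (fst t))) \<kappa>0 < r"
    using r(1) unfolding continuous_at_eps_delta by metis
  define \<delta> where "\<delta> = min (min r e) m"
  have \<delta>: "\<delta> > 0" "\<delta> \<le> r" "\<delta> \<le> e" "\<delta> \<le> m" using r e m by (auto simp: \<delta>_def)
  have D: "rational_map d (ball z0 \<delta>) (\<lambda>z. z) (\<lambda>k z. homog f k z (g z \<zeta> w))" if "\<zeta> \<in> V" "dist w w0 < \<delta>/2" for \<zeta> w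
  proof (rule rational_map_continue[of V "cnj z0" \<zeta> "ball z0 \<delta>" "\<lambda>x _. x" "\<lambda>k z \<zeta>. homog f k z (g z \<zeta> w)"])
    show "cnj z0 \<in> V" using V(3) by (auto simp: K_def)
    show "(\<lambda>\<zeta>. homog f k z (g z \<zeta> w)) holomorphic_on V" if "z \<in> ball z0 \<delta>" for k z
    proof (rule hol2_compose[OF hol2_homog[OF AB f]])
      have *: "\<zeta> \<in> V \<Longrightarrow> z \<in> A \<and> P z0 \<zeta> \<noteq> 1 \<and> g z \<zeta> w \<in> B" for \<zeta>
        using that \<open>dist w w0 < \<delta>/2\<close> \<delta> by (intro Vmem) (auto simp: dist_commute)
      show "(z, g z \<zeta> w) \<in> A \<times> B" if "\<zeta> \<in> V" for \<zeta> using *[OF that] by blast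
      show "(\<lambda>\<zeta>. g z \<zeta> w) holomorphic_on V"
        unfolding g_def using * by (intro holomorphic_intros) fastforce
    qed (use V in \<open>auto intro!: holomorphic_intros\<close>)
    have "\<forall>\<^sub>F v in at (cnj z0). v \<in> ball (cnj z0) (\<delta>/2)" using \<delta> by (intro eventually_at_in_open') auto
    then have "\<forall>\<^sub>F v in at (cnj z0). rational_map d (ball z0 \<delta>) (\<lambda>z. z) (\<lambda>k z. homog f k z (g z v w))"
    proof eventually_elim
      case (elim v)
      have "dist (v, w) (cnj z0, w0) \<le> dist v (cnj z0) + dist w w0"
        unfolding dist_Pair_Pair by (rule sqrt_sum_squares_le_sum) auto
      also have "\<dots> < m" using elim that(2) \<delta> by (simp add: dist_commute)
      finally have "w / (1 - P z0 v) \<in> ball \<kappa>0 r" using m(2)[of "(v, w)"] by (simp add: dist_commute)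
      with elim have "rational_map d (ball z0 r) (\<lambda>z. z) (\<lambda>k z. homog f k z (w / (1 - P z0 v) * (1 - P z v)))"
        using \<delta> by (intro r(2)) (auto simp: \<kappa>0_def)
      then have "rational_map d (ball z0 r) (\<lambda>z. z) (\<lambda>k z. homog f k z (g z v w))" by (simp add: g_def)
      then show ?case by (rule rational_map_subset) (use \<delta> in auto)
    qed
    then show "\<exists>\<^sub>F v in at (cnj z0). rational_map d (ball z0 \<delta>) (\<lambda>z. z) (\<lambda>k z. homog f k z (g z v w))"
      by (rule eventually_frequently[OF at_neq_bot])
  qed (use V that in \<open>auto intro!: holomorphic_intros\<close>)
  have "isCont (\<lambda>t. snd t * (1 - P z0 (fst t))) (0, w0)"
    by (intro continuous_intros continuous_on_interior[of UNIV]) auto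
  moreover have "snd (0, w0) * (1 - P z0 (fst (0, w0))) = w0" by (simp add: P0)
  ultimately obtain n where n: "n > 0" "\<And>t. dist t (0, w0) < n \<Longrightarrow> dist (snd t * (1 - P z0 (fst t))) w0 < \<delta>/2"
    using \<delta>(1) unfolding continuous_at_eps_delta by (metis half_gt_zero)
  define \<rho> where "\<rho> = min (n/2) \<delta>"
  have \<rho>: "\<rho> > 0" "\<rho> \<le> n/2" "\<rho> \<le> \<delta>" using n \<delta> by (auto simp: \<rho>_def)
  have fin: "z \<in> A \<and> \<kappa> * (1 - P z \<zeta>) \<in> B" "rational_map d (ball z0 \<rho>) (\<lambda>z. z) (\<lambda>k z. homog f k z (\<kappa> * (1 - P z \<zeta>)))"
    if "\<zeta> \<in> ball 0 \<rho>" "\<kappa> \<in> ball w0 \<rho>" "z \<in> ball z0 \<rho>" for z \<zeta> \<kappa>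
  proof -
    have "dist (\<zeta>, \<kappa>) (0, w0) \<le> dist \<zeta> 0 + dist \<kappa> w0"
      unfolding dist_Pair_Pair by (rule sqrt_sum_squares_le_sum) auto
    also have "\<dots> < n" using that \<rho> by (simp add: dist_commute)
    finally have d: "dist (\<kappa> * (1 - P z0 \<zeta>)) w0 < \<delta>/2" using n(2)[of "(\<zeta>, \<kappa>)"] by simp
    have \<zeta>: "\<zeta> \<in> V" unfolding V_def using that(1) \<rho> \<delta> by (intro UN_I[of 0] UN_I[of \<zeta>]) (auto simp: K_def)
    have P: "P z0 \<zeta> \<noteq> 1" using Vmem[OF \<zeta>, of z0 w0] e(1) by auto
    then have g: "g z \<zeta> (\<kappa> * (1 - P z0 \<zeta>)) = \<kappa> * (1 - P z \<zeta>)" for z by (simp add: g_def)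
    show "z \<in> A \<and> \<kappa> * (1 - P z \<zeta>) \<in> B"
      using Vmem[OF \<zeta>, of z "\<kappa> * (1 - P z0 \<zeta>)"] that(3) d \<rho> \<delta> by (auto simp: g dist_commute)
    show "rational_map d (ball z0 \<rho>) (\<lambda>z. z) (\<lambda>k z. homog f k z (\<kappa> * (1 - P z \<zeta>)))"
      using D[OF \<zeta> d] \<rho> unfolding g by (elim rational_map_subset) auto
  qed
  have "z0 \<in> ball z0 \<rho>" using \<rho> by simp
  then show ?thesis using fin \<rho>(1) by blast
qed

end

section \<open>Holomorphic coefficients\<close>

text \<open>A family \<open>k\<close> of polynomials of degree at most \<open>d\<close> in \<open>z\<close> whose coefficients depend on \<open>w\<close>.\<close>

definition zpoly :: "nat \<Rightarrow> ('k \<Rightarrow> nat \<Rightarrow> complex \<Rightarrow> complex) \<Rightarrow> 'k \<Rightarrow> complex \<Rightarrow> complex \<Rightarrow> complex" where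
  "zpoly d a k z w = (\<Sum>i\<le>d. a k i w * z ^ i)"

lemma infinite_ball: "r > 0 \<Longrightarrow> infinite (ball (z :: complex) r)"
  using uncountable_ball[of r z] countable_finite by blast

lemma zpoly_as_poly: "zpoly d a k z w = poly (\<Sum>i\<le>d. monom (a k i w) i) z"
  by (simp add: zpoly_def poly_sum poly_monom)

lemma zpoly_zero_coeff:
  assumes "infinite X" "\<And>z. z \<in> X \<Longrightarrow> zpoly d a k z w = 0" "i \<le> d"
  shows "a k i w = 0"
proof -
  have "(\<Sum>i\<le>d. monom (a k i w) i) = 0"
  proof (rule ccontr)
    assume "(\<Sum>i\<le>d. monom (a k i w) i) \<noteq> 0"
    from poly_roots_finite[OF this] have "finite X"
      by (rule finite_subset[rotated]) (use assms(2) in \<open>auto simp flip: zpoly_as_poly\<close>)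
    with assms(1) show False by simp
  qed
  then have "coeff (\<Sum>i\<le>d. monom (a k i w) i) i = 0" by simp
  then show ?thesis using assms(3) by (simp add: coeff_sum_monom)
qed

lemma zpoly_product_eq:
  assumes "infinite X"
    "\<And>z. z \<in> X \<Longrightarrow> zpoly d a k z w * zpoly d b l z v = zpoly d a' k' z w' * zpoly d b' l' z v'"
  shows "zpoly d a k z w * zpoly d b l z v = zpoly d a' k' z w' * zpoly d b' l' z v'"
proof -
  let ?p = "\<lambda>a k w. \<Sum>i\<le>d. monom (a k i w) i"
  have "?p a k w * ?p b l v - ?p a' k' w' * ?p b' l' v' = 0"
  proof (rule ccontr)
    assume "?p a k w * ?p b l v - ?p a' k' w' * ?p b' l' v' \<noteq> 0"
    from poly_roots_finite[OF this] have "finite X"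
      by (rule finite_subset[rotated]) (use assms(2) in \<open>auto simp flip: zpoly_as_poly\<close>)
    with assms(1) show False by simp
  qed
  then have "poly (?p a k w * ?p b l v - ?p a' k' w' * ?p b' l' v') z = 0" by simp
  then show ?thesis by (simp flip: zpoly_as_poly)
qed

lemma holomorphic_zpoly:
  assumes "\<And>i. i \<le> d \<Longrightarrow> a k i holomorphic_on V" "\<alpha> holomorphic_on S" "\<omega> holomorphic_on S" "\<omega> ` S \<subseteq> V"
  shows "(\<lambda>t. zpoly d a k (\<alpha> t) (\<omega> t)) holomorphic_on S"
  unfolding zpoly_def
proof (intro holomorphic_intros assms(2))
  fix i assume "i \<in> {..d}"
  then have "(a k i \<circ> \<omega>) holomorphic_on S"
    by (intro holomorphic_on_compose_gen[OF assms(3) assms(1) assms(4)]) auto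
  then show "(\<lambda>t. a k i (\<omega> t)) holomorphic_on S" by (simp add: o_def)
qed

context segre begin

text \<open>A relation with denominator identically zero at \<open>w0\<close> would have all numerators zero there too, because the
  denominator of \<open>homog f\<close> is \<open>1\<close>; so the denominator is nontrivial.\<close>

lemma horizontal_coefficients:
  fixes f :: "'n::finite \<Rightarrow> complex \<Rightarrow> complex \<Rightarrow> complex"
  assumes AB: "open A" "open B" and f: "\<And>j. hol2 (A \<times> B) (f j)"
    and r: "r > 0" "\<And>z \<kappa>. z \<in> ball z0 r \<Longrightarrow> \<kappa> \<in> ball w0 r \<Longrightarrow> z \<in> A \<and> \<kappa> \<in> B"
    and rat: "\<And>\<kappa>. \<kappa> \<in> ball w0 r \<Longrightarrow> rational_map d (ball z0 r) (\<lambda>z. z) (\<lambda>k z. homog f k z \<kappa>)"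
  shows "\<exists>a. (\<forall>k. \<forall>i\<le>d. a k i holomorphic_on ball w0 r) \<and> (\<exists>i\<le>d. a None i w0 \<noteq> 0) \<and>
    (\<forall>k. \<forall>z\<in>ball z0 r. \<forall>w\<in>ball w0 r. zpoly d a None z w * homog f k z w = zpoly d a k z w)"
proof -
  obtain a k0 i0 where a: "\<And>k i. i \<le> d \<Longrightarrow> a k i holomorphic_on ball w0 r" "a k0 i0 w0 \<noteq> 0" "i0 \<le> d"
    "\<And>x v k. x \<in> ball z0 r \<Longrightarrow> v \<in> ball w0 r \<Longrightarrow> (\<Sum>i\<le>d. a None i v * x ^ i) * homog f k x v =
        (\<Sum>i\<le>d. a k i v * x ^ i) * homog f None x v"
  proof (rule rational_map_propagate[of "ball w0 r" w0 w0 "ball z0 r" "\<lambda>x _. x" "homog f" d])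
    show "homog f k x holomorphic_on ball w0 r" if x: "x \<in> ball z0 r" for k x
    proof (rule hol2_compose[OF hol2_homog[OF AB f]])
      show "(x, t) \<in> A \<times> B" if "t \<in> ball w0 r" for t using r(2)[OF x that] by simp
    qed (auto intro!: holomorphic_intros)
    have "\<forall>\<^sub>F v in at w0. v \<in> ball w0 r" using r(1) by (intro eventually_at_in_open') auto
    then have "\<forall>\<^sub>F v in at w0. rational_map d (ball z0 r) (\<lambda>x. x) (\<lambda>k x. homog f k x v)"
      by (rule eventually_mono) (rule rat)
    then show "\<exists>\<^sub>F v in at w0. rational_map d (ball z0 r) (\<lambda>x. x) (\<lambda>k x. homog f k x v)"
      by (rule eventually_frequently[OF at_neq_bot])
  qed (insert r(1), (simp; fail | rule that; assumption)+)
  have id: "zpoly d a None z w * homog f k z w = zpoly d a k z w" if "z \<in> ball z0 r" "w \<in> ball w0 r" for k z w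
    using a(4)[OF that, of k] by (simp add: zpoly_def homog_def)
  have "\<exists>i\<le>d. a None i w0 \<noteq> 0"
  proof (rule ccontr)
    assume "\<not> ?thesis"
    then have "zpoly d a None z w0 = 0" for z by (simp add: zpoly_def)
    then have "zpoly d a k0 z w0 = 0" if "z \<in> ball z0 r" for z using id[OF that, of w0 k0] r(1) by simp
    with zpoly_zero_coeff[of "ball z0 r" d a k0 w0 i0] a(2,3) r(1) show False
      by (simp add: infinite_ball)
  qed
  then show ?thesis
    by (intro exI[of _ a] conjI allI impI ballI a(1) id)
qed

text \<open>On the line of height \<open>w\<close> the map is now known for all \<open>z\<close>, since \<open>a\<close> is polynomial in \<open>z\<close>. The window in \<open>z\<close> can therefore be
  moved from \<open>z0\<close> to \<open>0\<close>, where \<open>P x \<zeta>\<close> is small for all \<open>\<zeta>\<close> in a bounded set, so that nothing obstructs the continuation of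
  \<open>\<zeta>\<close> from \<open>0\<close> to \<open>1\<close>.\<close>

lemma curve_coefficients:
  assumes r: "r > 0" and P0: "\<And>z. P z 0 = 0"
    and a: "\<And>k i. i \<le> d \<Longrightarrow> a k i holomorphic_on ball w0 r"
    and rat: "\<And>\<zeta> \<kappa>. \<zeta> \<in> ball 0 r \<Longrightarrow> \<kappa> \<in> ball w0 r \<Longrightarrow> (\<And>z. z \<in> ball z0 r \<Longrightarrow> \<kappa> * (1 - P z \<zeta>) \<in> ball w0 r) \<Longrightarrow>
       rational_map d (ball z0 r) (\<lambda>z. z) (\<lambda>k z. zpoly d a k z (\<kappa> * (1 - P z \<zeta>)))"
  obtains \<rho> k0 i0 and b :: "'n::finite option \<Rightarrow> nat \<Rightarrow> complex \<Rightarrow> complex"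
  where "\<rho> > 0" "\<And>k i. i \<le> d \<Longrightarrow> b k i holomorphic_on ball w0 \<rho>" "i0 \<le> d" "b k0 i0 w0 \<noteq> 0"
    "\<And>k x \<kappa>. x \<in> ball 0 \<rho> \<Longrightarrow> \<kappa> \<in> ball w0 \<rho> \<Longrightarrow> \<kappa> * (1 - P x 1) \<in> ball w0 r \<and>
       zpoly d b None x \<kappa> * zpoly d a k x (\<kappa> * (1 - P x 1)) = zpoly d b k x \<kappa> * zpoly d a None x (\<kappa> * (1 - P x 1))"
proof -
  \<comment> \<open>a disc that contains \<open>0\<close> and the original window around \<open>z0\<close>\<close>
  define R where "R = cmod z0 + r"
  have "\<exists>e>0. \<forall>y0\<in>cball 0 R. \<forall>x y z. dist x w0 < e \<longrightarrow> dist y y0 < e \<longrightarrow> dist z 0 < e \<longrightarrow>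
     (x, y, z) \<in> UNIV \<and> (\<lambda>t. fst t * (1 - P (fst (snd t)) (snd (snd t)))) (x, y, z) \<in> ball w0 r"
    by (rule compact_tube3) (use r in \<open>auto intro!: continuous_intros simp: P0\<close>)
  then obtain e1 where e1: "e1 > 0" "\<And>\<kappa> z0 z \<zeta>. z0 \<in> cball 0 R \<Longrightarrow> dist \<kappa> w0 < e1 \<Longrightarrow> dist z z0 < e1 \<Longrightarrow> dist \<zeta> 0 < e1 \<Longrightarrow>
      \<kappa> * (1 - P z \<zeta>) \<in> ball w0 r" by auto
  define \<rho>1 where "\<rho>1 = min e1 r"
  have \<rho>1: "\<rho>1 > 0" "\<rho>1 \<le> e1" "\<rho>1 \<le> r" using e1(1) r by (auto simp: \<rho>1_def)
  have sub: "ball z0 r \<subseteq> ball 0 R"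
  proof
    fix z assume "z \<in> ball z0 r"
    then show "z \<in> ball 0 R" using norm_triangle_ineq2[of z z0] by (simp add: R_def dist_norm norm_minus_commute)
  qed
  have mem1: "\<kappa> * (1 - P z \<zeta>) \<in> ball w0 r" if "z \<in> ball 0 R" "\<zeta> \<in> ball 0 \<rho>1" "\<kappa> \<in> ball w0 \<rho>1" for z \<zeta> \<kappa>
    using that \<rho>1 e1(1) by (intro e1(2)[of z]) (auto simp: dist_commute)
  have rat1: "rational_map d (ball 0 R) (\<lambda>z. z) (\<lambda>k z. zpoly d a k z (\<kappa> * (1 - P z \<zeta>)))"
    if "\<zeta> \<in> ball 0 \<rho>1" "\<kappa> \<in> ball w0 \<rho>1" for \<zeta> \<kappa>
  proof (rule rational_map_extend)
    show "rational_map d (ball z0 r) (\<lambda>z. z) (\<lambda>k z. zpoly d a k z (\<kappa> * (1 - P z \<zeta>)))"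
      using that \<rho>1 sub mem1 by (intro rat) auto
    show "z0 \<in> ball 0 R" using r by (simp add: R_def)
    show "\<forall>\<^sub>F x in at z0. x \<in> ball z0 r" using r by (intro eventually_at_in_open') auto
    show "(\<lambda>z. zpoly d a k z (\<kappa> * (1 - P z \<zeta>))) holomorphic_on ball 0 R" for k
      by (rule holomorphic_zpoly[OF a]) (use mem1 that in \<open>auto intro!: holomorphic_intros\<close>)
  qed auto
  \<comment> \<open>the path of \<open>\<zeta>\<close>, which is then thickened to the open set \<open>V\<close>\<close>
  define K where "K = closed_segment 0 (1::complex)"
  have "\<exists>e>0. \<forall>y0\<in>K. \<forall>x y z. dist x 0 < e \<longrightarrow> dist y y0 < e \<longrightarrow> dist z w0 < e \<longrightarrow>
     (x, y, z) \<in> UNIV \<and> (\<lambda>t. snd (snd t) * (1 - P (fst t) (fst (snd t)))) (x, y, z) \<in> ball w0 r"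
    by (rule compact_tube3) (use r P0 P_sym[of 0] in \<open>auto intro!: continuous_intros simp: K_def\<close>)
  then obtain e2 where e2: "e2 > 0" "\<And>y0 x \<zeta> \<kappa>. y0 \<in> K \<Longrightarrow> dist x 0 < e2 \<Longrightarrow> dist \<zeta> y0 < e2 \<Longrightarrow> dist \<kappa> w0 < e2 \<Longrightarrow>
      \<kappa> * (1 - P x \<zeta>) \<in> ball w0 r" by auto
  define V where "V = (\<Union>x\<in>K. \<Union>y\<in>ball 0 e2. {x + y})"
  have V: "open V" "connected V" "K \<subseteq> V"
  proof -
    show "open V" unfolding V_def by (rule open_sums) auto
    show "connected V" unfolding V_def
      by (intro convex_connected convex_sums) (auto simp: K_def)
    show "K \<subseteq> V" unfolding V_def using e2(1) by force
  qed
  have mem2: "\<kappa> * (1 - P x \<zeta>) \<in> ball w0 r" if "\<zeta> \<in> V" "x \<in> ball 0 e2" "\<kappa> \<in> ball w0 e2" for x \<zeta> \<kappa>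
  proof -
    from that(1) obtain u y where "u \<in> K" "y \<in> ball 0 e2" "\<zeta> = u + y" unfolding V_def by auto
    then show ?thesis using that by (intro e2(2)[of u]) (auto simp: dist_norm norm_minus_commute)
  qed
  define \<rho> where "\<rho> = min e2 \<rho>1"
  have \<rho>: "\<rho> > 0" "\<rho> \<le> e2" "\<rho> \<le> \<rho>1" using e2(1) \<rho>1 by (auto simp: \<rho>_def)
  have subR: "ball 0 \<rho> \<subseteq> ball 0 R" using \<rho> \<rho>1 by (auto simp: R_def) (smt (verit) norm_ge_zero)
  have rat2: "rational_map d (ball 0 \<rho>) (\<lambda>x. x) (\<lambda>k x. zpoly d a k x (\<kappa> * (1 - P x 1)))" if \<kappa>: "\<kappa> \<in> ball w0 \<rho>" for \<kappa>
  proof (rule rational_map_continue[of V 0 1 "ball 0 \<rho>" "\<lambda>x _. x" "\<lambda>k x \<zeta>. zpoly d a k x (\<kappa> * (1 - P x \<zeta>))"])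
    show "0 \<in> V" "1 \<in> V" using V(3) by (auto simp: K_def)
    show "(\<lambda>\<zeta>. zpoly d a k x (\<kappa> * (1 - P x \<zeta>))) holomorphic_on V" if "x \<in> ball 0 \<rho>" for k x
    proof (rule holomorphic_zpoly[OF a])
      have "x \<in> ball 0 e2" "\<kappa> \<in> ball w0 e2" using that \<kappa> \<rho> by auto
      then show "(\<lambda>\<zeta>. \<kappa> * (1 - P x \<zeta>)) ` V \<subseteq> ball w0 r" using mem2 by blast
    qed (auto intro!: holomorphic_intros)
    have "\<forall>\<^sub>F v in at 0. v \<in> ball 0 \<rho>1" using \<rho>1 by (intro eventually_at_in_open') auto
    then have "\<forall>\<^sub>F v in at 0. rational_map d (ball 0 \<rho>) (\<lambda>x. x) (\<lambda>k x. zpoly d a k x (\<kappa> * (1 - P x v)))"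
    proof eventually_elim
      case (elim v)
      show ?case by (rule rational_map_subset[OF rat1[OF elim] subR]) (use \<kappa> \<rho> in auto)
    qed
    then show "\<exists>\<^sub>F v in at 0. rational_map d (ball 0 \<rho>) (\<lambda>x. x) (\<lambda>k x. zpoly d a k x (\<kappa> * (1 - P x v)))"
      by (rule eventually_frequently[OF at_neq_bot])
  qed (use V in auto)
  have mem3: "\<kappa> * (1 - P x 1) \<in> ball w0 r" if "x \<in> ball 0 \<rho>" "\<kappa> \<in> ball w0 \<rho>" for x \<kappa>
    using that \<rho> V(3) by (intro mem2) (auto simp: K_def)
  obtain b k0 i0 where b: "\<And>k i. i \<le> d \<Longrightarrow> b k i holomorphic_on ball w0 \<rho>" "b k0 i0 w0 \<noteq> 0" "i0 \<le> d"
    "\<And>x v k. x \<in> ball 0 \<rho> \<Longrightarrow> v \<in> ball w0 \<rho> \<Longrightarrow> (\<Sum>i\<le>d. b None i v * x ^ i) * zpoly d a k x (v * (1 - P x 1)) =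
        (\<Sum>i\<le>d. b k i v * x ^ i) * zpoly d a None x (v * (1 - P x 1))"
  proof (rule rational_map_propagate[of "ball w0 \<rho>" w0 w0 "ball 0 \<rho>" "\<lambda>x _. x" "\<lambda>k x \<kappa>. zpoly d a k x (\<kappa> * (1 - P x 1))" d])
    show "(\<lambda>\<kappa>. zpoly d a k x (\<kappa> * (1 - P x 1))) holomorphic_on ball w0 \<rho>" if "x \<in> ball 0 \<rho>" for k x
      by (rule holomorphic_zpoly[OF a]) (use mem3 that in \<open>auto intro!: holomorphic_intros\<close>)
    have "\<forall>\<^sub>F v in at w0. v \<in> ball w0 \<rho>" using \<rho>(1) by (intro eventually_at_in_open') auto
    then have "\<forall>\<^sub>F v in at w0. rational_map d (ball 0 \<rho>) (\<lambda>x. x) (\<lambda>k x. zpoly d a k x (v * (1 - P x 1)))"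
      by (rule eventually_mono) (rule rat2)
    then show "\<exists>\<^sub>F v in at w0. rational_map d (ball 0 \<rho>) (\<lambda>x. x) (\<lambda>k x. zpoly d a k x (v * (1 - P x 1)))"
      by (rule eventually_frequently[OF at_neq_bot])
  qed (insert \<rho>(1), (simp; fail | rule that; assumption)+)
  show ?thesis
  proof (rule that[of \<rho> b i0 k0])
    show "\<kappa> * (1 - P x 1) \<in> ball w0 r \<and>
        zpoly d b None x \<kappa> * zpoly d a k x (\<kappa> * (1 - P x 1)) = zpoly d b k x \<kappa> * zpoly d a None x (\<kappa> * (1 - P x 1))"
      if "x \<in> ball 0 \<rho>" "\<kappa> \<in> ball w0 \<rho>" for k x \<kappa>
      using b(4)[OF that, of k] mem3[OF that] by (simp only: zpoly_def)
    show "b k i holomorphic_on ball w0 \<rho>" if "i \<le> d" for k i using b(1)[OF that] .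
  qed (fact \<rho>(1) b(2) b(3))+
qed

end

section \<open>Continuation along a ray\<close>

context segre begin

text \<open>If the denominator \<open>b None\<close> vanished identically, then so would the product of \<open>b k0\<close> and \<open>a None\<close>. For each \<open>x\<close> one of
  the two factors vanishes for all \<open>\<kappa>\<close>, and one of them does so for infinitely many \<open>x\<close>; both possibilities contradict a
  nonzero coefficient.\<close>

lemma curve_coefficients_nonzero:
  fixes b :: "'n option \<Rightarrow> nat \<Rightarrow> complex \<Rightarrow> complex"
  assumes \<rho>: "\<rho> > 0" and P0: "\<And>\<zeta>. P 0 \<zeta> = 0"
    and a: "\<And>k i. i \<le> d \<Longrightarrow> a k i holomorphic_on ball w0 r" "i1 \<le> d" "a None i1 w0 \<noteq> 0"
    and b: "\<And>k i. i \<le> d \<Longrightarrow> b k i holomorphic_on ball w0 \<rho>" "i0 \<le> d" "b k0 i0 w0 \<noteq> 0"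
    and id: "\<And>k x \<kappa>. x \<in> ball 0 \<rho> \<Longrightarrow> \<kappa> \<in> ball w0 \<rho> \<Longrightarrow> \<kappa> * (1 - P x 1) \<in> ball w0 r \<and>
       zpoly d b None x \<kappa> * zpoly d a k x (\<kappa> * (1 - P x 1)) = zpoly d b k x \<kappa> * zpoly d a None x (\<kappa> * (1 - P x 1))"
  shows "\<exists>\<kappa>\<in>ball w0 \<rho>. \<exists>i\<le>d. b None i \<kappa> \<noteq> 0"
proof (rule ccontr)
  assume "\<not> ?thesis"
  then have bN: "zpoly d b None x \<kappa> = 0" if "\<kappa> \<in> ball w0 \<rho>" for x \<kappa> using that by (simp add: zpoly_def)
  have prod: "zpoly d b k0 x \<kappa> * zpoly d a None x (\<kappa> * (1 - P x 1)) = 0" if "x \<in> ball 0 \<rho>" "\<kappa> \<in> ball w0 \<rho>" for x \<kappa>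
    using id[OF that, of k0] bN[OF that(2)] by simp
  have w0b: "w0 \<in> ball w0 \<rho>" using \<rho> by simp
  have dich: "(\<forall>\<kappa>\<in>ball w0 \<rho>. zpoly d b k0 x \<kappa> = 0) \<or> (\<forall>\<kappa>\<in>ball w0 \<rho>. zpoly d a None x (\<kappa> * (1 - P x 1)) = 0)"
    if x: "x \<in> ball 0 \<rho>" for x
  proof (rule ccontr)
    assume "\<not> ?thesis"
    then obtain u v where uv: "u \<in> ball w0 \<rho>" "zpoly d b k0 x u \<noteq> 0" "v \<in> ball w0 \<rho>" "zpoly d a None x (v * (1 - P x 1)) \<noteq> 0"
      by blast
    have "(\<lambda>\<kappa>. zpoly d b k0 x \<kappa>) holomorphic_on ball w0 \<rho>"
      by (rule holomorphic_zpoly[OF b(1)]) (auto intro!: holomorphic_intros)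
    from holomorphic_eventually_nonzero[OF open_ball _ w0b this uv(1,2)]
    have e1: "\<forall>\<^sub>F \<kappa> in at w0. zpoly d b k0 x \<kappa> \<noteq> 0" by simp
    have "(\<lambda>\<kappa>. zpoly d a None x (\<kappa> * (1 - P x 1))) holomorphic_on ball w0 \<rho>"
      by (rule holomorphic_zpoly[OF a(1)]) (use id[OF x] in \<open>auto intro!: holomorphic_intros\<close>)
    from holomorphic_eventually_nonzero[OF open_ball _ w0b this uv(3,4)]
    have e2: "\<forall>\<^sub>F \<kappa> in at w0. zpoly d a None x (\<kappa> * (1 - P x 1)) \<noteq> 0" by simp
    have e3: "\<forall>\<^sub>F \<kappa> in at w0. \<kappa> \<in> ball w0 \<rho>" using w0b by (intro eventually_at_in_open') auto
    from e1 e2 e3 have "\<forall>\<^sub>F \<kappa> in at w0. False"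
    proof eventually_elim
      case (elim \<kappa>)
      show ?case using prod[OF x elim(3)] elim(1,2) by simp
    qed
    then show False by simp
  qed
  have "isCont (\<lambda>x. w0 / (1 - P x 1)) 0"
    by (intro continuous_intros continuous_on_interior[of UNIV]) (auto simp: P0)
  then obtain e where e: "e > 0" "\<And>x. dist x 0 < e \<Longrightarrow> dist (w0 / (1 - P x 1)) w0 < \<rho>"
    using \<rho> unfolding continuous_at_eps_delta by (metis P0 diff_zero div_by_1)
  have "isCont (\<lambda>x. P x 1) 0" by (intro continuous_on_interior[of UNIV] continuous_intros) auto
  then obtain e' where e': "e' > 0" "\<And>x. dist x 0 < e' \<Longrightarrow> dist (P x 1) 0 < 1"
    unfolding continuous_at_eps_delta by (metis P0 zero_less_one)
  define X where "X = ball (0::complex) (min (min e e') \<rho>)"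
  have X: "infinite X" unfolding X_def using e(1) e'(1) \<rho> by (intro infinite_ball) auto
  define X1 where "X1 = {x\<in>X. \<forall>\<kappa>\<in>ball w0 \<rho>. zpoly d b k0 x \<kappa> = 0}"
  define X2 where "X2 = {x\<in>X. \<forall>\<kappa>\<in>ball w0 \<rho>. zpoly d a None x (\<kappa> * (1 - P x 1)) = 0}"
  have "X \<subseteq> ball 0 \<rho>" by (auto simp: X_def)
  then have "X = X1 \<union> X2" using dich unfolding X1_def X2_def by blast
  then consider "infinite X1" | "infinite X2" using X by auto
  then show False
  proof cases
    case 1
    then have "b k0 i0 w0 = 0"
      by (rule zpoly_zero_coeff[OF _ _ b(2)]) (use w0b in \<open>simp add: X1_def\<close>)
    with b(3) show False by simp
  next
    case 2
    have "zpoly d a None x w0 = 0" if x: "x \<in> X2" for x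
    proof -
      have d: "dist x 0 < e" "dist x 0 < e'" using x by (auto simp: X2_def X_def)
      have "w0 / (1 - P x 1) \<in> ball w0 \<rho>" using e(2)[OF d(1)] by (simp add: dist_commute)
      then have "zpoly d a None x (w0 / (1 - P x 1) * (1 - P x 1)) = 0" using x unfolding X2_def by blast
      moreover have "P x 1 \<noteq> 1" using e'(2)[OF d(2)] by auto
      ultimately show ?thesis by simp
    qed
    from zpoly_zero_coeff[OF 2 this a(2)] a(3) show False by simp
  qed
qed

text \<open>The point \<open>(z, w)\<close> lies on the curve with parameters \<open>\<zeta> = 1\<close> and \<open>\<kappa> = w / (1 - P z 1)\<close>, so the map is known from \<open>b\<close> wherever
  this \<open>\<kappa>\<close> is near \<open>w0\<close>: that is, near the points \<open>(s, w s)\<close> with \<open>w s = w0 * (1 - P s 1)\<close>. In a window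
  \<open>z = s + x\<close> around \<open>s\<close>, the restriction to height \<open>w s\<close> is rational in \<open>z\<close> of degree \<open>d\<close> for small \<open>s\<close>, and hence for
  all \<open>s\<close> near the segment. As \<open>w\<close> is injective near the segment, the coefficients become functions of the height.\<close>

lemma ray_coefficients:
  fixes b :: "'n::finite option \<Rightarrow> nat \<Rightarrow> complex \<Rightarrow> complex"
  assumes w0: "w0 \<noteq> 0" and P0: "\<And>z. P z 0 = 0"
    and a: "\<And>k i. i \<le> d \<Longrightarrow> a k i holomorphic_on ball w0 r" "i1 \<le> d" "a None i1 w0 \<noteq> 0"
    and \<rho>: "\<rho> > 0" and b: "\<And>k i. i \<le> d \<Longrightarrow> b k i holomorphic_on ball w0 \<rho>" "i0 \<le> d" "b k0 i0 w0 \<noteq> 0"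
    and id: "\<And>k x \<kappa>. x \<in> ball 0 \<rho> \<Longrightarrow> \<kappa> \<in> ball w0 \<rho> \<Longrightarrow> \<kappa> * (1 - P x 1) \<in> ball w0 r \<and>
       zpoly d b None x \<kappa> * zpoly d a k x (\<kappa> * (1 - P x 1)) = zpoly d b k x \<kappa> * zpoly d a None x (\<kappa> * (1 - P x 1))"
    and seg: "s1 \<le> 0" "0 \<le> s2" "\<And>x. s1 \<le> x \<Longrightarrow> x \<le> s2 \<Longrightarrow> P (of_real x) 1 \<noteq> 1"
      "\<And>x. s1 \<le> x \<Longrightarrow> x \<le> s2 \<Longrightarrow> 0 < Re (deriv (\<lambda>s. P s 1) (of_real x))"
  obtains V g k1 i2 \<mu> where "open V" "connected V"
     "\<And>x. s1 \<le> x \<Longrightarrow> x \<le> s2 \<Longrightarrow> w0 * (1 - P (of_real x) 1) \<in> V"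
     "\<And>k i. i \<le> d \<Longrightarrow> g k i holomorphic_on V" "i2 \<le> d" "g (k1 :: 'n option) i2 w0 \<noteq> 0"
     "\<mu> > 0" "ball w0 \<mu> \<subseteq> V \<inter> ball w0 r" "\<And>w. w \<in> ball w0 \<mu> \<Longrightarrow> a None i1 w \<noteq> 0"
     "\<And>w k z. w \<in> ball w0 \<mu> \<Longrightarrow> zpoly d g None z w * zpoly d a k z w = zpoly d g k z w * zpoly d a None z w"
proof -
  have P0': "P 0 \<zeta> = 0" for \<zeta> using P0[of \<zeta>] P_sym[of 0 \<zeta>] by simp
  define Q where "Q = (\<lambda>s. P s 1)"
  have Qhol: "Q holomorphic_on S" for S unfolding Q_def by (intro holomorphic_intros)
  have Qcont: "continuous_on S h \<Longrightarrow> continuous_on S (\<lambda>t. Q (h t))" for h :: "complex \<times> complex \<times> complex \<Rightarrow> complex" and S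
    unfolding Q_def by (intro continuous_intros)
  have Q0: "Q 0 = 0" by (simp add: Q_def P0')
  define w where "w = (\<lambda>s. w0 * (1 - Q s))"
  have w_0: "w 0 = w0" by (simp add: w_def Q0)
  have whol: "w holomorphic_on S" for S unfolding w_def by (intro holomorphic_intros Qhol)
  define K where "K = complex_of_real ` {s1..s2}"
  have K: "compact K" "convex K" "0 \<in> K"
  proof -
    show "compact K" unfolding K_def by (intro compact_continuous_image continuous_intros) auto
    show "convex K" unfolding K_def by (intro convex_linear_image) (auto simp: linear_iff scaleR_conv_of_real)
    show "0 \<in> K" unfolding K_def using seg(1,2) by (intro image_eqI[of _ _ 0]) auto
  qed
  define U where "U = {t :: complex \<times> complex \<times> complex. Q (fst (snd t) + fst t) \<noteq> 1}"
  have "\<exists>e>0. \<forall>y0\<in>K. \<forall>x y z. dist x 0 < e \<longrightarrow> dist y y0 < e \<longrightarrow> dist z 0 < e \<longrightarrow>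
     (x, y, z) \<in> U \<and> (\<lambda>t. w0 * (1 - Q (fst (snd t))) / (1 - Q (fst (snd t) + fst t))) (x, y, z) \<in> ball w0 \<rho>"
  proof (rule compact_tube3[OF K(1)])
    show "open U" unfolding U_def by (intro open_Collect_neq continuous_intros Qcont)
    show "continuous_on U (\<lambda>t. w0 * (1 - Q (fst (snd t))) / (1 - Q (fst (snd t) + fst t)))"
      by (intro continuous_intros Qcont) (auto simp: U_def)
    fix y assume "y \<in> K"
    then have "Q y \<noteq> 1" using seg(3) by (auto simp: K_def Q_def)
    then show "(0, y, 0) \<in> U \<and> w0 * (1 - Q (fst (snd (0, y, 0)))) / (1 - Q (fst (snd (0, y, 0)) + fst (0, y, 0))) \<in> ball w0 \<rho>"
      using \<rho> by (simp add: U_def)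
  qed auto
  then obtain e1 where e1: "e1 > 0" and e1': "\<And>y0 x s. y0 \<in> K \<Longrightarrow> dist x 0 < e1 \<Longrightarrow> dist s y0 < e1 \<Longrightarrow>
     Q (s + x) \<noteq> 1 \<and> w s / (1 - Q (s + x)) \<in> ball w0 \<rho>"
    by (fastforce simp: U_def w_def)
  have "open {s. 0 < Re (deriv Q s)}"
    by (intro open_Collect_less continuous_intros holomorphic_on_imp_continuous_on holomorphic_deriv Qhol) auto
  moreover have "K \<subseteq> {s. 0 < Re (deriv Q s)}" using seg(4) by (auto simp: K_def Q_def)
  ultimately obtain e2 where e2: "e2 > 0" "(\<Union>x\<in>K. ball x e2) \<subseteq> {s. 0 < Re (deriv Q s)}"
    using compact_subset_open_imp_ball_epsilon_subset[OF K(1)] by metis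
  define e where "e = min (min e1 e2) (\<rho> / 2)"
  have e: "e > 0" "e \<le> e1" "e \<le> e2" "e \<le> \<rho>/2" using e1 e2(1) \<rho> by (auto simp: e_def)
  \<comment> \<open>a convex neighbourhood of the segment on which \<open>Q\<close> has derivative with positive real part\<close>
  define T where "T = (\<Union>x\<in>K. \<Union>y\<in>ball 0 e. {x + y})"
  have T: "open T" "convex T" "connected T" "K \<subseteq> T" "ball 0 e \<subseteq> T"
  proof -
    show "open T" unfolding T_def by (rule open_sums) auto
    show "convex T" unfolding T_def by (intro convex_sums K) auto
    then show "connected T" by (rule convex_connected)
    show "K \<subseteq> T" unfolding T_def using e(1) by force
    show "ball 0 e \<subseteq> T" unfolding T_def using K(3) by force
  qed
  have T0: "0 \<in> T" using T(4) K(3) by blast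
  have Tmem: "Q (s + x) \<noteq> 1 \<and> w s / (1 - Q (s + x)) \<in> ball w0 \<rho>" "0 < Re (deriv Q s)"
    if s: "s \<in> T" and x: "x \<in> ball 0 e" for s x
  proof -
    from s obtain u y where uy: "u \<in> K" "y \<in> ball 0 e" "s = u + y" unfolding T_def by auto
    have d: "dist s u < e" using uy by (simp add: dist_norm)
    show "Q (s + x) \<noteq> 1 \<and> w s / (1 - Q (s + x)) \<in> ball w0 \<rho>"
      using uy(1) d x e(2) by (intro e1'[of u]) auto
    have "s \<in> ball u e2" using d e(3) by (simp add: dist_commute)
    then show "0 < Re (deriv Q s)" using e2(2) uy(1) by blast
  qed
  have winj: "inj_on w T"
  proof (rule inj_onI, rule ccontr)
    fix s t assume st: "s \<in> T" "t \<in> T" "w s = w t" "s \<noteq> t"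
    then have Qst: "Q s = Q t" using w0 by (simp add: w_def)
    have "\<exists>u. u \<in> closed_segment s t \<and> Re (Q t * cnj (t - s)) - Re (Q s * cnj (t - s)) =
        Re ((deriv Q u * cnj (t - s)) * (t - s))"
      by (rule complex_mvt_line) (auto intro!: DERIV_cmult_right holomorphic_derivI[OF Qhol[of UNIV]] simp del: complex_cnj_diff)
    then obtain u where u: "u \<in> closed_segment s t" "Re ((deriv Q u * cnj (t - s)) * (t - s)) = 0"
      by (auto simp: Qst)
    have "u \<in> T" using u(1) closed_segment_subset[OF st(1,2) T(2)] by blast
    then have "0 < Re (deriv Q u)" using Tmem(2)[of u 0] e(1) by simp
    moreover have eq: "(deriv Q u * cnj (t - s)) * (t - s) = deriv Q u * of_real ((cmod (t - s))\<^sup>2)"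
      by (simp only: complex_norm_square mult_ac)
    have "Re (deriv Q u) * (cmod (t - s))\<^sup>2 = 0"
      using u(2) unfolding eq by (simp only: times_complex.sel Re_complex_of_real Im_complex_of_real mult_zero_right diff_zero)
    ultimately show False using st(4) by simp
  qed
  \<comment> \<open>the values of the map at the points \<open>(s + x, w s)\<close>\<close>
  define \<phi> where "\<phi> = (\<lambda>k x s. zpoly d b k (s + x) (w s / (1 - Q (s + x))))"
  have "0 < r" using id[of 0 w0] \<rho> by (simp add: P0')
  then have "isCont (a None i1) (w 0)"
    using holomorphic_on_imp_continuous_on[OF a(1)[OF a(2), of None]] by (simp add: w_0 continuous_on_eq_continuous_at)
  moreover have "isCont w 0"
    using holomorphic_on_imp_continuous_on[OF whol[of UNIV]] by (simp add: continuous_on_eq_continuous_at)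
  ultimately have "isCont (\<lambda>s. a None i1 (w s)) 0" by (intro isCont_o2[of 0 w "a None i1"])
  then have "\<forall>\<^sub>F s in at 0. a None i1 (w s) \<noteq> 0"
    using a(3) w_0 by (intro tendsto_imp_eventually_ne[where c = "a None i1 w0"]) (auto simp: isCont_def)
  then obtain \<delta>' where \<delta>': "\<delta>' > 0" "\<And>s. s \<noteq> 0 \<Longrightarrow> dist s 0 < \<delta>' \<Longrightarrow> a None i1 (w s) \<noteq> 0"
    unfolding eventually_at by blast
  define \<delta> where "\<delta> = min \<delta>' (e/2)"
  have \<delta>: "\<delta> > 0" "\<delta> \<le> \<delta>'" "\<delta> \<le> e/2" using \<delta>' e by (auto simp: \<delta>_def)
  have aw: "a None i1 (w s) \<noteq> 0" if "s \<in> ball 0 \<delta>" for s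
    using \<delta>'(2)[of s] that \<delta> a(3) w_0 by (cases "s = 0") auto
  have idw: "w s \<in> ball w0 r \<and> zpoly d b None (s + x) (w s / (1 - Q (s + x))) * zpoly d a k (s + x) (w s) =
      zpoly d b k (s + x) (w s / (1 - Q (s + x))) * zpoly d a None (s + x) (w s)"
    if "s \<in> ball 0 e" "x \<in> ball 0 e" for s x k
  proof -
    have "s + x \<in> ball 0 \<rho>" using that e(4) norm_triangle_ineq[of s x] by simp
    moreover have T': "Q (s + x) \<noteq> 1 \<and> w s / (1 - Q (s + x)) \<in> ball w0 \<rho>" using that T by (intro Tmem) auto
    ultimately show ?thesis using id[of "s + x" "w s / (1 - Q (s + x))" k] by (simp add: Q_def)
  qed
  obtain t k1 i2 where t: "\<And>k i. i \<le> d \<Longrightarrow> t k i holomorphic_on T" "t k1 i2 0 \<noteq> 0" "i2 \<le> d"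
    "\<And>x s k. x \<in> ball 0 e \<Longrightarrow> s \<in> T \<Longrightarrow> (\<Sum>i\<le>d. t None i s * (s + x) ^ i) * \<phi> k x s =
        (\<Sum>i\<le>d. t k i s * (s + x) ^ i) * \<phi> None x s"
  proof (rule rational_map_propagate[of T 0 0 "ball 0 e" "\<lambda>x s. s + x" \<phi> d])
    show "\<phi> k x holomorphic_on T" if x: "x \<in> ball 0 e" for k x
      unfolding \<phi>_def
    proof (rule holomorphic_zpoly[OF b(1)])
      show "(\<lambda>s. w s / (1 - Q (s + x))) ` T \<subseteq> ball w0 \<rho>" using Tmem(1)[OF _ x] by blast
      have "(\<lambda>s. Q (s + x)) holomorphic_on T" unfolding Q_def by (intro holomorphic_intros)
      moreover have "1 - Q (s + x) \<noteq> 0" if "s \<in> T" for s using Tmem(1)[OF that x] by auto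
      ultimately show "(\<lambda>s. w s / (1 - Q (s + x))) holomorphic_on T"
        by (intro holomorphic_intros whol) auto
    qed (auto intro!: holomorphic_intros)
    have "\<forall>\<^sub>F s in at 0. s \<in> ball 0 \<delta>" using \<delta>(1) by (intro eventually_at_in_open') auto
    then have "\<forall>\<^sub>F s in at 0. rational_map d (ball 0 e) (\<lambda>x. s + x) (\<lambda>k x. \<phi> k x s)"
    proof eventually_elim
      case (elim s)
      show ?case
      proof (rule rational_map_sumI[where a = "\<lambda>k i. a k i (w s)" and m = None and j = i1])
        fix x :: complex and k assume x: "x \<in> ball 0 e"
        have "s \<in> ball 0 e" using elim \<delta> by auto
        from idw[OF this x, of k]
        show "(\<Sum>i\<le>d. a None i (w s) * (s + x) ^ i) * \<phi> k x s = (\<Sum>i\<le>d. a k i (w s) * (s + x) ^ i) * \<phi> None x s"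
          unfolding \<phi>_def zpoly_def[of _ a, symmetric] by (simp only: mult.commute)
      qed (use aw[OF elim] a(2) in auto)
    qed
    then show "\<exists>\<^sub>F s in at 0. rational_map d (ball 0 e) (\<lambda>x. s + x) (\<lambda>k x. \<phi> k x s)"
      by (rule eventually_frequently[OF at_neq_bot])
  qed (insert T(1,3) T0, (intro holomorphic_intros; fail | simp; fail | rule that; assumption)+)
  obtain \<kappa>1 j1 where bN: "\<kappa>1 \<in> ball w0 \<rho>" "j1 \<le> d" "b None j1 \<kappa>1 \<noteq> 0"
    using curve_coefficients_nonzero[OF \<rho> P0' a b id] by blast
  \<comment> \<open>The coefficients \<open>t\<close> and \<open>a\<close> describe the same map at height \<open>w s\<close>: if some cross product did not vanish,
    then the denominator \<open>b None\<close> would vanish at all nearby points, and hence identically.\<close>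
  have \<Delta>: "zpoly d t None z s * zpoly d a k z (w s) = zpoly d t k z s * zpoly d a None z (w s)"
    if z: "z \<in> ball 0 \<delta>" and s: "s \<in> ball 0 \<delta>" for z s k
  proof (rule ccontr)
    assume ne: "\<not> ?thesis"
    define D where "D = (\<lambda>z s. zpoly d t None z s * zpoly d a k z (w s) - zpoly d t k z s * zpoly d a None z (w s))"
    have wr: "w ` ball 0 \<delta> \<subseteq> ball w0 r" using idw[of _ 0] e(1) \<delta> by force
    have subT: "ball 0 \<delta> \<subseteq> T" using T(5) \<delta> by auto
    have D0: "zpoly d b None z (w s / (1 - Q z)) = 0" if "z \<in> ball 0 \<delta>" "s \<in> ball 0 \<delta>" "D z s \<noteq> 0" for z s
    proof -
      define x where "x = z - s"
      have x: "x \<in> ball 0 e" using that(1,2) \<delta>(3) norm_triangle_ineq4[of z s] by (simp add: x_def)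
      have se: "s \<in> ball 0 e" using that(2) \<delta> by auto
      have zsx: "s + x = z" by (simp add: x_def)
      have 1: "zpoly d t None z s * zpoly d b k z (w s / (1 - Q z)) = zpoly d t k z s * zpoly d b None z (w s / (1 - Q z))"
        using t(4)[OF x, of s k] se T(5) by (auto simp: zsx \<phi>_def zpoly_def)
      have 2: "zpoly d b None z (w s / (1 - Q z)) * zpoly d a k z (w s) = zpoly d b k z (w s / (1 - Q z)) * zpoly d a None z (w s)"
        using idw[OF se x, of k] by (simp add: zsx)
      have "zpoly d b None z (w s / (1 - Q z)) * D z s =
          zpoly d t None z s * (zpoly d b None z (w s / (1 - Q z)) * zpoly d a k z (w s)) -
          (zpoly d t k z s * zpoly d b None z (w s / (1 - Q z))) * zpoly d a None z (w s)"
        by (simp add: D_def algebra_simps)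
      also have "\<dots> = 0" unfolding 2 1[symmetric] by (simp add: algebra_simps)
      finally show ?thesis using that(3) by simp
    qed
    have Dz: "(\<lambda>z. D z s) holomorphic_on ball 0 \<delta>"
      unfolding D_def zpoly_def by (intro holomorphic_intros)
    have Ds: "(\<lambda>s. D z s) holomorphic_on ball 0 \<delta>" for z
      unfolding D_def
      by (intro holomorphic_intros holomorphic_zpoly[OF t(1)] holomorphic_zpoly[OF a(1)] whol)
        (use wr subT in auto)
    have Dne: "D z s \<noteq> 0" using ne by (simp add: D_def)
    obtain \<epsilon> where \<epsilon>: "\<epsilon> > 0" "\<And>y. dist z y < \<epsilon> \<Longrightarrow> D y s \<noteq> 0"
      using continuous_on_open_avoid[OF holomorphic_on_imp_continuous_on[OF Dz] open_ball z Dne] by blast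
    define X where "X = ball z (min \<epsilon> (\<delta> - cmod z))"
    have X: "infinite X" unfolding X_def using \<epsilon>(1) z by (intro infinite_ball) auto
    have "zpoly d b None y \<kappa>1 = 0" if y: "y \<in> X" for y
    proof -
      have yd: "y \<in> ball 0 \<delta>"
        using y norm_triangle_ineq2[of y z] by (simp add: X_def dist_norm norm_minus_commute)
      have Dy: "D y s \<noteq> 0" using \<epsilon>(2)[of y] y by (simp add: X_def)
      have Qy: "Q y \<noteq> 1" using Tmem(1)[OF T0, of y] yd \<delta>(3) e(1) by auto
      have "y - s \<in> ball 0 e" using yd s \<delta>(3) norm_triangle_ineq4[of y s] by simp
      from Tmem(1)[OF _ this, of s] subT s
      have \<kappa>b: "w s / (1 - Q y) \<in> ball w0 \<rho>" by auto
      show ?thesis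
      proof (rule holomorphic_frequently_zero[OF open_ball _ \<kappa>b _ _ bN(1), where h = "\<lambda>\<kappa>. zpoly d b None y \<kappa>"])
        show "(\<lambda>\<kappa>. zpoly d b None y \<kappa>) holomorphic_on ball w0 \<rho>"
          by (rule holomorphic_zpoly[OF b(1)]) (auto intro!: holomorphic_intros)
        have ev: "\<forall>\<^sub>F u in at s. u \<in> ball 0 \<delta>" using s by (intro eventually_at_in_open') auto
        have "filterlim (\<lambda>u. w u / (1 - Q y)) (at (w s / (1 - Q y))) (at s)"
        proof (rule filterlim_atI)
          have "isCont w s" using holomorphic_on_imp_continuous_on[OF whol[of UNIV]] by (simp add: continuous_on_eq_continuous_at)
          then show "((\<lambda>u. w u / (1 - Q y)) \<longlongrightarrow> w s / (1 - Q y)) (at s)"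
            using Qy by (intro tendsto_intros) (auto simp: isCont_def)
          have "\<forall>\<^sub>F u in at s. u \<noteq> s" by (simp add: eventually_neq_at_within)
          with ev show "\<forall>\<^sub>F u in at s. w u / (1 - Q y) \<noteq> w s / (1 - Q y)"
          proof eventually_elim
            case (elim u)
            then have "w u \<noteq> w s" using winj subT s unfolding inj_on_def by blast
            then show ?case using Qy by simp
          qed
        qed
        note lim = this
        have "\<forall>\<^sub>F u in at s. D y u \<noteq> 0"
          by (rule holomorphic_eventually_nonzero[OF open_ball _ s Ds s Dy]) simp
        with ev have zero: "\<forall>\<^sub>F u in at s. zpoly d b None y (w u / (1 - Q y)) = 0"
        proof eventually_elim
          case (elim u)
          then show ?case using yd by (intro D0)
        qed
        show "\<exists>\<^sub>F \<kappa> in at (w s / (1 - Q y)). zpoly d b None y \<kappa> = 0"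
          unfolding frequently_def
        proof
          assume "\<forall>\<^sub>F \<kappa> in at (w s / (1 - Q y)). zpoly d b None y \<kappa> \<noteq> 0"
          from eventually_compose_filterlim[OF this lim] zero have "\<forall>\<^sub>F u in at s. False"
            by eventually_elim simp
          then show False by simp
        qed
      qed simp
    qed
    from zpoly_zero_coeff[OF X this bN(2)] bN(3) show False by simp
  qed
  obtain \<sigma> where \<sigma>: "\<sigma> holomorphic_on w ` T" "\<And>s. s \<in> T \<Longrightarrow> \<sigma> (w s) = s"
    by (rule holomorphic_has_inverse[OF whol[of T] T(1) winj]) blast
  define V where "V = w ` T"
  define g where "g = (\<lambda>k i v. t k i (\<sigma> v))"
  have subT: "ball 0 \<delta> \<subseteq> T" using T(5) \<delta> by auto
  have "open (w ` ball 0 \<delta>)"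
    by (rule open_mapping_thm3[OF whol open_ball inj_on_subset[OF winj subT]])
  moreover have "w0 \<in> w ` ball 0 \<delta>" using w_0 \<delta>(1) by (metis centre_in_ball image_eqI)
  ultimately obtain \<mu> where \<mu>: "\<mu> > 0" "ball w0 \<mu> \<subseteq> w ` ball 0 \<delta>"
    using open_contains_ball by blast
  show ?thesis
  proof (rule that[of V g i2 k1 \<mu>])
  show "open V" unfolding V_def by (rule open_mapping_thm3[OF whol T(1) winj])
  show "connected V"
    unfolding V_def by (intro connected_continuous_image holomorphic_on_imp_continuous_on whol T)
  show "w0 * (1 - P (of_real x) 1) \<in> V" if "s1 \<le> x" "x \<le> s2" for x
  proof -
    have "of_real x \<in> T" using T(4) that by (auto simp: K_def)
    then show ?thesis unfolding V_def w_def Q_def by blast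
  qed
  show "g k i holomorphic_on V" if "i \<le> d" for k i
    unfolding g_def using holomorphic_on_compose_gen[OF \<sigma>(1) t(1)[OF that]] \<sigma>(2) by (fastforce simp: V_def o_def)
  show "g k1 i2 w0 \<noteq> 0" using t(2) \<sigma>(2)[OF T0] by (simp add: g_def w_0)
  show "ball w0 \<mu> \<subseteq> V \<inter> ball w0 r"
    using \<mu>(2) subT idw[of _ 0] e(1) \<delta>(1,3) unfolding V_def by force
  fix v assume v: "v \<in> ball w0 \<mu>"
  have both: "a None i1 v \<noteq> 0 \<and> (\<forall>k z. zpoly d g None z v * zpoly d a k z v = zpoly d g k z v * zpoly d a None z v)"
  proof -
    obtain s where s: "s \<in> ball 0 \<delta>" "v = w s" using \<mu>(2) v by blast
    then have "\<sigma> v = s" using \<sigma>(2) subT by blast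
    then have g: "zpoly d g k z v = zpoly d t k z s" for k z by (simp add: zpoly_def g_def)
    have "zpoly d t None z s * zpoly d a k z (w s) = zpoly d t k z s * zpoly d a None z (w s)" for k z
      by (rule zpoly_product_eq[of "ball 0 \<delta>"]) (use \<delta>(1) infinite_ball \<Delta> s(1) in auto)
    then show ?thesis using aw[OF s(1)] unfolding g unfolding s(2) by blast
  qed
  show "a None i1 v \<noteq> 0" using both by blast
  show "zpoly d g None z v * zpoly d a k z v = zpoly d g k z v * zpoly d a None z v" for k z using both by blast
  qed (fact \<mu>(1) t(3))+
qed

end

section \<open>The continued map in lowest terms\<close>

lemma zpoly_lowest:
  assumes "l \<le> d" "\<And>i. i < l \<Longrightarrow> g k i w = 0"
  shows "zpoly d g k z w = z ^ l * zpoly (d - l) (\<lambda>k i. g k (i + l)) k z w"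
proof -
  have "zpoly d g k z w = (\<Sum>i\<in>{l..d}. g k i w * z ^ i)"
    unfolding zpoly_def using assms(2) by (intro sum.mono_neutral_right) (auto simp: not_le)
  also have "\<dots> = (\<Sum>i\<in>{0..d - l}. g k (i + l) w * z ^ (i + l))"
    using sum.atLeastAtMost_shift_0[OF assms(1), of "\<lambda>i. g k i w * z ^ i"] by (simp add: o_def add.commute)
  also have "\<dots> = z ^ l * zpoly (d - l) (\<lambda>k i. g k (i + l)) k z w"
    by (simp add: zpoly_def sum_distrib_left power_add algebra_simps atLeast0AtMost)
  finally show ?thesis .
qed

context segre begin

text \<open>The preceding steps combined. Removing the largest power of \<open>z\<close> that divides all components leaves a
  representative \<open>g\<close> that does not vanish identically on the line \<open>z = 0\<close>, where the map will be evaluated.\<close>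

lemma ray_continuation:
  fixes f :: "'n::finite \<Rightarrow> complex \<Rightarrow> complex \<Rightarrow> complex"
  assumes AB: "open A" "open B" and f: "\<And>j. hol2 (A \<times> B) (f j)"
    and p: "z0 \<in> A" "w0 \<in> B" "z0 \<noteq> 0" "w0 \<noteq> 0" "on_M z0 w0"
    and sph: "\<And>z w. z \<in> A \<Longrightarrow> w \<in> B \<Longrightarrow> on_M z w \<Longrightarrow> (\<Sum>j\<in>UNIV. f j z w * cnj (f j z w)) = 1"
    and level: "\<And>r. r > 0 \<Longrightarrow> \<exists>e>0. \<forall>t. dist t (P z0 (cnj z0)) < e \<longrightarrow> t \<in> \<real> \<longrightarrow>
        uncountable {z \<in> cball z0 r. P z (cnj z) = t}"
    and P0: "\<And>z. P z 0 = 0"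
    and chord: "\<And>\<zeta>. \<zeta> \<in> closed_segment 0 (cnj z0) \<Longrightarrow> P z0 \<zeta> \<noteq> 1"
    and seg: "s1 \<le> 0" "0 \<le> s2" "\<And>x. s1 \<le> x \<Longrightarrow> x \<le> s2 \<Longrightarrow> P (of_real x) 1 \<noteq> 1"
      "\<And>x. s1 \<le> x \<Longrightarrow> x \<le> s2 \<Longrightarrow> 0 < Re (deriv (\<lambda>s. P s 1) (of_real x))"
  obtains d V g k1 v1 \<mu> where "open V" "connected V"
     "\<And>x. s1 \<le> x \<Longrightarrow> x \<le> s2 \<Longrightarrow> w0 * (1 - P (of_real x) 1) \<in> V"
     "\<And>k i. i \<le> d \<Longrightarrow> g (k :: 'n option) i holomorphic_on V" "v1 \<in> V" "g k1 0 v1 \<noteq> 0"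
     "\<mu> > 0" "ball w0 \<mu> \<subseteq> V \<inter> B" "ball z0 \<mu> \<subseteq> A"
     "\<And>k z w. z \<in> ball z0 \<mu> \<Longrightarrow> w \<in> ball w0 \<mu> \<Longrightarrow> zpoly d g None z w * homog f k z w = zpoly d g k z w"
proof -
  obtain d r where r: "r > 0" "\<And>z \<zeta> \<kappa>. z \<in> ball z0 r \<Longrightarrow> \<zeta> \<in> ball 0 r \<Longrightarrow> \<kappa> \<in> ball w0 r \<Longrightarrow> z \<in> A \<and> \<kappa> * (1 - P z \<zeta>) \<in> B"
     "\<And>\<zeta> \<kappa>. \<zeta> \<in> ball 0 r \<Longrightarrow> \<kappa> \<in> ball w0 r \<Longrightarrow> rational_map d (ball z0 r) (\<lambda>z. z) (\<lambda>k z. homog f k z (\<kappa> * (1 - P z \<zeta>)))"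
    using horizontal_rational[OF AB f p(1,2,4,5) sph level P0 chord] by blast
  have mem: "z \<in> A \<and> \<kappa> \<in> B" if "z \<in> ball z0 r" "\<kappa> \<in> ball w0 r" for z \<kappa>
    using r(2)[OF that(1) _ that(2), of 0] r(1) by (simp add: P0)
  have rat0: "rational_map d (ball z0 r) (\<lambda>z. z) (\<lambda>k z. homog f k z \<kappa>)" if "\<kappa> \<in> ball w0 r" for \<kappa>
    using r(3)[OF _ that, of 0] r(1) by (simp add: P0)
  obtain a i1 where a: "\<And>k i. i \<le> d \<Longrightarrow> a k i holomorphic_on ball w0 r" "i1 \<le> d" "a None i1 w0 \<noteq> 0"
      "\<And>k z w. z \<in> ball z0 r \<Longrightarrow> w \<in> ball w0 r \<Longrightarrow> zpoly d a None z w * homog f k z w = zpoly d a k z w"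
    using horizontal_coefficients[OF AB f r(1) mem rat0] by blast
  have ratc: "rational_map d (ball z0 r) (\<lambda>z. z) (\<lambda>k z. zpoly d a k z (\<kappa> * (1 - P z \<zeta>)))"
    if "\<zeta> \<in> ball 0 r" "\<kappa> \<in> ball w0 r" "\<And>z. z \<in> ball z0 r \<Longrightarrow> \<kappa> * (1 - P z \<zeta>) \<in> ball w0 r" for \<zeta> \<kappa>
    using r(3)[OF that(1,2)]
    by (rule rational_map_scale[where l = "\<lambda>z. zpoly d a None z (\<kappa> * (1 - P z \<zeta>))"]) (use that(3) a(4) in simp)
  obtain \<rho> k0 i0 and b :: "'n option \<Rightarrow> nat \<Rightarrow> complex \<Rightarrow> complex" where \<rho>: "\<rho> > 0"
     and b: "\<And>k i. i \<le> d \<Longrightarrow> b k i holomorphic_on ball w0 \<rho>" "i0 \<le> d" "b k0 i0 w0 \<noteq> 0"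
     and idb: "\<And>k x \<kappa>. x \<in> ball 0 \<rho> \<Longrightarrow> \<kappa> \<in> ball w0 \<rho> \<Longrightarrow> \<kappa> * (1 - P x 1) \<in> ball w0 r \<and>
       zpoly d b None x \<kappa> * zpoly d a k x (\<kappa> * (1 - P x 1)) = zpoly d b k x \<kappa> * zpoly d a None x (\<kappa> * (1 - P x 1))"
  proof (rule curve_coefficients[of r d a w0 z0])
  qed (rule r(1) P0 | rule a(1) ratc that; assumption)+
  obtain V g k1 i2 \<mu> where V: "open V" "connected V"
     "\<And>x. s1 \<le> x \<Longrightarrow> x \<le> s2 \<Longrightarrow> w0 * (1 - P (of_real x) 1) \<in> V"
     and g: "\<And>k i. i \<le> d \<Longrightarrow> g k i holomorphic_on V" "i2 \<le> d" "g (k1 :: 'n option) i2 w0 \<noteq> 0"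
     and \<mu>: "\<mu> > 0" "ball w0 \<mu> \<subseteq> V \<inter> ball w0 r"
     and idg: "\<And>w. w \<in> ball w0 \<mu> \<Longrightarrow> a None i1 w \<noteq> 0"
       "\<And>w k z. w \<in> ball w0 \<mu> \<Longrightarrow> zpoly d g None z w * zpoly d a k z w = zpoly d g k z w * zpoly d a None z w"
  proof (rule ray_coefficients[of w0 d a r i1 \<rho> b i0 k0 s1 s2])
  qed (rule p(4) P0 a(2,3) \<rho> b(2,3) seg(1,2) | rule a(1) b(1) idb seg(3,4) that; assumption)+
  have gf: "zpoly d g None z w * homog f k z w = zpoly d g k z w" if z: "z \<in> ball z0 r" and w: "w \<in> ball w0 \<mu>" for k z w
  proof -
    have wr: "w \<in> ball w0 r" using w \<mu>(2) by blast
    have holf: "(\<lambda>z. homog f k z w) holomorphic_on ball z0 r"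
      by (rule hol2_compose[OF hol2_homog[OF AB f]]) (use mem[OF _ wr] in \<open>auto intro!: holomorphic_intros\<close>)
    have z0b: "z0 \<in> ball z0 r" using r(1) by simp
    have "zpoly d g None z w * homog f k z w - zpoly d g k z w = 0"
    proof (rule holomorphic_frequently_zero[OF open_ball _ z0b _ _ z])
      show "(\<lambda>z. zpoly d g None z w * homog f k z w - zpoly d g k z w) holomorphic_on ball z0 r"
        unfolding zpoly_def by (intro holomorphic_intros holf)
      have ah: "(\<lambda>z. zpoly d a None z w) holomorphic_on ball z0 r"
        unfolding zpoly_def by (intro holomorphic_intros)
      have "\<exists>y\<in>ball z0 r. zpoly d a None y w \<noteq> 0"
        using zpoly_zero_coeff[of "ball z0 r" d a None w i1] infinite_ball[OF r(1)] idg(1)[OF w] a(2) by blast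
      then obtain y where "y \<in> ball z0 r" "zpoly d a None y w \<noteq> 0" by blast
      from holomorphic_eventually_nonzero[OF open_ball _ z0b ah this]
      have "\<forall>\<^sub>F z in at z0. zpoly d a None z w \<noteq> 0" by simp
      moreover have "\<forall>\<^sub>F z in at z0. z \<in> ball z0 r" using z0b by (intro eventually_at_in_open') auto
      ultimately have "\<forall>\<^sub>F z in at z0. zpoly d g None z w * homog f k z w - zpoly d g k z w = 0"
      proof eventually_elim
        case (elim z)
        have "zpoly d a None z w * (zpoly d g None z w * homog f k z w - zpoly d g k z w) =
            zpoly d g None z w * (zpoly d a None z w * homog f k z w) - zpoly d g k z w * zpoly d a None z w"
          by (simp add: algebra_simps)
        also have "\<dots> = 0" using a(4)[OF elim(2) wr, of k] idg(2)[OF w, where k = k and z = z] by simp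
        finally show ?case using elim(1) by simp
      qed
      then show "\<exists>\<^sub>F z in at z0. zpoly d g None z w * homog f k z w - zpoly d g k z w = 0"
        by (rule eventually_frequently[OF at_neq_bot])
    qed simp
    then show ?thesis by simp
  qed
  \<comment> \<open>the order of vanishing of \<open>g\<close> along \<open>z = 0\<close>\<close>
  define l where "l = (LEAST i. \<exists>k. \<exists>v\<in>V. g k i v \<noteq> 0)"
  have "w0 \<in> V" using \<mu> by auto
  then have ex: "\<exists>k. \<exists>v\<in>V. g k i2 v \<noteq> 0" using g(3) by blast
  have l: "\<exists>k. \<exists>v\<in>V. g k l v \<noteq> 0" unfolding l_def by (rule LeastI[of _ i2]) (rule ex)
  have ld: "l \<le> d"
    unfolding l_def by (rule le_trans[OF Least_le[of "\<lambda>i. \<exists>k. \<exists>v\<in>V. g k i v \<noteq> 0" i2, OF ex] g(2)])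
  have low: "g k i v = 0" if "i < l" "v \<in> V" for k i v
    using not_less_Least[of i "\<lambda>i. \<exists>k. \<exists>v\<in>V. g k i v \<noteq> 0"] that unfolding l_def by blast
  define g' where "g' = (\<lambda>k i. g k (i + l))"
  have pl: "zpoly d g k z w = z ^ l * zpoly (d - l) g' k z w" if "w \<in> V" for k z w
    unfolding g'_def using low that by (intro zpoly_lowest[OF ld])
  \<comment> \<open>the new window around \<open>z0\<close> avoids \<open>0\<close>, so that \<open>z ^ l\<close> can be cancelled\<close>
  define \<nu> where "\<nu> = min (min \<mu> r) (cmod z0)"
  have \<nu>: "\<nu> > 0" "\<nu> \<le> \<mu>" "\<nu> \<le> r" "\<nu> \<le> cmod z0" using \<mu> r p(3) by (auto simp: \<nu>_def)
  have subw: "ball w0 \<nu> \<subseteq> V \<inter> ball w0 r" using \<mu>(2) \<nu>(2) by auto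
  obtain k2 v2 where kv: "v2 \<in> V" "g k2 l v2 \<noteq> 0" using l by blast
  show ?thesis
  proof (rule that[of V "d - l" g' v2 k2 \<nu>])
    show "open V" "connected V" "v2 \<in> V" by fact+
    show "w0 * (1 - P (of_real x) 1) \<in> V" if "s1 \<le> x" "x \<le> s2" for x by (rule V(3)[OF that])
    show "g' k i holomorphic_on V" if "i \<le> d - l" for k i unfolding g'_def using that ld by (intro g(1)) simp
    show "g' k2 0 v2 \<noteq> 0" using kv by (simp add: g'_def)
    show "\<nu> > 0" by (rule \<nu>(1))
    show "ball w0 \<nu> \<subseteq> V \<inter> B" using subw mem[of z0] r(1) by auto
    show "ball z0 \<nu> \<subseteq> A" using mem[of _ w0] r(1) \<nu>(3) by auto
    fix k z w assume z: "z \<in> ball z0 \<nu>" and w: "w \<in> ball w0 \<nu>"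
    have "z \<noteq> 0" using z \<nu>(4) by auto
    moreover have wV: "w \<in> V" using w subw by blast
    have "z ^ l * (zpoly (d - l) g' None z w * homog f k z w) = z ^ l * zpoly (d - l) g' k z w"
      using gf[of z w k] z w \<nu>(2,3) by (simp add: pl[OF wV] mult.assoc)
    ultimately show "zpoly (d - l) g' None z w * homog f k z w = zpoly (d - l) g' k z w" by simp
  qed
qed

end

section \<open>Transport of the sphere equation\<close>

text \<open>The sum of the \<open>|x j * Y - X * y j|\<^sup>2\<close> expands to zero. Arguing with this sum avoids a division by \<open>Y\<close>.\<close>

lemma cauchy_schwarz_equality:
  fixes x y :: "'n::finite \<Rightarrow> complex"
  assumes "(\<Sum>j\<in>UNIV. x j * cnj (y j)) = X * cnj Y"
    and "(\<Sum>j\<in>UNIV. x j * cnj (x j)) = X * cnj X" "(\<Sum>j\<in>UNIV. y j * cnj (y j)) = Y * cnj Y"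
  shows "x j * Y = X * y j"
proof -
  have "(\<Sum>j\<in>UNIV. y j * cnj (x j)) = cnj (\<Sum>j\<in>UNIV. x j * cnj (y j))" by (simp add: mult.commute)
  then have yx: "(\<Sum>j\<in>UNIV. y j * cnj (x j)) = cnj X * Y" by (simp add: assms(1))
  have "(\<Sum>j\<in>UNIV. (x j * Y - X * y j) * cnj (x j * Y - X * y j)) =
      Y * cnj Y * (\<Sum>j\<in>UNIV. x j * cnj (x j)) - Y * cnj X * (\<Sum>j\<in>UNIV. x j * cnj (y j))
      - X * cnj Y * (\<Sum>j\<in>UNIV. y j * cnj (x j)) + X * cnj X * (\<Sum>j\<in>UNIV. y j * cnj (y j))"
    unfolding sum_distrib_left sum_subtractf[symmetric] sum.distrib[symmetric]
    by (intro sum.cong) (auto simp: algebra_simps)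
  also have "\<dots> = 0" unfolding assms yx by (simp add: algebra_simps)
  finally have "x j * Y - X * y j = 0" by (rule sum_mult_cnj_eq_0D)
  then show ?thesis by simp
qed

text \<open>The inner product with the value at \<open>w1\<close> is holomorphic, bounded by \<open>1\<close>, and equal to \<open>1\<close> at \<open>w1\<close>. So it is constant
  by the maximum principle, and the equality case of the Cauchy-Schwarz inequality applies.\<close>

lemma holomorphic_into_sphere_constant:
  fixes h :: "'n::finite \<Rightarrow> complex \<Rightarrow> complex"
  assumes S: "open S" "connected S" "w1 \<in> S" and hol: "\<And>j. h j holomorphic_on S"
    and unit: "\<And>w. w \<in> S \<Longrightarrow> (\<Sum>j\<in>UNIV. h j w * cnj (h j w)) = 1"
    and w: "w \<in> S"
  shows "h j w = h j w1"
proof -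
  define \<phi> where "\<phi> = (\<lambda>w. \<Sum>j\<in>UNIV. h j w * cnj (h j w1))"
  have hol\<phi>: "\<phi> holomorphic_on S" unfolding \<phi>_def by (intro holomorphic_intros hol)
  have L2: "L2_set (\<lambda>j. cmod (h j w)) UNIV = 1" if "w \<in> S" for w
  proof -
    have "of_real (\<Sum>j\<in>UNIV. (cmod (h j w))\<^sup>2) = (1::complex)"
      using unit[OF that] by (simp only: of_real_sum complex_norm_square)
    then have "(\<Sum>j\<in>UNIV. (cmod (h j w))\<^sup>2) = 1" by (simp only: of_real_eq_1_iff)
    then show ?thesis by (simp add: L2_set_def)
  qed
  have le: "cmod (\<phi> w) \<le> 1" if "w \<in> S" for w
  proof -
    have "cmod (\<phi> w) \<le> (\<Sum>j\<in>UNIV. \<bar>cmod (h j w)\<bar> * \<bar>cmod (h j w1)\<bar>)"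
      unfolding \<phi>_def by (rule norm_sum[THEN order_trans]) (simp add: norm_mult)
    also have "\<dots> \<le> 1" using L2_set_mult_ineq[of "\<lambda>j. cmod (h j w)" "\<lambda>j. cmod (h j w1)" UNIV] L2[OF that] L2[OF S(3)] by simp
    finally show ?thesis .
  qed
  have one: "\<phi> w1 = 1" using unit[OF S(3)] by (simp add: \<phi>_def)
  have "\<phi> constant_on S"
    by (rule maximum_modulus_principle[OF hol\<phi> S(1,2,1) subset_refl S(3)]) (use le one in simp)
  then have "\<phi> w = 1" using one w S(3) unfolding constant_on_def by metis
  then have "h j w * 1 = 1 * h j w1"
    by (intro cauchy_schwarz_equality) (use unit w S(3) in \<open>auto simp: \<phi>_def\<close>)
  then show ?thesis by simp
qed

context segre begin

text \<open>The modulus of \<open>w\<close> on the hypersurface above \<open>z\<close>.\<close>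

definition radius :: "complex \<Rightarrow> complex" where
  "radius z = of_real (sqrt (Re (1 - P z (cnj z))))"

lemma radius_square: "0 \<le> Re (1 - P z (cnj z)) \<Longrightarrow> radius z * radius z = 1 - P z (cnj z)"
  using P_diag_real[of z] unfolding radius_def
  by (auto simp: complex_eq_iff complex_is_Real_iff simp flip: of_real_mult)

lemma cnj_radius [simp]: "cnj (radius z) = radius z"
  by (simp add: radius_def)

lemma on_M_radius:
  assumes "0 \<le> Re (1 - P z (cnj z))" "cmod u = 1"
  shows "on_M z (u * radius z)"
proof -
  have "u * cnj u = 1" using assms(2) by (simp add: complex_norm_square[symmetric])
  then have "u * radius z * cnj (u * radius z) = radius z * radius z" by (simp add: algebra_simps)
  then show ?thesis using radius_square[OF assms(1)] by (simp add: on_M_def)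
qed

lemma on_M_imp_radius:
  assumes "on_M z w" shows "radius z = of_real (cmod w)"
proof -
  have "1 - P z (cnj z) = of_real ((cmod w)\<^sup>2)"
    using assms unfolding on_M_def complex_norm_square by simp
  then show ?thesis unfolding radius_def by (simp only: Re_complex_of_real real_sqrt_abs abs_norm_cancel)
qed

lemma continuous_radius: "continuous_on S h \<Longrightarrow> continuous_on S (\<lambda>t. radius (h t))"
  unfolding radius_def by (intro continuous_intros)

text \<open>Along the segment \<open>z = a + t * (b - a)\<close>, the identity at the points \<open>(z, u * radius z)\<close> of the hypersurface is real analytic
  in \<open>t\<close>. Explicitly, with the principal square root for the radius, it is the restriction to real \<open>t\<close> of a function
  that is holomorphic near \<open>[0, 1]\<close>, and the identity theorem applies.\<close>

lemma transport_segment: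
  assumes V: "open V" and G: "\<And>k. hol2 (UNIV \<times> V) (G k)"
    and seg: "\<And>z. z \<in> closed_segment a b \<Longrightarrow> 0 < Re (1 - P z (cnj z)) \<and> u * radius z \<in> V"
    and \<delta>: "\<delta> > 0" and base: "\<And>z. z \<in> ball a \<delta> \<Longrightarrow> pairing sg G z (u * radius z) (cnj z) (cnj (u * radius z)) = 0"
  shows "pairing sg G b (u * radius b) (cnj b) (cnj (u * radius b)) = 0"
proof -
  define v where "v = b - a"
  define z where "z = (\<lambda>t. a + t * v)"
  define \<zeta> where "\<zeta> = (\<lambda>t. cnj a + t * cnj v)"
  define c where "c = (\<lambda>t. csqrt (1 - P (z t) (\<zeta> t)))"
  define U where "U = {t. 0 < Re (1 - P (z t) (\<zeta> t))}"
  have U: "open U" unfolding U_def z_def \<zeta>_def by (intro open_Collect_less continuous_intros)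
  have chol: "c holomorphic_on U"
    unfolding c_def z_def \<zeta>_def
    by (intro holomorphic_intros) (auto simp: U_def z_def \<zeta>_def complex_nonpos_Reals_iff)
  have ccont: "continuous_on U c" by (rule holomorphic_on_imp_continuous_on[OF chol])
  have real: "\<zeta> t = cnj (z t)" "t \<in> U \<Longrightarrow> c t = radius (z t)" if "t \<in> \<real>" for t
  proof -
    show *: "\<zeta> t = cnj (z t)" using that by (simp add: \<zeta>_def z_def Reals_cnj_iff)
    assume "t \<in> U"
    then have pos: "0 < Re (1 - P (z t) (cnj (z t)))" by (simp add: U_def *)
    have "Im (1 - P (z t) (cnj (z t))) = 0" using P_diag_real[of "z t"] by (simp add: complex_is_Real_iff)
    then show "c t = radius (z t)"
      unfolding c_def * radius_def using pos by (intro csqrt_of_real_nonneg) auto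
  qed
  define S where "S = U \<inter> (\<lambda>t. u * c t) -` V \<inter> (U \<inter> (\<lambda>t. cnj (cnj u * c t)) -` V)"
  have S: "open S" unfolding S_def
    by (intro open_Int continuous_open_preimage[OF _ U V] continuous_intros ccont)
  define K where "K = complex_of_real ` {0..1}"
  have K: "compact K" "convex K" "0 \<in> K" "1 \<in> K"
  proof -
    show "compact K" unfolding K_def by (intro compact_continuous_image continuous_intros) auto
    show "convex K" unfolding K_def by (intro convex_linear_image) (auto simp: linear_iff scaleR_conv_of_real)
    show "0 \<in> K" unfolding K_def by (intro image_eqI[of _ _ 0]) auto
    show "1 \<in> K" unfolding K_def by (intro image_eqI[of _ _ 1]) auto
  qed
  have "K \<subseteq> S"
  proof
    fix t assume "t \<in> K"
    then obtain x where x: "t = of_real x" "0 \<le> x" "x \<le> 1" by (auto simp: K_def)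
    then have tR: "t \<in> \<real>" by simp
    have "z t \<in> closed_segment a b"
      unfolding closed_segment_def using x
      by (intro CollectI exI[of _ x]) (auto simp: z_def v_def scaleR_conv_of_real algebra_simps)
    from seg[OF this] have s: "0 < Re (1 - P (z t) (cnj (z t)))" "u * radius (z t) \<in> V" by auto
    then have tU: "t \<in> U" by (simp add: U_def real(1)[OF tR])
    then show "t \<in> S" using s(2) real(2)[OF tR] by (simp add: S_def)
  qed
  then obtain e where e: "e > 0" "(\<Union>x\<in>K. ball x e) \<subseteq> S"
    using compact_subset_open_imp_ball_epsilon_subset[OF K(1) S] by metis
  define T where "T = (\<Union>x\<in>K. \<Union>y\<in>ball 0 e. {x + y})"
  have T: "open T" "connected T" "K \<subseteq> T" "T \<subseteq> S"
  proof -
    show "open T" unfolding T_def by (rule open_sums) auto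
    show "connected T" unfolding T_def by (intro convex_connected convex_sums K) auto
    show "K \<subseteq> T" unfolding T_def using e(1) by force
    show "T \<subseteq> S"
    proof
      fix t assume "t \<in> T"
      then obtain x y where "x \<in> K" "y \<in> ball 0 e" "t = x + y" unfolding T_def by auto
      then have "t \<in> ball x e" by (simp add: dist_norm)
      then show "t \<in> S" using e(2) \<open>x \<in> K\<close> by blast
    qed
  qed
  define H where "H = (\<lambda>t. pairing sg G (z t) (u * c t) (\<zeta> t) (cnj u * c t))"
  have Hreal: "H t = pairing sg G (z t) (u * radius (z t)) (cnj (z t)) (cnj (u * radius (z t)))"
    if "t \<in> \<real>" "t \<in> T" for t
    using real[OF that(1)] that(2) T(4) by (auto simp: H_def S_def)
  have "H 1 = 0"
  proof (rule holomorphic_frequently_zero[OF T(1,2), where h = H and v = 0])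
    have "T \<subseteq> U" using T(4) by (auto simp: S_def)
    then have cT: "c holomorphic_on T" by (rule holomorphic_on_subset[OF chol])
    show "H holomorphic_on T"
      unfolding H_def
    proof (rule holomorphic_pairing[OF G T(1)])
      show "z holomorphic_on T" "\<zeta> holomorphic_on T" unfolding z_def \<zeta>_def by (intro holomorphic_intros)+
      show "(\<lambda>t. u * c t) holomorphic_on T" "(\<lambda>t. cnj u * c t) holomorphic_on T"
        by (intro holomorphic_intros cT)+
    qed (use T(4) in \<open>auto simp: S_def\<close>)
    show 0: "0 \<in> T" "1 \<in> T" using K T(3) by auto
    define r where "r = \<delta> / (cmod v + 1)"
    have "cmod v + 1 > 0" by (simp add: add_nonneg_pos)
    then have r: "r > 0" "r * (cmod v + 1) = \<delta>" using \<delta> by (auto simp: r_def)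
    have "\<forall>\<^sub>F t in at 0. t \<in> ball 0 r \<inter> T" using r 0 T(1) by (intro eventually_at_in_open') auto
    moreover have "\<exists>\<^sub>F t in at (0::complex). t \<in> \<real>" using frequently_real[of 0] by simp
    ultimately have "\<exists>\<^sub>F t in at 0. t \<in> ball 0 r \<inter> T \<and> t \<in> \<real>"
      by (rule frequently_eventually_conj[rotated])
    then show "\<exists>\<^sub>F t in at 0. H t = 0"
    proof (rule frequently_elim1, elim conjE)
      fix t :: complex assume t: "t \<in> ball 0 r \<inter> T" "t \<in> \<real>"
      have "cmod (t * v) \<le> cmod t * (cmod v + 1)" by (simp add: norm_mult mult_left_mono)
      also have "\<dots> < r * (cmod v + 1)" using t(1) \<open>cmod v + 1 > 0\<close> by (intro mult_strict_right_mono) auto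
      finally have "z t \<in> ball a \<delta>" using r(2) by (simp add: z_def dist_norm)
      then show "H t = 0" using base Hreal t by simp
    qed
  qed
  moreover have "z 1 = b" by (simp add: z_def v_def)
  ultimately show ?thesis using Hreal[of 1] T(3) K(4) by auto
qed

text \<open>The same with a neighbourhood of the end point: parallel segments start in the given ball around \<open>a\<close>.\<close>

lemma transport_region:
  assumes V: "open V" and G: "\<And>k. hol2 (UNIV \<times> V) (G k)"
    and D: "open D" "\<And>z. z \<in> D \<Longrightarrow> 0 < Re (1 - P z (cnj z)) \<and> u * radius z \<in> V"
    and seg: "closed_segment a b \<subseteq> D"
    and base: "\<exists>\<delta>>0. \<forall>z\<in>ball a \<delta>. pairing sg G z (u * radius z) (cnj z) (cnj (u * radius z)) = 0"
  shows "\<exists>\<delta>>0. \<forall>z\<in>ball b \<delta>. pairing sg G z (u * radius z) (cnj z) (cnj (u * radius z)) = 0"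
proof -
  obtain \<delta> where \<delta>: "\<delta> > 0" "\<And>z. z \<in> ball a \<delta> \<Longrightarrow> pairing sg G z (u * radius z) (cnj z) (cnj (u * radius z)) = 0"
    using base by blast
  obtain e where e: "e > 0" "(\<Union>x\<in>closed_segment a b. ball x e) \<subseteq> D"
    using compact_subset_open_imp_ball_epsilon_subset[OF compact_segment(1) D(1) seg] by metis
  show ?thesis
  proof (intro exI[of _ "min (\<delta>/2) e"] conjI ballI)
    show "min (\<delta>/2) e > 0" using \<delta> e by simp
    fix y assume y: "y \<in> ball b (min (\<delta>/2) e)"
    define s where "s = y - b"
    have s: "cmod s < \<delta>/2" "cmod s < e" using y by (auto simp: s_def dist_norm norm_minus_commute)
    have "closed_segment (s + a) y = (+) s ` closed_segment a b"
      using closed_segment_translation[of s a b] by (simp add: s_def)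
    moreover have "s + x \<in> D" if "x \<in> closed_segment a b" for x
    proof -
      have "s + x \<in> ball x e" using s(2) by (simp add: dist_norm)
      then show ?thesis using e(2) that by blast
    qed
    ultimately have sD: "closed_segment (s + a) y \<subseteq> D" by auto
    show "pairing sg G y (u * radius y) (cnj y) (cnj (u * radius y)) = 0"
    proof (rule transport_segment[OF V G, where a = "s + a" and \<delta> = "\<delta>/2"])
      show "0 < Re (1 - P z (cnj z)) \<and> u * radius z \<in> V" if "z \<in> closed_segment (s + a) y" for z
        using D(2) sD that by blast
      fix z assume "z \<in> ball (s + a) (\<delta>/2)"
      then have "z \<in> ball a \<delta>"
        using dist_triangle[of a z "s + a"] s(1) by (simp add: dist_norm)
      then show "pairing sg G z (u * radius z) (cnj z) (cnj (u * radius z)) = 0" by (rule \<delta>(2))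
    qed (use \<delta>(1) in auto)
  qed
qed

end

section \<open>Sphere maps near a generic point\<close>

lemma compact_tube2:
  fixes g :: "complex \<Rightarrow> complex \<Rightarrow> complex"
  assumes "compact K" "continuous_on UNIV (case_prod g)" "open B" "\<And>y. y \<in> K \<Longrightarrow> g x0 y \<in> B"
  shows "\<exists>e>0. \<forall>y0\<in>K. \<forall>x y. dist x x0 < e \<longrightarrow> dist y y0 < e \<longrightarrow> g x y \<in> B"
proof -
  have "continuous_on UNIV (\<lambda>t :: complex \<times> complex \<times> complex. case_prod g (fst t, fst (snd t)))"
    by (rule continuous_on_compose2[OF assms(2)]) (auto intro!: continuous_intros)
  then have "\<exists>e>0. \<forall>y0\<in>K. \<forall>x y z. dist x x0 < e \<longrightarrow> dist y y0 < e \<longrightarrow> dist z (0::complex) < e \<longrightarrow>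
     (x, y, z) \<in> UNIV \<and> (\<lambda>t. case_prod g (fst t, fst (snd t))) (x, y, z) \<in> B"
    by (intro compact_tube3) (use assms(1,3,4) in auto)
  then obtain e where e: "e > 0" "\<forall>y0\<in>K. \<forall>x y z. dist x x0 < e \<longrightarrow> dist y y0 < e \<longrightarrow> dist z (0::complex) < e \<longrightarrow>
     (x, y, z) \<in> UNIV \<and> (\<lambda>t. case_prod g (fst t, fst (snd t))) (x, y, z) \<in> B"
    by (elim exE conjE) (rule that)
  have "g x y \<in> B" if "y0 \<in> K" "dist x x0 < e" "dist y y0 < e" for x y y0
    using e(1) e(2)[rule_format, OF that, of 0] by simp
  then show ?thesis using e(1) by blast
qed

context segre begin

text \<open>What is asked of \<open>P\<close>: uncountable level sets for the uniform degree, \<open>chord\<close> for the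
  continuation to horizontal lines, \<open>seg\<close> for the continuation along the ray, the star-shaped region \<open>D\<close> for transport, with
  a bounding set \<open>C\<close> that keeps the radii within reach of the ray, and infinitely many zeros of \<open>P z (cnj z)\<close> for the comparison
  with the origin.\<close>

lemma sphere_map_locally_constant:
  fixes f :: "'n::finite \<Rightarrow> complex \<Rightarrow> complex \<Rightarrow> complex"
  assumes AB: "open A" "open B" and f: "\<And>j. hol2 (A \<times> B) (f j)"
    and p: "z0 \<in> A" "w0 \<in> B" "z0 \<noteq> 0" "w0 \<noteq> 0" "on_M z0 w0"
    and sph: "\<And>z w. z \<in> A \<Longrightarrow> w \<in> B \<Longrightarrow> on_M z w \<Longrightarrow> (\<Sum>j\<in>UNIV. f j z w * cnj (f j z w)) = 1"
    and level: "\<And>r. r > 0 \<Longrightarrow> \<exists>e>0. \<forall>t. dist t (P z0 (cnj z0)) < e \<longrightarrow> t \<in> \<real> \<longrightarrow>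
        uncountable {z \<in> cball z0 r. P z (cnj z) = t}"
    and P0: "\<And>z. P z 0 = 0"
    and chord: "\<And>\<zeta>. \<zeta> \<in> closed_segment 0 (cnj z0) \<Longrightarrow> P z0 \<zeta> \<noteq> 1"
    and seg: "s1 \<le> 0" "0 \<le> s2" "\<And>x. s1 \<le> x \<Longrightarrow> x \<le> s2 \<Longrightarrow> P (of_real x) 1 \<noteq> 1"
      "\<And>x. s1 \<le> x \<Longrightarrow> x \<le> s2 \<Longrightarrow> 0 < Re (deriv (\<lambda>s. P s 1) (of_real x))"
    and D: "open D" "z0 \<in> D" "compact C" "D \<subseteq> C" "\<And>z. z \<in> D \<Longrightarrow> closed_segment 0 z \<subseteq> D"
      "\<And>z. z \<in> C \<Longrightarrow> 0 < Re (1 - P z (cnj z))"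
      "\<And>z. z \<in> C \<Longrightarrow> \<exists>x. s1 \<le> x \<and> x \<le> s2 \<and> cmod w0 * Re (1 - P (of_real x) 1) = sqrt (Re (1 - P z (cnj z)))"
    and Z: "infinite {z \<in> D. P z (cnj z) = 0}"
  obtains w1 \<epsilon> where "\<epsilon> > 0" "ball z0 \<epsilon> \<subseteq> A" "ball w1 \<epsilon> \<subseteq> B"
    "\<And>j z w. z \<in> ball z0 \<epsilon> \<Longrightarrow> w \<in> ball w1 \<epsilon> \<Longrightarrow> f j z w = f j z0 w1"
proof -
  have P0': "P 0 \<zeta> = 0" for \<zeta> using P0[of \<zeta>] P_sym[of 0 \<zeta>] by simp
  obtain d V g k1 v1 \<mu> where V: "open V" "connected V"
     "\<And>x. s1 \<le> x \<Longrightarrow> x \<le> s2 \<Longrightarrow> w0 * (1 - P (of_real x) 1) \<in> V"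
     and g: "\<And>k i. i \<le> d \<Longrightarrow> g (k :: 'n option) i holomorphic_on V" "v1 \<in> V" "g k1 0 v1 \<noteq> 0"
     and \<mu>: "\<mu> > 0" "ball w0 \<mu> \<subseteq> V \<inter> B" "ball z0 \<mu> \<subseteq> A"
     and gf: "\<And>k z w. z \<in> ball z0 \<mu> \<Longrightarrow> w \<in> ball w0 \<mu> \<Longrightarrow> zpoly d g None z w * homog f k z w = zpoly d g k z w"
  proof (rule ray_continuation[of A B f z0 w0 s1 s2])
  qed (rule AB f p P0 seg(1,2) | rule sph level chord seg(3,4) that; assumption)+
  define G where "G = zpoly d g"
  have G: "hol2 (UNIV \<times> V) (G k)" for k
    using hol2_poly[OF V(1), of d "g k"] g(1) by (simp add: G_def zpoly_def[abs_def])
  define gN gj where "gN = g None 0" and "gj = (\<lambda>j. g (Some j) 0)"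
  have G0: "G None 0 w = gN w" "G (Some j) 0 w = gj j w" for w j
    by (simp_all add: G_def zpoly_def gN_def gj_def power_0_left if_distrib cong: if_cong)
  have gh: "gN holomorphic_on V" "gj j holomorphic_on V" for j
    unfolding gN_def gj_def by (intro g(1); simp)+
  have Ghol: "(\<lambda>z. G k z w) holomorphic_on S" for k w S
    unfolding G_def zpoly_def by (intro holomorphic_intros)
  define sg :: "'n option \<Rightarrow> complex" where "sg = case_option (-1) (\<lambda>_. 1)"
  have pair: "pairing sg G z w \<zeta> \<eta> = (\<Sum>j\<in>UNIV. G (Some j) z w * cnj (G (Some j) (cnj \<zeta>) (cnj \<eta>))) -
      G None z w * cnj (G None (cnj \<zeta>) (cnj \<eta>))" for z w \<zeta> \<eta>
    by (simp add: pairing_def UNIV_option_conv sum.reindex sg_def)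
  \<comment> \<open>\<open>\<Sum>|G\<^sub>j|\<^sup>2 - |G\<^sub>0|\<^sup>2\<close>, which vanishes on the hypersurface near \<open>(z0, w0)\<close>\<close>
  define E where "E = (\<lambda>z w. pairing sg G z w (cnj z) (cnj w))"
  have base: "E z w = 0" if "z \<in> ball z0 \<mu>" "w \<in> ball w0 \<mu>" "on_M z w" for z w
  proof -
    have "G (Some j) z w = G None z w * f j z w" for j
      using gf[OF that(1,2), of "Some j"] by (simp add: G_def homog_def)
    then have "E z w = G None z w * cnj (G None z w) * ((\<Sum>j\<in>UNIV. f j z w * cnj (f j z w)) - 1)"
      unfolding E_def pair by (simp add: sum_distrib_left algebra_simps)
    moreover have "z \<in> A" "w \<in> B" using that \<mu> by auto
    ultimately show ?thesis using sph[OF _ _ that(3)] by simp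
  qed
  \<comment> \<open>Rays with directions \<open>u\<close> near that of \<open>w0\<close> are used, because polarization needs an open piece of the
    hypersurface.\<close>
  define u0 where "u0 = w0 / of_real (cmod w0)"
  have u0: "cmod u0 = 1" using p(4) by (simp add: u0_def norm_divide)
  have rad0: "radius z0 = of_real (cmod w0)" by (rule on_M_imp_radius[OF p(5)])
  have w0u: "u0 * radius z0 = w0" using p(4) by (simp add: u0_def rad0)
  have u0V: "u0 * radius z \<in> V" if zC: "z \<in> C" for z
  proof -
    obtain x where x: "s1 \<le> x" "x \<le> s2" "cmod w0 * Re (1 - P (of_real x) 1) = sqrt (Re (1 - P z (cnj z)))"
      using D(7)[OF zC] by blast
    have "cnj (P (of_real x) 1) = P (of_real x) 1" by (simp add: P_cnj)
    then have "1 - P (of_real x) 1 = of_real (Re (1 - P (of_real x) 1))"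
      by (simp add: complex_eq_iff)
    then have "w0 * (1 - P (of_real x) 1) = u0 * of_real (cmod w0 * Re (1 - P (of_real x) 1))"
      using p(4) by (metis (no_types, lifting) mult.assoc of_real_mult rad0 w0u)
    also have "\<dots> = u0 * radius z" unfolding x(3) radius_def by (rule refl)
    finally show ?thesis using V(3)[OF x(1,2)] by simp
  qed
  have "continuous_on UNIV (\<lambda>(u, z). u * radius z)"
    unfolding split_beta by (intro continuous_intros continuous_radius)
  note tube = compact_tube2[OF _ this]
  obtain \<kappa>1 where k1: "\<kappa>1 > 0" "\<forall>y0\<in>C. \<forall>x y. dist x u0 < \<kappa>1 \<longrightarrow> dist y y0 < \<kappa>1 \<longrightarrow> x * radius y \<in> V"
    using tube[OF D(3) V(1) u0V] by blast
  have \<kappa>1: "u * radius z \<in> V" if "z \<in> C" "dist u u0 < \<kappa>1" for u z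
    using k1 that by simp
  obtain \<kappa>2 where k2: "\<kappa>2 > 0" "\<forall>y0\<in>{z0}. \<forall>x y. dist x u0 < \<kappa>2 \<longrightarrow> dist y y0 < \<kappa>2 \<longrightarrow> x * radius y \<in> ball w0 \<mu>"
    using tube[of "{z0}" "ball w0 \<mu>" u0] w0u \<mu>(1) by auto
  have \<kappa>2: "u * radius z \<in> ball w0 \<mu>" if "dist z z0 < \<kappa>2" "dist u u0 < \<kappa>2" for u z
    using k2(2) that by simp
  define \<kappa> where "\<kappa> = min \<kappa>1 \<kappa>2"
  have \<kappa>: "\<kappa> > 0" "\<kappa> \<le> \<kappa>1" "\<kappa> \<le> \<kappa>2" using k1(1) k2(1) by (auto simp: \<kappa>_def)
  have D0: "0 \<in> D" using D(5)[OF D(2)] by auto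
  \<comment> \<open>transport from \<open>z0\<close> to \<open>0\<close>, and from \<open>0\<close> to any point of \<open>D\<close>\<close>
  have R: "E z (u * radius z) = 0" if zD: "z \<in> D" and u: "cmod u = 1" "dist u u0 < \<kappa>" for z u
  proof -
    have pos: "0 < Re (1 - P y (cnj y)) \<and> u * radius y \<in> V" if "y \<in> D" for y
      using that D(4,6) \<kappa>1[of y u] u(2) \<kappa>(2) by auto
    obtain \<delta>0 where \<delta>0: "\<delta>0 > 0" "ball z0 \<delta>0 \<subseteq> D" using D(1,2) open_contains_ball by blast
    have "\<exists>\<delta>>0. \<forall>y\<in>ball z0 \<delta>. pairing sg G y (u * radius y) (cnj y) (cnj (u * radius y)) = 0"
    proof (intro exI[of _ "min (min \<delta>0 \<kappa>2) \<mu>"] conjI ballI)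
      show "0 < min (min \<delta>0 \<kappa>2) \<mu>" using \<delta>0 k2(1) \<mu>(1) by simp
      fix y assume y: "y \<in> ball z0 (min (min \<delta>0 \<kappa>2) \<mu>)"
      then have "y \<in> D" using \<delta>0(2) by auto
      have "on_M y (u * radius y)" using pos[OF \<open>y \<in> D\<close>] u(1) by (intro on_M_radius) auto
      moreover have "u * radius y \<in> ball w0 \<mu>"
        using y u(2) \<kappa>(3) by (intro \<kappa>2) (auto simp: dist_commute)
      ultimately have "E y (u * radius y) = 0" using y by (intro base) auto
      then show "pairing sg G y (u * radius y) (cnj y) (cnj (u * radius y)) = 0" by (simp add: E_def)
    qed
    from transport_region[OF V(1) G D(1) pos _ this, of 0]
    have "\<exists>\<delta>>0. \<forall>y\<in>ball 0 \<delta>. pairing sg G y (u * radius y) (cnj y) (cnj (u * radius y)) = 0"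
      using D(5)[OF D(2)] by (simp add: closed_segment_commute)
    from transport_region[OF V(1) G D(1) pos D(5)[OF zD] this]
    show ?thesis unfolding E_def by (metis centre_in_ball)
  qed
  \<comment> \<open>Polarization at \<open>(0, u0)\<close>, where the hypersurface has radius \<open>1\<close>. At \<open>\<zeta> = 0\<close> it will give a relation that is
    linear in \<open>G(z, w)\<close>, and hence valid for all \<open>z\<close>.\<close>
  have rad00: "radius 0 = 1" by (simp add: radius_def P0)
  have u0inV: "u0 \<in> V" using u0V[of 0] D0 D(4) by (simp add: rad00 subset_iff)
  have "isCont (\<lambda>w. w / of_real (cmod w)) u0" using u0 by (intro continuous_intros) auto
  then obtain \<kappa>3 where \<kappa>3: "\<kappa>3 > 0" "\<And>w. dist w u0 < \<kappa>3 \<Longrightarrow> dist (w / of_real (cmod w)) u0 < \<kappa>"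
    using u0 \<kappa>(1) unfolding continuous_at_eps_delta by (metis div_by_1 of_real_1)
  define B' where "B' = V \<inter> ball u0 (min \<kappa>3 1)"
  have G': "hol2 (D \<times> B') (G k)" for k
    by (rule hol2_subset[OF G]) (auto simp: B'_def intro!: open_Times D(1) V(1) open_Int)
  have zero': "pairing sg G z w (cnj z) (cnj w) = 0" if "z \<in> D" "w \<in> B'" "on_M z w" for z w
  proof -
    have "w \<noteq> 0" using that(2) u0 by (auto simp: B'_def dist_norm)
    then have w: "w = w / of_real (cmod w) * radius z" "cmod (w / of_real (cmod w)) = 1"
      by (simp_all add: on_M_imp_radius[OF that(3)] norm_divide)
    have "dist (w / of_real (cmod w)) u0 < \<kappa>" using that(2) by (intro \<kappa>3(2)) (auto simp: B'_def dist_commute)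
    from R[OF that(1) w(2) this] show ?thesis by (simp only: E_def w(1)[symmetric])
  qed
  have "open B'" "u0 \<in> B'" "u0 \<noteq> 0" "on_M 0 u0"
    using V(1) u0inV u0 \<kappa>3(1) on_M_radius[of 0 u0] by (auto simp: B'_def rad00 P0)
  from polarization[of D B' G 0 u0 sg, OF D(1) this(1) G' D0 this(2-4) zero']
  obtain \<delta> where \<delta>: "\<delta> > 0" "\<And>z \<zeta> w. dist z 0 < \<delta> \<Longrightarrow> dist \<zeta> (cnj 0) < \<delta> \<Longrightarrow> dist w u0 < \<delta> \<Longrightarrow>
       pairing sg G z w \<zeta> ((1 - P z \<zeta>) / w) = 0" by blast
  define \<tau> where "\<tau> = min \<delta> \<kappa>"
  \<comment> \<open>above a zero of \<open>P z (cnj z)\<close> the vectors \<open>G(z, w)\<close> and \<open>G(0, w)\<close> are null and mutually orthogonal\<close>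
  have cross: "G (Some j) z w * gN w = G None z w * gj j w"
    if w: "cmod w = 1" "dist w u0 < \<tau>" and z: "z \<in> {z \<in> D. P z (cnj z) = 0}" for j z w
  proof (rule cauchy_schwarz_equality)
    have ww: "w * cnj w = 1" using w(1) by (simp add: complex_norm_square[symmetric])
    have "w \<noteq> 0" using w(1) by auto
    then have winv: "1 / w = cnj w" using ww by (simp add: divide_eq_eq mult.commute)
    have "(\<Sum>j\<in>UNIV. G (Some j) z w * cnj (gj j w)) - G None z w * cnj (gN w) = 0"
    proof (rule holomorphic_frequently_zero[where V = UNIV and v = 0 and x = z and
          h = "\<lambda>z. (\<Sum>j\<in>UNIV. G (Some j) z w * cnj (gj j w)) - G None z w * cnj (gN w)"])
      show "(\<lambda>z. (\<Sum>j\<in>UNIV. G (Some j) z w * cnj (gj j w)) - G None z w * cnj (gN w)) holomorphic_on UNIV"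
        by (intro holomorphic_intros Ghol)
      have "\<forall>\<^sub>F y in at 0. y \<in> ball 0 \<delta>" using \<delta>(1) by (intro eventually_at_in_open') auto
      then have "\<forall>\<^sub>F y in at 0. (\<Sum>j\<in>UNIV. G (Some j) y w * cnj (gj j w)) - G None y w * cnj (gN w) = 0"
      proof eventually_elim
        case (elim y)
        have "pairing sg G y w 0 ((1 - P y 0) / w) = 0"
          using elim \<delta>(1) w(2) by (intro \<delta>(2)) (auto simp: \<tau>_def)
        then show ?case by (simp add: P0 winv pair G0)
      qed
      then show "\<exists>\<^sub>F y in at 0. (\<Sum>j\<in>UNIV. G (Some j) y w * cnj (gj j w)) - G None y w * cnj (gN w) = 0"
        by (rule eventually_frequently[OF at_neq_bot])
    qed auto
    then show "(\<Sum>j\<in>UNIV. G (Some j) z w * cnj (gj j w)) = G None z w * cnj (gN w)" by simp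
    have "radius z = 1" using z by (simp add: radius_def)
    then have "E z w = 0" using R[of z w] z w by (simp add: \<tau>_def)
    then show "(\<Sum>j\<in>UNIV. G (Some j) z w * cnj (G (Some j) z w)) = G None z w * cnj (G None z w)"
      by (simp add: E_def pair)
    have "E 0 w = 0" using R[OF D0 w(1)] w(2) rad00 by (simp add: \<tau>_def)
    then show "(\<Sum>j\<in>UNIV. gj j w * cnj (gj j w)) = gN w * cnj (gN w)"
      by (simp add: E_def pair G0)
  qed
  have \<tau>: "\<tau> > 0" using \<delta>(1) \<kappa>(1) by (simp add: \<tau>_def)
  have "u0 \<noteq> 0" using u0 by auto
  moreover have "\<forall>\<^sub>F w in at u0. w \<in> ball u0 \<tau>" using \<tau> by (intro eventually_at_in_open') auto
  ultimately have "\<exists>\<^sub>F w in at u0. w \<in> ball u0 \<tau> \<and> w * cnj w = u0 * cnj u0"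
    by (intro frequently_eventually_conj frequently_circle)
  then have freq: "\<exists>\<^sub>F w in at u0. cmod w = 1 \<and> dist w u0 < \<tau>"
  proof (rule frequently_elim1, elim conjE)
    fix w assume "w \<in> ball u0 \<tau>" "w * cnj w = u0 * cnj u0"
    then have "of_real ((cmod w)\<^sup>2) = (of_real ((cmod u0)\<^sup>2) :: complex)" by (simp only: complex_norm_square)
    then have "(cmod w)\<^sup>2 = (cmod u0)\<^sup>2" by (simp only: of_real_eq_iff)
    then have "cmod w = cmod u0" by (rule power2_eq_imp_eq) auto
    then show "cmod w = 1 \<and> dist w u0 < \<tau>" using u0 \<open>w \<in> ball u0 \<tau>\<close> by (simp add: dist_commute)
  qed
  \<comment> \<open>the coefficients in \<open>z\<close> of the cross product, holomorphic in \<open>w\<close>: they vanish on an arc of the circle, and hence on \<open>V\<close>\<close>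
  define h where "h = (\<lambda>j i w. g (Some j) i w * gN w - g None i w * gj j w)"
  have zpolyh: "zpoly d h j z w = G (Some j) z w * gN w - G None z w * gj j w" for j z w
    by (simp add: zpoly_def G_def h_def sum_distrib_left sum_distrib_right sum_subtractf algebra_simps)
  have h0: "h j i w = 0" if "i \<le> d" "w \<in> V" for j i w
  proof (rule holomorphic_frequently_zero[OF V(1,2) u0inV _ _ that(2), where h = "h j i"])
    show "h j i holomorphic_on V" unfolding h_def using that by (intro holomorphic_intros gh g(1))
    from freq show "\<exists>\<^sub>F w in at u0. h j i w = 0"
    proof (rule frequently_elim1, elim conjE)
      fix w assume w: "cmod w = 1" "dist w u0 < \<tau>"
      show "h j i w = 0"
        by (rule zpoly_zero_coeff[OF Z _ that(1)]) (use cross[OF w] in \<open>simp add: zpolyh\<close>)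
    qed
  qed
  have GV: "G (Some j) z w * gN w = G None z w * gj j w" if "w \<in> V" for j z w
  proof -
    have "zpoly d h j z w = 0" unfolding zpoly_def using h0[OF _ that] by simp
    then show ?thesis by (simp add: zpolyh)
  qed
  \<comment> \<open>\<open>G(0, w)\<close> is not identically zero, and on the circle its denominator controls the other components\<close>
  have "\<exists>v\<in>V. gN v \<noteq> 0"
  proof (rule ccontr)
    assume none: "\<not> ?thesis"
    have "gj j v = 0" if "v \<in> V" for j v
    proof (rule holomorphic_frequently_zero[OF V(1,2) u0inV gh(2) _ that])
      have "\<forall>\<^sub>F w in at u0. w \<in> V" using V(1) u0inV by (rule eventually_at_in_open')
      with freq have "\<exists>\<^sub>F w in at u0. w \<in> V \<and> (cmod w = 1 \<and> dist w u0 < \<tau>)" by (rule frequently_eventually_conj)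
      then show "\<exists>\<^sub>F w in at u0. gj j w = 0"
      proof (rule frequently_elim1, elim conjE)
        fix w assume w: "w \<in> V" "cmod w = 1" "dist w u0 < \<tau>"
        have "E 0 w = 0" using R[OF D0 w(2)] w(3) rad00 by (simp add: \<tau>_def)
        then have "(\<Sum>j\<in>UNIV. gj j w * cnj (gj j w)) = 0" using none w(1) by (simp add: E_def pair G0)
        then show "gj j w = 0" by (rule sum_mult_cnj_eq_0D)
      qed
    qed
    then have "g k 0 v1 = 0" for k using none g(2) by (cases k) (auto simp: gN_def gj_def)
    then show False using g(3) by simp
  qed
  then obtain v2 where v2: "v2 \<in> V" "gN v2 \<noteq> 0" by blast
  have w0V: "w0 \<in> V" using \<mu> by auto
  obtain e where e: "e > 0" "\<And>t. dist t (P z0 (cnj z0)) < e \<Longrightarrow> t \<in> \<real> \<Longrightarrow> uncountable {z \<in> cball z0 (\<mu>/2). P z (cnj z) = t}"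
    using level[of "\<mu>/2"] \<mu>(1) by auto
  have "isCont (\<lambda>w. 1 - w * cnj w) w0" by (intro continuous_intros)
  moreover have "1 - w0 * cnj w0 = P z0 (cnj z0)" using p(5) by (simp add: on_M_def)
  ultimately obtain \<delta>4 where \<delta>4: "\<delta>4 > 0" "\<And>w. dist w w0 < \<delta>4 \<Longrightarrow> dist (1 - w * cnj w) (P z0 (cnj z0)) < e"
    using e(1) unfolding continuous_at_eps_delta by metis
  \<comment> \<open>For \<open>w\<close> within \<open>r\<close> of \<open>w0\<close> there is a point of the hypersurface at height \<open>w\<close> with \<open>z\<close> close to \<open>z0\<close>.\<close>
  define r where "r = min \<mu> \<delta>4"
  have r: "r > 0" "r \<le> \<mu>" "r \<le> \<delta>4" using \<mu>(1) \<delta>4(1) by (auto simp: r_def)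
  have "\<forall>\<^sub>F w in at w0. gN w \<noteq> 0" by (rule holomorphic_eventually_nonzero[OF V(1,2) w0V gh(1) v2])
  moreover have "\<forall>\<^sub>F w in at w0. w \<in> ball w0 r" using r by (intro eventually_at_in_open') auto
  ultimately have "\<forall>\<^sub>F w in at w0. gN w \<noteq> 0 \<and> w \<in> ball w0 r" by (rule eventually_conj)
  then obtain w1 where w1: "gN w1 \<noteq> 0" "w1 \<in> ball w0 r" using eventually_happens'[OF at_neq_bot] by blast
  have "continuous_on (ball w0 r) gN"
    by (rule holomorphic_on_imp_continuous_on[OF holomorphic_on_subset[OF gh(1)]]) (use \<mu>(2) r(2) in auto)
  from continuous_on_open_avoid[OF this open_ball w1(2,1)]
  obtain e1 where e1: "e1 > 0" "\<And>y. dist w1 y < e1 \<Longrightarrow> gN y \<noteq> 0" by blast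
  obtain e2 where e2: "e2 > 0" "ball w1 e2 \<subseteq> ball w0 r" using w1(2) open_contains_ball[of "ball w0 r"] open_ball by blast
  define \<epsilon> where "\<epsilon> = min (min e1 e2) \<mu>"
  have \<epsilon>: "\<epsilon> > 0" "\<epsilon> \<le> e1" "\<epsilon> \<le> e2" "\<epsilon> \<le> \<mu>" using e1 e2 \<mu>(1) by (auto simp: \<epsilon>_def)
  have near: "w \<in> ball w0 \<mu>" "w \<in> V" "gN w \<noteq> 0" "dist w w0 < \<delta>4" if "w \<in> ball w1 \<epsilon>" for w
  proof -
    have "w \<in> ball w1 e2" using that \<epsilon>(3) by simp
    then have "w \<in> ball w0 r" using e2(2) by blast
    then show "w \<in> ball w0 \<mu>" "dist w w0 < \<delta>4" using r by (auto simp: dist_commute)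
    then show "w \<in> V" using \<mu>(2) by blast
    show "gN w \<noteq> 0" using e1(2)[of w] that \<epsilon>(2) by simp
  qed
  \<comment> \<open>\<open>f\<close> depends on \<open>w\<close> only\<close>
  have fh: "f j z w = gj j w / gN w" if z: "z \<in> ball z0 \<mu>" and w: "w \<in> ball w1 \<epsilon>" for j z w
  proof -
    have wB: "w \<in> B" using near(1)[OF w] \<mu>(2) by blast
    have z0b: "z0 \<in> ball z0 \<mu>" using \<mu>(1) by simp
    have "gN w * f j z w - gj j w = 0"
    proof (rule holomorphic_frequently_zero[OF open_ball _ z0b _ _ z, where h = "\<lambda>z. gN w * f j z w - gj j w"])
      have "(\<lambda>z. f j z w) holomorphic_on ball z0 \<mu>"
        by (rule hol2_compose[OF f]) (use \<mu>(3) wB in \<open>auto intro!: holomorphic_intros\<close>)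
      then show "(\<lambda>z. gN w * f j z w - gj j w) holomorphic_on ball z0 \<mu>" by (intro holomorphic_intros)
      have "\<forall>\<^sub>F z in at z0. G None z w \<noteq> 0"
        by (rule holomorphic_eventually_nonzero[of UNIV z0 _ 0]) (use Ghol G0 near(3)[OF w] in auto)
      moreover have "\<forall>\<^sub>F z in at z0. z \<in> ball z0 \<mu>" using z0b by (intro eventually_at_in_open') auto
      ultimately have "\<forall>\<^sub>F z in at z0. gN w * f j z w - gj j w = 0"
      proof eventually_elim
        case (elim z)
        have "G None z w * f j z w = G (Some j) z w"
          using gf[OF elim(2) near(1)[OF w], of "Some j"] by (simp add: G_def homog_def)
        then have "G None z w * (gN w * f j z w - gj j w) = G (Some j) z w * gN w - G None z w * gj j w"
          by (simp add: algebra_simps)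
        then show ?case using elim(1) GV[OF near(2)[OF w], of j z] by simp
      qed
      then show "\<exists>\<^sub>F z in at z0. gN w * f j z w - gj j w = 0" by (rule eventually_frequently[OF at_neq_bot])
    qed simp
    then show ?thesis using near(3)[OF w] by (simp add: field_simps)
  qed
  have const: "gj j w / gN w = gj j w1 / gN w1" if w: "w \<in> ball w1 \<epsilon>" for j w
  proof (rule holomorphic_into_sphere_constant[OF open_ball _ _ _ _ w])
    show "(\<lambda>w. gj j w / gN w) holomorphic_on ball w1 \<epsilon>" for j
      by (intro holomorphic_intros holomorphic_on_subset[OF gh(1)] holomorphic_on_subset[OF gh(2)])
        (use near in blast)+
    fix w assume w: "w \<in> ball w1 \<epsilon>"
    have "1 - w * cnj w \<in> \<real>" by (simp add: complex_mult_cnj)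
    then have "uncountable {z \<in> cball z0 (\<mu>/2). P z (cnj z) = 1 - w * cnj w}"
      using \<delta>4(2)[OF near(4)[OF w]] by (intro e(2))
    then have "{z \<in> cball z0 (\<mu>/2). P z (cnj z) = 1 - w * cnj w} \<noteq> {}" using countable_empty by metis
    then obtain z where z: "z \<in> cball z0 (\<mu>/2)" "P z (cnj z) = 1 - w * cnj w" by blast
    have zb: "z \<in> ball z0 \<mu>" using z(1) \<mu>(1) by auto
    have "on_M z w" using z(2) by (simp add: on_M_def)
    then have "(\<Sum>j\<in>UNIV. f j z w * cnj (f j z w)) = 1" using zb near(1)[OF w] \<mu> by (intro sph) auto
    then show "(\<Sum>j\<in>UNIV. gj j w / gN w * cnj (gj j w / gN w)) = 1" by (simp only: fh[OF zb w])
  qed (use \<epsilon>(1) in auto)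
  show ?thesis
  proof (rule that[of \<epsilon> w1])
    show "ball z0 \<epsilon> \<subseteq> A" using \<mu>(3) \<epsilon>(4) by auto
    show "ball w1 \<epsilon> \<subseteq> B" using near(1) \<mu>(2) by blast
    fix j z w assume zw: "z \<in> ball z0 \<epsilon>" "w \<in> ball w1 \<epsilon>"
    have "f j z w = gj j w / gN w" using zw \<epsilon>(4) by (intro fh) auto
    also have "\<dots> = gj j w1 / gN w1" by (rule const[OF zw(2)])
    also have "\<dots> = f j z0 w1" using \<mu>(1) \<epsilon>(1) by (intro fh[symmetric]) auto
    finally show "f j z w = f j z0 w1" .
  qed (rule \<epsilon>(1))
qed

end

section \<open>Holomorphic maps on domains\<close>

definition pt :: "complex \<Rightarrow> complex \<Rightarrow> complex ^ 2" where
  "pt z w = (\<chi> i. if i = 1 then z else w)"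

lemma pt_nth [simp]: "pt z w $ 1 = z" "pt z w $ 2 = w"
  by (simp_all add: pt_def)

lemma pt_eta: "pt (Z $ 1) (Z $ 2) = Z"
  by (simp add: pt_def vec_eq_iff forall_2)

lemma bounded_linear_pt: "bounded_linear (\<lambda>q. pt (fst q) (snd q))"
  by (rule linear_conv_bounded_linear[THEN iffD1])
    (auto simp: linear_iff pt_def vec_eq_iff)

lemma continuous_pt [continuous_intros]:
  assumes "continuous_on S f" "continuous_on S g"
  shows "continuous_on S (\<lambda>t. pt (f t) (g t))"
  using bounded_linear.continuous_on[OF bounded_linear_pt continuous_on_Pair[OF assms]] by simp

text \<open>A complex linear derivative is determined by its values on the two coordinate vectors.\<close>

lemma hol2_component:
  fixes F :: "complex ^ 2 \<Rightarrow> complex ^ 'n"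
  assumes F: "holomorphic_map X F" and AB: "open A" "open B" and sub: "\<And>z w. z \<in> A \<Longrightarrow> w \<in> B \<Longrightarrow> pt z w \<in> X"
  shows "hol2 (A \<times> B) (\<lambda>z w. F (pt z w) $ j)"
  unfolding hol2_def
proof (intro conjI ballI)
  show "open (A \<times> B)" by (intro open_Times AB)
  fix p assume "p \<in> A \<times> B"
  then have "pt (fst p) (snd p) \<in> X" using sub by auto
  then obtain L where L: "(F has_derivative L) (at (pt (fst p) (snd p)))" "Vector_Spaces.linear (*s) (*s) L"
    using F unfolding holomorphic_map_def by blast
  interpret L: Vector_Spaces.linear "(*s)" "(*s)" L by (rule L(2))
  have "((\<lambda>q. pt (fst q) (snd q)) has_derivative (\<lambda>q. pt (fst q) (snd q))) (at p)"
    by (rule bounded_linear_imp_has_derivative[OF bounded_linear_pt])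
  from has_derivative_compose[OF this L(1)]
  have "((\<lambda>q. F (pt (fst q) (snd q))) has_derivative (\<lambda>q. L (pt (fst q) (snd q)))) (at p)" .
  from bounded_linear.has_derivative[OF bounded_linear_vec_nth this]
  have d: "((\<lambda>q. F (pt (fst q) (snd q)) $ j) has_derivative (\<lambda>q. L (pt (fst q) (snd q)) $ j)) (at p)" .
  have lin: "L (pt z w) $ j = L (pt 1 0) $ j * z + L (pt 0 1) $ j * w" for z w
  proof -
    have "pt z w = z *s pt 1 0 + w *s pt 0 1" by (simp add: pt_def vec_eq_iff)
    then have "L (pt z w) = z *s L (pt 1 0) + w *s L (pt 0 1)" by (simp only: L.add L.scale)
    then show ?thesis by (simp add: mult.commute)
  qed
  have "((\<lambda>q. F (pt (fst q) (snd q)) $ j) has_derivative (\<lambda>q. L (pt 1 0) $ j * fst q + L (pt 0 1) $ j * snd q)) (at p)"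
    using d by (subst lin[symmetric])
  then show "\<exists>a b. ((\<lambda>(z, w). F (pt z w) $ j) has_derivative (\<lambda>q. a * fst q + b * snd q)) (at p)"
    unfolding case_prod_unfold by blast
qed

lemma holomorphic_map_along_line:
  fixes F :: "complex ^ 'm \<Rightarrow> complex ^ 'n"
  assumes F: "holomorphic_map X F" and T: "open T" "\<And>t. t \<in> T \<Longrightarrow> p + t *s v \<in> X"
  shows "(\<lambda>t. F (p + t *s v) $ j) holomorphic_on T"
  unfolding holomorphic_on_open[OF T(1)]
proof
  fix t assume "t \<in> T"
  then obtain L where L: "(F has_derivative L) (at (p + t *s v))" "Vector_Spaces.linear (*s) (*s) L"
    using F T(2) unfolding holomorphic_map_def by blast
  interpret L: Vector_Spaces.linear "(*s)" "(*s)" L by (rule L(2))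
  have "bounded_linear (\<lambda>t. t *s v)"
    by (rule linear_conv_bounded_linear[THEN iffD1]) (auto simp: linear_iff vec_eq_iff algebra_simps)
  then have "((\<lambda>t. p + t *s v) has_derivative (\<lambda>h. 0 + h *s v)) (at t)"
    by (intro has_derivative_add has_derivative_const bounded_linear_imp_has_derivative)
  from bounded_linear.has_derivative[OF bounded_linear_vec_nth has_derivative_compose[OF this L(1)]]
  have "((\<lambda>t. F (p + t *s v) $ j) has_derivative (\<lambda>h. L (0 + h *s v) $ j)) (at t)" .
  moreover have "(\<lambda>h. L (0 + h *s v) $ j) = (*) (L v $ j)"
    by (simp add: L.scale fun_eq_iff mult.commute)
  ultimately show "\<exists>f'. ((\<lambda>t. F (p + t *s v) $ j) has_field_derivative f') (at t)"
    unfolding has_field_derivative_def by auto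
qed

text \<open>Inside a ball the identity theorem is applied on complex lines, so the set of points near which \<open>F\<close> equals \<open>a\<close> is both open
  and closed in \<open>X\<close>.\<close>

lemma holomorphic_map_identity:
  fixes F :: "complex ^ 'm \<Rightarrow> complex ^ 'n"
  assumes F: "holomorphic_map X F" and X: "connected X"
    and O: "open O'" "O' \<subseteq> X" "O' \<noteq> {}" "\<And>q. q \<in> O' \<Longrightarrow> F q = a"
  shows "F constant_on X"
proof -
  have oX: "open X" using F by (simp add: holomorphic_map_def)
  define S where "S = {p\<in>X. \<exists>r>0. \<forall>q\<in>ball p r. F q = a}"
  \<comment> \<open>a ball in \<open>X\<close> that meets \<open>S\<close> is contained in the zero set of \<open>F - a\<close>\<close>
  have spread: "F q' = a" if B: "ball p r \<subseteq> X" and q: "q \<in> ball p r" "q \<in> S" and q': "q' \<in> ball p r" for p q q' r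
  proof -
    define v where "v = q' - q"
    define T where "T = (\<lambda>t. q + t *s v) -` ball p r"
    have bl: "linear (\<lambda>t. t *s v)" by (auto simp: linear_iff vec_eq_iff algebra_simps)
    then have cont: "continuous_on S (\<lambda>t. t *s v)" for S
      by (simp add: linear_continuous_on linear_conv_bounded_linear)
    have oT: "open T" unfolding T_def by (intro open_vimage open_ball continuous_intros cont)
    have "T = (\<lambda>t. t *s v) -` ball (p - q) r"
      by (auto simp: T_def dist_norm algebra_simps)
    then have cT: "connected T" by (simp add: convex_connected convex_linear_vimage[OF bl])
    have 0: "0 \<in> T" "1 \<in> T" using q q' by (auto simp: T_def v_def)
    obtain s where s: "s > 0" "\<And>y. y \<in> ball q s \<Longrightarrow> F y = a" using q(2) by (auto simp: S_def)
    have "open ((\<lambda>t. q + t *s v) -` ball q s)" by (intro open_vimage open_ball continuous_intros cont)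
    then have ev: "\<forall>\<^sub>F t in at 0. t \<in> (\<lambda>t. q + t *s v) -` ball q s" using s(1) by (intro eventually_at_in_open') auto
    have "F (q + 1 *s v) $ j - a $ j = 0" for j
    proof (rule holomorphic_frequently_zero[OF oT cT 0(1) _ _ 0(2), where h = "\<lambda>t. F (q + t *s v) $ j - a $ j"])
      show "(\<lambda>t. F (q + t *s v) $ j - a $ j) holomorphic_on T"
        by (intro holomorphic_intros holomorphic_map_along_line[OF F oT]) (use B in \<open>auto simp: T_def\<close>)
      from ev have "\<forall>\<^sub>F t in at 0. F (q + t *s v) $ j - a $ j = 0"
        by eventually_elim (use s(2) in auto)
      then show "\<exists>\<^sub>F t in at 0. F (q + t *s v) $ j - a $ j = 0" by (rule eventually_frequently[OF at_neq_bot])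
    qed
    then show ?thesis by (simp add: v_def vec_eq_iff)
  qed
  have oS: "open S"
    unfolding open_contains_ball
  proof
    fix p assume "p \<in> S"
    then obtain r where r: "p \<in> X" "r > 0" "\<forall>q\<in>ball p r. F q = a" by (auto simp: S_def)
    obtain r' where r': "r' > 0" "ball p r' \<subseteq> X" using oX r(1) open_contains_ball by blast
    have "ball p (min r r' / 2) \<subseteq> S"
    proof
      fix q assume q: "q \<in> ball p (min r r' / 2)"
      have "F y = a" if "y \<in> ball q (min r r' / 2)" for y
        using q that r(3) dist_triangle[of p y q] by (intro r(3)[rule_format]) auto
      moreover have "min r r' / 2 > 0" using r(2) r'(1) by simp
      moreover have "q \<in> X" using q r' by auto
      ultimately show "q \<in> S" unfolding S_def by blast
    qed
    then show "\<exists>e>0. ball p e \<subseteq> S" using r(2) r'(1) by (intro exI[of _ "min r r' / 2"]) simp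
  qed
  have oXS: "open (X - S)"
    unfolding open_contains_ball
  proof
    fix p assume p: "p \<in> X - S"
    obtain r where r: "r > 0" "ball p r \<subseteq> X" using oX p open_contains_ball by blast
    have "ball p r \<inter> S = {}"
    proof (rule ccontr)
      assume "\<not> ?thesis"
      then obtain q where q: "q \<in> ball p r" "q \<in> S" by blast
      have "F y = a" if "y \<in> ball p r" for y by (rule spread[OF r(2) q that])
      then have "p \<in> S" using r(1) p unfolding S_def by blast
      with p show False by blast
    qed
    then have "ball p r \<subseteq> X - S" using r(2) by blast
    then show "\<exists>e>0. ball p e \<subseteq> X - S" using r(1) by blast
  qed
  obtain p where p: "p \<in> O'" using O(3) by blast
  obtain r where r: "r > 0" "ball p r \<subseteq> O'" using O(1) p open_contains_ball by blast
  have "F q = a" if "q \<in> ball p r" for q using O(4) r(2) that by blast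
  then have "p \<in> S" using r(1) O(2) p unfolding S_def by blast
  then have "X \<inter> S \<noteq> {}" using O(2) p by blast
  then have "X \<subseteq> S"
    using connectedD[OF X oS oXS] by blast
  then have "F p = a" if "p \<in> X" for p using that \<open>X \<subseteq> S\<close> by (auto simp: S_def)
  then show ?thesis unfolding constant_on_def by blast
qed

lemma constant_holomorphic_map_not_embedding:
  fixes F :: "complex ^ 'm \<Rightarrow> complex ^ 'n"
  assumes "F constant_on X" "p \<in> X"
  shows "\<not> holomorphic_embedding X F"
proof
  assume emb: "holomorphic_embedding X F"
  then have oX: "open X" by (simp add: holomorphic_embedding_def holomorphic_map_def)
  obtain a where a: "\<And>q. q \<in> X \<Longrightarrow> F q = a" using assms(1) by (auto simp: constant_on_def)
  have "(F has_derivative (\<lambda>_. 0)) (at p)"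
    by (rule has_derivative_transform_within_open[OF has_derivative_const[of a] oX assms(2)]) (simp add: a)
  then have "frechet_derivative F (at p) = (\<lambda>_. 0)" by (rule frechet_derivative_at[symmetric])
  moreover have "inj (frechet_derivative F (at p))" using emb assms(2) unfolding holomorphic_embedding_def by blast
  ultimately have "inj (\<lambda>_ :: complex ^ 'm. 0 :: complex ^ 'n)" by simp
  then have "(0 :: complex ^ 'm) = 1" by (rule injD) simp
  then show False by (simp add: vec_eq_iff)
qed

section \<open>The perturbed octic hypersurfaces\<close>

lemma IVT_closed_segment:
  fixes g :: "real \<Rightarrow> real"
  assumes "continuous_on UNIV g" "g a \<le> t" "t \<le> g b"
  obtains x where "x \<in> closed_segment a b" "g x = t"
proof -
  have "connected (g ` closed_segment a b)"
    by (intro connected_continuous_image continuous_on_subset[OF assms(1)]) auto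
  then have "t \<in> g ` closed_segment a b"
    by (rule connectedD_interval[OF _ _ _ assms(2,3)]) auto
  then show thesis using that by blast
qed

text \<open>The two bounds make \<open>e\<close> small: the first gives star-shapedness, the second makes \<open>\<rho>\<close> change sign.\<close>

locale perturbed_octic =
  fixes c e0 e :: real
  assumes c: "2 < c" and e0: "0 < e0" and e: "0 < e"
    and small: "e * (e0 * (c - 1)) < 1" "32 * e < (e0 * (c - 1)) ^ 4"
begin

text \<open>In the directions with \<open>z\<^sup>6 = -|z|\<^sup>6\<close>, the term of degree eight of \<open>\<rho>\<close> attains its minimum \<open>-K * |z|\<^sup>8\<close>.\<close>

definition K :: real where "K = e0 * (c - 1)"

text \<open>The function \<open>\<rho>\<close>, with the hypersurface being \<open>\<rho>(z) + |w|\<^sup>2 = 1\<close>. The next definition polarizes it.\<close>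

definition rho :: "complex \<Rightarrow> real" where
  "rho z = e0 * (cmod z ^ 8 + c * Re (complex_of_real (cmod z ^ 2) * z ^ 6)) + cmod z ^ 10 + e * cmod z ^ 2"

definition pol :: "complex \<Rightarrow> complex \<Rightarrow> complex" where
  "pol z \<zeta> = of_real e0 * (z ^ 4 * \<zeta> ^ 4 + of_real (c / 2) * (z ^ 7 * \<zeta> + z * \<zeta> ^ 7)) + z ^ 5 * \<zeta> ^ 5
     + of_real e * (z * \<zeta>)"

definition coef :: "nat \<Rightarrow> complex poly" where
  "coef j = (if j = 1 then monom (of_real e) 1 + monom (of_real (e0 * c / 2)) 7
     else if j = 4 then monom (of_real e0) 4 else if j = 5 then monom 1 5
     else if j = 7 then monom (of_real (e0 * c / 2)) 1 else 0)"

sublocale segre coef 7 pol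
proof
  have "{..7::nat} = {0,1,2,3,4,5,6,7}" by auto
  then show "pol z \<zeta> = (\<Sum>j\<le>7. poly (coef j) z * \<zeta> ^ j)" for z \<zeta>
    by (simp add: pol_def coef_def poly_monom algebra_simps)
  show "pol z \<zeta> = pol \<zeta> z" for z \<zeta> by (simp add: pol_def algebra_simps)
  show "cnj (pol z \<zeta>) = pol (cnj z) (cnj \<zeta>)" for z \<zeta> by (simp add: pol_def)
qed

lemma K_pos: "0 < K" using c e0 by (simp add: K_def)

lemma pol_cnj: "pol z (cnj z) = of_real (rho z)"
proof -
  define n where "n = complex_of_real (cmod z ^ 2)"
  have n: "z * cnj z = n" by (simp add: n_def complex_norm_square[symmetric] del: of_real_power)
  have "z ^ 7 * cnj z + z * cnj z ^ 7 = (z * cnj z) * (z ^ 6 + cnj (z ^ 6))"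
    by (simp add: algebra_simps power_numeral_reduce)
  also have "\<dots> = of_real (2 * (cmod z ^ 2 * Re (z ^ 6)))"
    unfolding complex_add_cnj n by (simp add: n_def)
  finally have 1: "z ^ 7 * cnj z + z * cnj z ^ 7 = of_real (2 * (cmod z ^ 2 * Re (z ^ 6)))" .
  have "pol z (cnj z) = of_real e0 * ((z * cnj z) ^ 4 + of_real (c / 2) * (z ^ 7 * cnj z + z * cnj z ^ 7))
      + (z * cnj z) ^ 5 + of_real e * (z * cnj z)"
    by (simp add: pol_def power_mult_distrib)
  also have "\<dots> = of_real (e0 * ((cmod z ^ 2) ^ 4 + c / 2 * (2 * (cmod z ^ 2 * Re (z ^ 6))))
      + (cmod z ^ 2) ^ 5 + e * cmod z ^ 2)"
    unfolding 1 n n_def by (simp only: of_real_add of_real_mult of_real_power)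
  also have "\<dots> = of_real (rho z)"
    by (simp add: rho_def power_mult[symmetric])
  finally show ?thesis .
qed

lemma on_M_iff: "on_M z w \<longleftrightarrow> rho z + cmod w ^ 2 = 1"
proof -
  have "w * cnj w = of_real (cmod w ^ 2)" by (simp add: complex_norm_square[symmetric] del: of_real_power)
  then have "on_M z w \<longleftrightarrow> complex_of_real (cmod w ^ 2) = of_real (1 - rho z)"
    unfolding on_M_def pol_cnj by simp
  then show ?thesis unfolding of_real_eq_iff by linarith
qed

lemma hypersurface_iff: "Z \<in> hypersurface_M c e0 e \<longleftrightarrow> rho (Z $ 1) + cmod (Z $ 2) ^ 2 = 1"
  unfolding hypersurface_M_def rho_def by (simp add: Let_def) linarith

lemma rho_polar:
  assumes "0 \<le> s"
  shows "rho (rcis s \<theta>) = e0 * (s ^ 8 * (1 + c * cos (6 * \<theta>))) + s ^ 10 + e * s ^ 2"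
proof -
  have "Re (complex_of_real (s ^ 2) * rcis s \<theta> ^ 6) = s ^ 2 * (s ^ 6 * cos (6 * \<theta>))"
    by (simp add: DeMoivre2 of_real_power[symmetric] del: of_real_power)
  then show ?thesis using assms by (simp add: rho_def algebra_simps power_add[symmetric])
qed

lemma continuous_rho [continuous_intros]:
  "continuous_on S g \<Longrightarrow> continuous_on S (\<lambda>x. rho (g x))"
  unfolding rho_def by (intro continuous_intros)

text \<open>On the ray through \<open>z\<close>, \<open>\<rho>\<close> is \<open>t ^ 8 * (a + t\<^sup>2 * n ^ 10) + e * t\<^sup>2 * n\<^sup>2\<close>. If the bracket is negative, then
  \<open>t\<^sup>2 * n\<^sup>2 \<le> K\<close> and only the small last term counts; if it is positive, then both summands increase with \<open>t\<close>. So every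
  sublevel set of height at least \<open>e * K\<close> is star-shaped.\<close>

lemma rho_scale:
  assumes t: "0 \<le> t" "t \<le> 1"
  shows "rho (of_real t * z) \<le> e * K \<or> rho (of_real t * z) + e * (1 - t ^ 2) * cmod z ^ 2 \<le> rho z"
proof -
  define n where "n = cmod z"
  define a where "a = e0 * (n ^ 8 + c * (n ^ 2 * Re (z ^ 6)))"
  have n0: "0 \<le> n" by (simp add: n_def)
  have "\<bar>Re (z ^ 6)\<bar> \<le> n ^ 6" using abs_Re_le_cmod[of "z ^ 6"] by (simp add: n_def norm_power)
  then have "n ^ 2 * (- (n ^ 6)) \<le> n ^ 2 * Re (z ^ 6)" by (intro mult_left_mono) auto
  then have "c * (n ^ 2 * (- (n ^ 6))) \<le> c * (n ^ 2 * Re (z ^ 6))" by (rule mult_left_mono) (use c in simp)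
  then have "e0 * (n ^ 8 + c * (n ^ 2 * (- (n ^ 6)))) \<le> a" unfolding a_def using e0 by (intro mult_left_mono) auto
  then have a: "- (K * n ^ 8) \<le> a" by (simp add: K_def algebra_simps power_add[symmetric])
  have "Re (complex_of_real (x ^ 2) * (of_real t * z) ^ 6) = x ^ 2 * (t ^ 6 * Re (z ^ 6))" for x
    by (simp add: power_mult_distrib of_real_power[symmetric] del: of_real_power)
  then have rt: "rho (of_real t * z) = t ^ 8 * (a + t ^ 2 * n ^ 10) + e * (t ^ 2 * n ^ 2)"
    using t unfolding rho_def a_def n_def
    by (simp add: norm_mult power_mult_distrib algebra_simps power_add[symmetric])
  have r: "rho z = a + n ^ 10 + e * n ^ 2" by (simp add: rho_def a_def n_def)
  show ?thesis
  proof (cases "a + t ^ 2 * n ^ 10 \<le> 0")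
    case True
    have "t ^ 2 * n ^ 2 \<le> K"
    proof (cases "n = 0")
      case False
      have "n ^ 8 * (t ^ 2 * n ^ 2) = t ^ 2 * n ^ 10" by (simp add: power_add[symmetric])
      then have "n ^ 8 * (t ^ 2 * n ^ 2) \<le> n ^ 8 * K" using True a by (simp add: mult.commute)
      then show ?thesis using False n0 by simp
    qed (use K_pos in simp)
    then have "e * (t ^ 2 * n ^ 2) \<le> e * K" using e by simp
    moreover have "t ^ 8 * (a + t ^ 2 * n ^ 10) \<le> 0" using True by (intro mult_nonneg_nonpos) (auto simp: t)
    ultimately show ?thesis unfolding rt by linarith
  next
    case False
    have "t ^ 8 * (a + t ^ 2 * n ^ 10) \<le> 1 * (a + t ^ 2 * n ^ 10)"
      using False t by (intro mult_right_mono power_le_one) auto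
    moreover have "t ^ 2 * n ^ 10 \<le> 1 * n ^ 10"
      using n0 t by (intro mult_right_mono power_le_one) auto
    ultimately show ?thesis unfolding rt r n_def[symmetric] by (simp add: algebra_simps)
  qed
qed

text \<open>On circles with \<open>K/2 < r\<^sup>2 < 3K/4\<close> the value of \<open>\<rho>\<close> is positive for \<open>\<theta> = 0\<close> and negative for \<open>\<theta> = \<pi>/6\<close>, the latter
  because \<open>r\<^sup>6 * (K - r\<^sup>2) > (K/2)\<^sup>3 * (K/4) = K\<^sup>4/32 > e\<close>. So every such circle contains a zero.\<close>

lemma infinite_zeros:
  assumes R: "sqrt K \<le> R"
  shows "infinite {z. cmod z < R \<and> rho z = 0}"
proof -
  have sub: "{sqrt (K / 2)<..<sqrt (3 * K / 4)} \<subseteq> cmod ` {z. cmod z < R \<and> rho z = 0}"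
  proof
    fix r assume r: "r \<in> {sqrt (K / 2)<..<sqrt (3 * K / 4)}"
    define x where "x = r ^ 2"
    have r0: "0 < r" using r K_pos by (auto intro: order.strict_trans[rotated])
    have x: "K / 2 < x" "x < 3 * K / 4"
      using r r0 real_sqrt_less_iff[of _ "r ^ 2"] real_sqrt_less_iff[of "r ^ 2"] by (auto simp: x_def)
    have "(K / 2) ^ 3 * (K / 4) < x ^ 3 * (K - x)"
      using x K_pos by (intro mult_strict_mono power_strict_mono) auto
    moreover have "e < (K / 2) ^ 3 * (K / 4)" using small(2) by (simp add: K_def power_numeral_reduce)
    ultimately have "x * (e - x ^ 3 * (K - x)) < 0" using x K_pos by (intro mult_pos_neg) auto
    moreover have "rho (rcis r (pi / 6)) = x * (e - x ^ 3 * (K - x))"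
      using r0 by (simp add: rho_polar x_def K_def algebra_simps power_numeral_reduce)
    moreover have "0 < rho (rcis r 0)"
      using r0 c e0 e by (simp add: rho_polar add_pos_pos del: rcis_zero_arg)
    moreover have "continuous_on UNIV (\<lambda>\<theta>. rho (rcis r \<theta>))"
      unfolding rcis_def cis_conv_exp by (intro continuous_intros)
    ultimately obtain \<theta> where "rho (rcis r \<theta>) = 0"
      using IVT_closed_segment[of "\<lambda>\<theta>. rho (rcis r \<theta>)" "pi / 6" 0 0] by (metis less_imp_le)
    moreover have "r < R"
      using r R real_sqrt_less_mono[of "3 * K / 4" K] K_pos unfolding greaterThanLessThan_iff by linarith
    ultimately show "r \<in> cmod ` {z. cmod z < R \<and> rho z = 0}"
      using r0 by (intro image_eqI[of _ _ "rcis r \<theta>"]) auto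
  qed
  have "infinite {sqrt (K / 2)<..<sqrt (3 * K / 4)}" using K_pos by (intro infinite_Ioo) simp
  then show ?thesis using finite_subset[OF sub finite_imageI] by blast
qed

lemma polar_neighbourhood:
  assumes "open W" "rcis s \<theta> \<in> W"
  obtains d where "d > 0" "\<And>s' \<theta>'. \<bar>s' - s\<bar> < d \<Longrightarrow> \<bar>\<theta>' - \<theta>\<bar> < d \<Longrightarrow> rcis s' \<theta>' \<in> W"
proof -
  define V where "V = (\<lambda>p. rcis (fst p) (snd p)) -` W"
  have "open V" unfolding V_def rcis_def cis_conv_exp by (intro open_vimage assms(1) continuous_intros)
  moreover have "(s, \<theta>) \<in> V" using assms(2) by (simp add: V_def)
  ultimately obtain A B where AB: "open A" "open B" "(s, \<theta>) \<in> A \<times> B" "A \<times> B \<subseteq> V"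
    by (rule open_prod_elim)
  obtain d1 where d1: "d1 > 0" "ball s d1 \<subseteq> A" using AB by (auto simp: open_contains_ball)
  obtain d2 where d2: "d2 > 0" "ball \<theta> d2 \<subseteq> B" using AB by (auto simp: open_contains_ball)
  show thesis
  proof (rule that[of "min d1 d2"])
    show "min d1 d2 > 0" using d1 d2 by simp
    fix s' \<theta>' assume "\<bar>s' - s\<bar> < min d1 d2" "\<bar>\<theta>' - \<theta>\<bar> < min d1 d2"
    then have "s' \<in> A" "\<theta>' \<in> B" using d1(2) d2(2) by (auto simp: dist_real_def abs_minus_commute subset_iff)
    then show "rcis s' \<theta>' \<in> W" using AB(4) by (auto simp: V_def)
  qed
qed

text \<open>Where \<open>sin (6 * \<theta>) \<noteq> 0\<close>, \<open>\<rho>\<close> is strictly monotone in the angle; hence on every nearby circle the level is attained near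
  \<open>\<theta>\<close>.\<close>

lemma uncountable_levels:
  assumes s: "0 < s" and \<theta>: "sin (6 * \<theta>) \<noteq> 0" and r: "0 < r"
  shows "\<exists>d>0. \<forall>t. \<bar>t - rho (rcis s \<theta>)\<bar> < d \<longrightarrow> uncountable {z \<in> cball (rcis s \<theta>) r. rho z = t}"
proof -
  let ?z = "rcis s \<theta>"
  have "?z \<in> ball ?z r" using r by simp
  then obtain d where d: "d > 0" "\<And>s' \<theta>'. \<bar>s' - s\<bar> < d \<Longrightarrow> \<bar>\<theta>' - \<theta>\<bar> < d \<Longrightarrow> rcis s' \<theta>' \<in> ball ?z r"
    using polar_neighbourhood[OF open_ball] by blast
  have D: "((\<lambda>\<theta>. cos (6 * \<theta>)) has_real_derivative (- 6 * sin (6 * \<theta>))) (at \<theta>)"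
    by (auto intro!: derivative_eq_intros)
  \<comment> \<open>two angles close to \<open>\<theta>\<close> where \<open>\<rho>\<close> is below and above its value at \<open>rcis s \<theta>\<close>\<close>
  obtain a b where ab: "a \<in> ball \<theta> d" "b \<in> ball \<theta> d" "cos (6 * a) < cos (6 * \<theta>)" "cos (6 * \<theta>) < cos (6 * b)"
  proof (cases "sin (6 * \<theta>) < 0")
    case True
    then have p: "0 < - 6 * sin (6 * \<theta>)" by simp
    obtain d1 where d1: "d1 > 0" "\<And>h. 0 < h \<Longrightarrow> h < d1 \<Longrightarrow> cos (6 * \<theta>) < cos (6 * (\<theta> + h))"
      using DERIV_pos_inc_right[OF D p] by blast
    obtain d2 where d2: "d2 > 0" "\<And>h. 0 < h \<Longrightarrow> h < d2 \<Longrightarrow> cos (6 * (\<theta> - h)) < cos (6 * \<theta>)"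
      using DERIV_pos_inc_left[OF D p] by blast
    define h where "h = min d (min d1 d2) / 2"
    have "0 < h" "h < d" "h < d1" "h < d2" using d(1) d1(1) d2(1) by (auto simp: h_def)
    then show thesis using d1(2)[of h] d2(2)[of h] by (intro that[of "\<theta> - h" "\<theta> + h"]) (auto simp: dist_real_def)
  next
    case False
    then have p: "- 6 * sin (6 * \<theta>) < 0" using \<theta> by simp
    obtain d1 where d1: "d1 > 0" "\<And>h. 0 < h \<Longrightarrow> h < d1 \<Longrightarrow> cos (6 * (\<theta> + h)) < cos (6 * \<theta>)"
      using DERIV_neg_dec_right[OF D p] by blast
    obtain d2 where d2: "d2 > 0" "\<And>h. 0 < h \<Longrightarrow> h < d2 \<Longrightarrow> cos (6 * \<theta>) < cos (6 * (\<theta> - h))"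
      using DERIV_neg_dec_left[OF D p] by blast
    define h where "h = min d (min d1 d2) / 2"
    have "0 < h" "h < d" "h < d1" "h < d2" using d(1) d1(1) d2(1) by (auto simp: h_def)
    then show thesis using d1(2)[of h] d2(2)[of h] by (intro that[of "\<theta> + h" "\<theta> - h"]) (auto simp: dist_real_def)
  qed
  have less: "rho (rcis s x) < rho (rcis s y)" if "cos (6 * x) < cos (6 * y)" for x y
    using that s c e0 by (simp add: rho_polar)
  have "rho (rcis s a) < rho ?z" "rho ?z < rho (rcis s b)" using ab less by auto
  define m where "m = min (rho ?z - rho (rcis s a)) (rho (rcis s b) - rho ?z) / 2"
  have m: "m > 0" using \<open>rho (rcis s a) < rho ?z\<close> \<open>rho ?z < rho (rcis s b)\<close> by (simp add: m_def)
  have oa: "open {x. rho (rcis x a) < rho ?z - m}" "open {x. rho ?z + m < rho (rcis x b)}"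
    unfolding rcis_def by (intro open_Collect_less continuous_intros)+
  have "open ({x. rho (rcis x a) < rho ?z - m} \<inter> {x. rho ?z + m < rho (rcis x b)} \<inter> ball s (min d s))"
    by (intro open_Int oa open_ball)
  moreover have "s \<in> {x. rho (rcis x a) < rho ?z - m} \<inter> {x. rho ?z + m < rho (rcis x b)} \<inter> ball s (min d s)"
    using \<open>rho (rcis s a) < rho ?z\<close> \<open>rho ?z < rho (rcis s b)\<close> s d(1) by (simp add: m_def min_def field_simps)
  ultimately obtain h where h: "h > 0"
    "ball s h \<subseteq> {x. rho (rcis x a) < rho ?z - m} \<inter> {x. rho ?z + m < rho (rcis x b)} \<inter> ball s (min d s)"
    by (meson open_contains_ball)
  have "uncountable {z \<in> cball ?z r. rho z = t}" if t: "\<bar>t - rho ?z\<bar> < m" for t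
  proof
    assume "countable {z \<in> cball ?z r. rho z = t}"
    then have "countable (cmod ` {z \<in> cball ?z r. rho z = t})" by (rule countable_image)
    moreover have "{s - h<..<s + h} \<subseteq> cmod ` {z \<in> cball ?z r. rho z = t}"
    proof
      fix x assume "x \<in> {s - h<..<s + h}"
      then have "x \<in> ball s h" by (auto simp: dist_real_def)
      then have x: "rho (rcis x a) < rho ?z - m" "rho ?z + m < rho (rcis x b)" "\<bar>x - s\<bar> < d" "0 < x"
        using h(2) by (auto simp: dist_real_def subset_iff)
      have "continuous_on UNIV (\<lambda>\<theta>. rho (rcis x \<theta>))"
        unfolding rcis_def cis_conv_exp by (intro continuous_intros)
      moreover have "rho (rcis x a) \<le> t" "t \<le> rho (rcis x b)" using x(1,2) t by linarith+
      ultimately obtain y where y: "y \<in> closed_segment a b" "rho (rcis x y) = t"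
        by (rule IVT_closed_segment)
      have "y \<in> ball \<theta> d" using closed_segment_subset[OF ab(1,2) convex_ball] y(1) by blast
      then have "rcis x y \<in> ball ?z r" using x(3) by (intro d(2)) (auto simp: dist_real_def)
      then show "x \<in> cmod ` {z \<in> cball ?z r. rho z = t}"
        using y(2) x(4) by (intro image_eqI[of _ _ "rcis x y"]) auto
    qed
    ultimately show False using h(1) countable_subset uncountable_open_interval[of "s - h" "s + h"] by fastforce
  qed
  then show ?thesis using m by blast
qed

text \<open>On the chord \<open>\<zeta> = t * cnj z\<close> the imaginary part of \<open>P z \<zeta>\<close> is a multiple of \<open>(t - t ^ 7) * Im (z ^ 6)\<close>; it vanishes only at the
  ends, where \<open>P z \<zeta>\<close> is \<open>0\<close> or \<open>\<rho>(z) < 1\<close>.\<close>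

lemma chord:
  assumes z: "Im (z ^ 6) \<noteq> 0" and r: "rho z < 1" and \<zeta>: "\<zeta> \<in> closed_segment 0 (cnj z)"
  shows "pol z \<zeta> \<noteq> 1"
proof
  assume eq: "pol z \<zeta> = 1"
  obtain t where t: "0 \<le> t" "t \<le> 1" "\<zeta> = of_real t * cnj z"
    using \<zeta> by (auto simp: closed_segment_def scaleR_conv_of_real)
  define n where "n = cmod z ^ 2"
  have n: "z * cnj z = of_real n" by (simp add: n_def complex_norm_square[symmetric] del: of_real_power)
  have "pol z \<zeta> = of_real e0 * (of_real (t ^ 4) * (z * cnj z) ^ 4
      + of_real (c / 2) * ((z * cnj z) * (of_real t * z ^ 6 + of_real (t ^ 7) * cnj (z ^ 6))))
      + of_real (t ^ 5) * (z * cnj z) ^ 5 + of_real e * (of_real t * (z * cnj z))"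
    by (simp add: pol_def t(3) algebra_simps power_mult_distrib power_numeral_reduce)
  also have "Im \<dots> = e0 * (c / 2 * (n * (t * Im (z ^ 6) - t ^ 7 * Im (z ^ 6))))"
    unfolding n by (simp add: of_real_power[symmetric] del: of_real_power complex_cnj_power)
  finally have "e0 * (c / 2 * (n * (t * Im (z ^ 6) - t ^ 7 * Im (z ^ 6)))) = 0" using eq by simp
  moreover have "n \<noteq> 0" using z by (auto simp: n_def)
  ultimately have "t * Im (z ^ 6) = t ^ 7 * Im (z ^ 6)" using c e0 by simp
  then have "t * (1 - t ^ 6) = 0" using z by (simp add: power_numeral_reduce)
  then have "t = 0 \<or> t = 1"
    using t power_eq_imp_eq_base[of t 6 1] by auto
  then show False
  proof
    assume "t = 1"
    then show False using eq r t(3) by (simp add: pol_cnj)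
  qed (use eq t(3) in \<open>simp add: pol_def\<close>)
qed

definition ray :: "real \<Rightarrow> real" where
  "ray x = e0 * (x ^ 4 + c / 2 * (x ^ 7 + x)) + x ^ 5 + e * x"

definition ray' :: "real \<Rightarrow> real" where
  "ray' x = e0 * (4 * x ^ 3 + c / 2 * (7 * x ^ 6 + 1)) + 5 * x ^ 4 + e"

lemma pol_ray: "pol (of_real x) 1 = of_real (ray x)"
  by (simp add: pol_def ray_def)

lemma ray_derivative: "(ray has_real_derivative ray' x) (at x)"
  unfolding ray_def ray'_def by (auto intro!: derivative_eq_intros simp: algebra_simps)

lemma pol_ray_deriv: "deriv (\<lambda>s. pol s 1) (of_real x) = of_real (ray' x)"
proof (rule DERIV_imp_deriv)
  show "((\<lambda>s. pol s 1) has_field_derivative of_real (ray' x)) (at (of_real x))"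
    unfolding pol_def ray'_def by (auto intro!: derivative_eq_intros simp: algebra_simps)
qed

text \<open>Since \<open>c > 2\<close>, the derivative of the octic part is at least \<open>e0\<close> times \<open>7 u\<^sup>2 + 4 u + 1\<close> with \<open>u = x ^ 3\<close>, whose discriminant
  is negative.\<close>

lemma ray'_pos: "0 < ray' x"
proof -
  have "0 < 7 * (x ^ 3 + 2 / 7) ^ 2 + 3 / 7" by (intro add_nonneg_pos) auto
  also have "\<dots> = 4 * x ^ 3 + (7 * x ^ 6 + 1)" by (simp add: power2_eq_square algebra_simps power_numeral_reduce)
  also have "\<dots> \<le> 4 * x ^ 3 + c / 2 * (7 * x ^ 6 + 1)"
    using mult_right_mono[of 1 "c / 2" "7 * x ^ 6 + 1"] c by simp
  finally have "0 < e0 * (4 * x ^ 3 + c / 2 * (7 * x ^ 6 + 1))" using e0 by simp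
  then show ?thesis unfolding ray'_def using e by (simp add: add_pos_nonneg add_nonneg_pos)
qed

lemma ray_mono: "x \<le> y \<Longrightarrow> ray x \<le> ray y"
  using DERIV_nonneg_imp_nondecreasing[of x y ray] ray_derivative ray'_pos by (meson less_imp_le)

lemma continuous_ray: "continuous_on S ray"
  unfolding ray_def by (intro continuous_intros)

text \<open>A segment on which \<open>1 - ray\<close> takes all values between \<open>b1\<close> and \<open>b2\<close>. The lower end is bounded by
  \<open>ray (- y) \<le> - (y ^ 5)\<close>, which holds because \<open>y ^ 4\<close> is at most the mean of \<open>y ^ 7\<close> and \<open>y\<close>.\<close>

lemma ray_segment:
  assumes b: "0 < b1" "b1 \<le> 1" "1 \<le> b2"
  obtains s1 s2 where "s1 \<le> 0" "0 \<le> s2" "\<And>x. s1 \<le> x \<Longrightarrow> x \<le> s2 \<Longrightarrow> ray x < 1"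
    "\<And>b. b1 \<le> b \<Longrightarrow> b \<le> b2 \<Longrightarrow> \<exists>x. s1 \<le> x \<and> x \<le> s2 \<and> 1 - ray x = b"
proof -
  have r0: "ray 0 = 0" by (simp add: ray_def)
  have "0 \<le> e0 * (1 + c)" using c e0 by simp
  then have "1 - b1 \<le> ray 1" using b e by (simp add: ray_def)
  then obtain s2 where s2: "0 \<le> s2" "ray s2 = 1 - b1"
    using IVT'[of ray 0 "1 - b1" 1, OF _ _ _ continuous_ray] b r0 by auto
  have neg: "ray (- y) \<le> - (y ^ 5)" if "0 \<le> y" for y
  proof -
    have "0 \<le> y * (y ^ 3 - 1) ^ 2" using that by simp
    then have "y ^ 4 \<le> (y ^ 7 + y) / 2" by (simp add: power2_eq_square algebra_simps power_numeral_reduce)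
    also have "\<dots> \<le> c / 2 * (y ^ 7 + y)"
      using mult_right_mono[of "1 / 2" "c / 2" "y ^ 7 + y"] that c by simp
    finally have "e0 * (y ^ 4 - c / 2 * (y ^ 7 + y)) \<le> 0" using e0 by (intro mult_nonneg_nonpos) linarith+
    moreover have "0 \<le> e * y" using e that by simp
    moreover have "ray (- y) = e0 * (y ^ 4 - c / 2 * (y ^ 7 + y)) - y ^ 5 - e * y"
      by (simp add: ray_def algebra_simps)
    ultimately show ?thesis by linarith
  qed
  have "b2 \<le> b2 ^ 5" using b self_le_power[of b2 5] by simp
  then have "ray (- b2) \<le> 1 - b2" using neg[of b2] b by linarith
  then obtain s1 where s1: "s1 \<le> 0" "ray s1 = 1 - b2"
    using IVT'[of ray "- b2" "1 - b2" 0, OF _ _ _ continuous_ray] b r0 by auto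
  show thesis
  proof (rule that[OF s1(1) s2(1)])
    fix x assume "x \<le> s2"
    then show "ray x < 1" using ray_mono[of x s2] s2 b by linarith
  next
    fix b assume "b1 \<le> b" "b \<le> b2"
    then have "\<exists>x. s1 \<le> x \<and> x \<le> s2 \<and> ray x = 1 - b"
      using IVT'[of ray s1 "1 - b" s2, OF _ _ _ continuous_ray] s1 s2 by auto
    then show "\<exists>x. s1 \<le> x \<and> x \<le> s2 \<and> 1 - ray x = b" by auto
  qed
qed

end

section \<open>Rigidity of sphere maps\<close>

context perturbed_octic
begin

lemma e_K_less_1: "e * K < 1" using small(1) by (simp add: K_def)

text \<open>The hypersurface contains a point with \<open>w = 0\<close> only above \<open>\<rho> = 1\<close>; moving \<open>z\<close> slightly towards the origin decreases
  \<open>\<rho>\<close> strictly.\<close>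

lemma point_off_circle:
  assumes W: "open W" "z1 \<in> W" and r: "rho z1 \<le> 1"
  obtains z where "z \<in> W" "rho z < 1"
proof (cases "rho z1 < 1")
  case False
  then have r1: "rho z1 = 1" using r by simp
  have "open ((\<lambda>t. of_real t * z1) -` W)" by (intro open_vimage W(1) continuous_intros)
  moreover have "1 \<in> (\<lambda>t. of_real t * z1) -` W" using W(2) by simp
  ultimately obtain d where d: "d > 0" "ball 1 d \<subseteq> (\<lambda>t. of_real t * z1) -` W"
    by (meson open_contains_ball)
  define t where "t = 1 - min d 1 / 2"
  have t: "0 \<le> t" "t < 1" "t \<in> ball 1 d" using d(1) by (auto simp: t_def dist_real_def)
  have "z1 \<noteq> 0" using r1 by (auto simp: rho_def)
  moreover have "t ^ 2 < 1" using t by (simp add: power_less_one_iff abs_square_less_1)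
  ultimately have "0 < e * (1 - t ^ 2) * cmod z1 ^ 2" using e by simp
  moreover have "rho (of_real t * z1) \<le> e * K \<or> rho (of_real t * z1) + e * (1 - t ^ 2) * cmod z1 ^ 2 \<le> rho z1"
    using t by (intro rho_scale) auto
  ultimately have "rho (of_real t * z1) < 1" using r1 e_K_less_1 by linarith
  moreover have "of_real t * z1 \<in> W" using d(2) t(3) by blast
  ultimately show thesis using that by blast
qed (use W that in blast)

lemma generic_polar_point:
  assumes W: "open W" "W \<noteq> {}"
  obtains s \<theta> where "rcis s \<theta> \<in> W" "0 < s" "sin (6 * \<theta>) \<noteq> 0"
proof -
  have "infinite W" using W by (metis finite_imp_not_open)
  then have "W - {0} \<noteq> {}" by (metis finite.emptyI infinite_remove)
  then obtain z where z: "z \<in> W" "z \<noteq> 0" by blast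
  define s where "s = cmod z"
  have s: "0 < s" "rcis s (Arg z) \<in> W" using z by (auto simp: s_def rcis_cmod_Arg)
  obtain d where d: "d > 0" "\<And>s' \<theta>'. \<bar>s' - s\<bar> < d \<Longrightarrow> \<bar>\<theta>' - Arg z\<bar> < d \<Longrightarrow> rcis s' \<theta>' \<in> W"
    using polar_neighbourhood[OF W(1) s(2)] by blast
  have "\<exists>\<theta>\<in>{Arg z<..<Arg z + d}. sin (6 * \<theta>) \<noteq> 0"
  proof (rule ccontr)
    assume 0: "\<not> ?thesis"
    have "{Arg z<..<Arg z + d} \<subseteq> range (\<lambda>k::int. of_int k * pi / 6)"
    proof
      fix \<theta> assume "\<theta> \<in> {Arg z<..<Arg z + d}"
      then have "sin (6 * \<theta>) = 0" using 0 by blast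
      then obtain k :: int where "6 * \<theta> = of_int k * pi" unfolding sin_zero_iff_int2 by blast
      then show "\<theta> \<in> range (\<lambda>k::int. of_int k * pi / 6)" by (intro image_eqI[of _ _ k]) auto
    qed
    then have "countable {Arg z<..<Arg z + d}" by (rule countable_subset) simp
    then show False using d(1) uncountable_open_interval[of "Arg z" "Arg z + d"] by simp
  qed
  then obtain \<theta> where \<theta>: "\<theta> \<in> {Arg z<..<Arg z + d}" "sin (6 * \<theta>) \<noteq> 0" by blast
  have "rcis s \<theta> \<in> W" using \<theta>(1) d(1) by (intro d(2)) auto
  then show thesis using that s(1) \<theta>(2) by blast
qed

text \<open>Every open piece contains a point with \<open>w \<noteq> 0\<close> and \<open>z ^ 6\<close> not real: the piece contains the graph over an open set of \<open>z\<close> of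
  a square root of \<open>1 - \<rho>\<close> times a fixed unit vector \<open>u\<close>.\<close>

lemma generic_point:
  assumes U: "open_piece (hypersurface_M c e0 e) U"
  obtains Q s \<theta> w where "open Q" "hypersurface_M c e0 e \<inter> Q \<subseteq> U" "pt (rcis s \<theta>) w \<in> Q"
    "0 < s" "sin (6 * \<theta>) \<noteq> 0" "w \<noteq> 0" "rho (rcis s \<theta>) + cmod w ^ 2 = 1"
proof -
  obtain Q where Q: "open Q" "U = hypersurface_M c e0 e \<inter> Q" "U \<noteq> {}"
    using U unfolding open_piece_def openin_open by blast
  obtain Z where Z: "Z \<in> hypersurface_M c e0 e" "Z \<in> Q" using Q(2,3) by blast
  define u where "u = (if Z $ 2 = 0 then 1 else sgn (Z $ 2))"
  have u: "cmod u = 1" "Z $ 2 = of_real (cmod (Z $ 2)) * u"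
    by (simp add: u_def norm_sgn) (simp add: u_def sgn_div_norm scaleR_conv_of_real)
  define g where "g z = of_real (sqrt (1 - rho z)) * u" for z
  have eq: "cmod (Z $ 2) ^ 2 = 1 - rho (Z $ 1)" using Z(1) by (simp add: hypersurface_iff)
  then have "sqrt (1 - rho (Z $ 1)) = cmod (Z $ 2)" by (metis norm_ge_zero real_sqrt_unique)
  then have "g (Z $ 1) = Z $ 2" using u(2) by (simp add: g_def)
  moreover have oV: "open ((\<lambda>z. pt z (g z)) -` Q)"
    unfolding g_def by (intro open_vimage Q(1) continuous_intros)
  moreover have "rho (Z $ 1) \<le> 1" using eq by (smt (verit) zero_le_power2)
  ultimately obtain z where "z \<in> (\<lambda>z. pt z (g z)) -` Q" "rho z < 1"
    using point_off_circle[of "(\<lambda>z. pt z (g z)) -` Q" "Z $ 1"] Z(2) pt_eta[of Z] by auto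
  then have ne: "(\<lambda>z. pt z (g z)) -` Q \<inter> {z. rho z < 1} \<noteq> {}" by blast
  have "open ((\<lambda>z. pt z (g z)) -` Q \<inter> {z. rho z < 1})"
    by (rule open_Int[OF oV], intro open_Collect_less continuous_intros)
  then obtain s \<theta> where p: "rcis s \<theta> \<in> (\<lambda>z. pt z (g z)) -` Q \<inter> {z. rho z < 1}" "0 < s" "sin (6 * \<theta>) \<noteq> 0"
    using ne by (rule generic_polar_point)
  have "g (rcis s \<theta>) \<noteq> 0" "rho (rcis s \<theta>) + cmod (g (rcis s \<theta>)) ^ 2 = 1"
    using p(1) u(1) by (auto simp: g_def norm_mult)
  then show thesis using that[of Q s \<theta> "g (rcis s \<theta>)"] Q p by blast
qed

text \<open>It remains to verify the assumptions of \<open>sphere_map_locally_constant\<close> at a generic point and to spread constancy by the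
  identity theorem.\<close>

lemma sphere_map_constant:
  fixes F :: "complex ^ 2 \<Rightarrow> complex ^ 'n"
  assumes U: "open_piece (hypersurface_M c e0 e) U" and F: "maps_into_sphere U X F"
  shows "F constant_on X"
proof -
  have X: "open X" "connected X" "U \<subseteq> X" "holomorphic_map X F" "F ` U \<subseteq> sphere 0 1"
    using F by (auto simp: maps_into_sphere_def)
  obtain Q s \<theta> w0 where Q: "open Q" "hypersurface_M c e0 e \<inter> Q \<subseteq> U" "pt (rcis s \<theta>) w0 \<in> Q"
    and s: "0 < s" "sin (6 * \<theta>) \<noteq> 0" and w0: "w0 \<noteq> 0" "rho (rcis s \<theta>) + cmod w0 ^ 2 = 1"
    using generic_point[OF U] by blast
  define z0 where "z0 = rcis s \<theta>"
  have "pt z0 w0 \<in> hypersurface_M c e0 e" using w0(2) by (simp add: hypersurface_iff z0_def)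
  then have p: "pt z0 w0 \<in> X \<inter> Q" using Q(2,3) X(3) unfolding z0_def by blast
  have z0: "z0 \<noteq> 0" using s(1) by (simp add: z0_def)
  have "open ((\<lambda>q. pt (fst q) (snd q)) -` (X \<inter> Q))"
    by (intro open_vimage open_Int X(1) Q(1) continuous_intros)
  moreover have "(z0, w0) \<in> (\<lambda>q. pt (fst q) (snd q)) -` (X \<inter> Q)" using p by simp
  ultimately obtain A B where AB: "open A" "open B" "(z0, w0) \<in> A \<times> B"
    "A \<times> B \<subseteq> (\<lambda>q. pt (fst q) (snd q)) -` (X \<inter> Q)"
    by (rule open_prod_elim)
  have sub: "pt z w \<in> X \<inter> Q" if "z \<in> A" "w \<in> B" for z w using AB(4) that by auto
  define f where "f j z w = F (pt z w) $ j" for j z w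
  have f: "hol2 (A \<times> B) (f j)" for j
    unfolding f_def using sub by (intro hol2_component[OF X(4) AB(1,2)]) auto
  have sph: "(\<Sum>j\<in>UNIV. f j z w * cnj (f j z w)) = 1" if zw: "z \<in> A" "w \<in> B" "on_M z w" for z w
  proof -
    have "pt z w \<in> U" using sub[OF zw(1,2)] Q(2) zw(3) by (auto simp: hypersurface_iff on_M_iff)
    then have "norm (F (pt z w)) = 1" using X(5) by auto
    then have "(\<Sum>j\<in>UNIV. cmod (f j z w) ^ 2) = 1"
      by (simp add: norm_vec_def L2_set_def f_def)
    moreover have "(\<Sum>j\<in>UNIV. f j z w * cnj (f j z w)) = of_real (\<Sum>j\<in>UNIV. cmod (f j z w) ^ 2)"
      by (simp add: complex_norm_square[symmetric] of_real_sum)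
    ultimately show ?thesis by simp
  qed
  have level: "\<exists>d>0. \<forall>t. dist t (pol z0 (cnj z0)) < d \<longrightarrow> t \<in> \<real> \<longrightarrow>
      uncountable {z \<in> cball z0 r. pol z (cnj z) = t}" if r: "r > 0" for r
  proof -
    obtain d where d: "d > 0" "\<And>t. \<bar>t - rho z0\<bar> < d \<Longrightarrow> uncountable {z \<in> cball z0 r. rho z = t}"
      using uncountable_levels[OF s r] unfolding z0_def by blast
    have "uncountable {z \<in> cball z0 r. pol z (cnj z) = t}"
      if t: "dist t (pol z0 (cnj z0)) < d" "t \<in> \<real>" for t
    proof -
      obtain x where x: "t = of_real x" using t(2) by (rule Reals_cases)
      have "\<bar>x - rho z0\<bar> < d" using t(1) unfolding x pol_cnj dist_of_real dist_real_def .
      from d(2)[OF this] show ?thesis unfolding x pol_cnj of_real_eq_iff .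
    qed
    then show ?thesis using d(1) by blast
  qed
  have r0: "rho z0 < 1" using w0 unfolding z0_def by (smt (verit) zero_less_power zero_less_norm_iff)
  have "Im (z0 ^ 6) \<noteq> 0" using s by (simp add: z0_def DeMoivre2)
  note chord = chord[OF this r0]
  have "0 < min (1 - e * K) (cmod w0 ^ 2)" using e_K_less_1 w0(1) by simp
  \<comment> \<open>The region \<open>D\<close> is \<open>\<rho> < 1 - m\<close>: it is star-shaped as \<open>e * K < 1 - m\<close>, it contains \<open>z0\<close> as
    \<open>\<rho>(z0) = 1 - |w0|\<^sup>2\<close>, and the radii above it are at least \<open>sqrt m\<close>.\<close>
  then obtain m where "0 < m" "m < min (1 - e * K) (cmod w0 ^ 2)" using dense by blast
  then have m: "0 < m" "m < 1 - e * K" "m < cmod w0 ^ 2" by auto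
  \<comment> \<open>\<open>R\<close> is large enough for \<open>z0\<close> and for the zeros of \<open>\<rho>\<close>\<close>
  define R where "R = cmod z0 + sqrt K + 1"
  define D where "D = {z. cmod z < R \<and> rho z < 1 - m}"
  define C where "C = cball 0 R \<inter> {z. rho z \<le> 1 - m}"
  have DC: "D \<subseteq> C" by (auto simp: D_def C_def)
  have oD: "open D" unfolding D_def by (intro open_Collect_conj open_Collect_less continuous_intros)
  have cC: "compact C" unfolding C_def by (intro compact_Int_closed compact_cball closed_Collect_le continuous_intros)
  have zD: "z0 \<in> D" using w0(2) m K_pos by (simp add: D_def R_def z0_def add_pos_pos)
  have star: "closed_segment 0 z \<subseteq> D" if z: "z \<in> D" for z
  proof
    fix y assume "y \<in> closed_segment 0 z"
    then obtain t where t: "0 \<le> t" "t \<le> 1" "y = of_real t * z"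
      by (auto simp: closed_segment_def scaleR_conv_of_real)
    have "0 \<le> e * (1 - t ^ 2) * cmod z ^ 2" using e t by (simp add: power_le_one)
    then have "rho y < 1 - m" using rho_scale[OF t(1,2), of z] m(2) z unfolding t(3) D_def by auto
    moreover have "cmod y \<le> cmod z" using t by (simp add: norm_mult mult_left_le_one_le)
    ultimately show "y \<in> D" using z by (auto simp: D_def)
  qed
  have pos: "0 < Re (1 - pol z (cnj z))" if "z \<in> C" for z
    using that m(1) by (simp add: pol_cnj C_def)
  have "continuous_on C (\<lambda>z. sqrt (1 - rho z))" by (intro continuous_intros)
  then obtain y where y: "\<And>z. z \<in> C \<Longrightarrow> sqrt (1 - rho z) \<le> sqrt (1 - rho y)"
    using continuous_attains_sup[OF cC] zD DC by blast
  \<comment> \<open>the largest ratio of a radius over \<open>C\<close> to \<open>|w0|\<close>\<close>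
  define b where "b = max 1 (sqrt (1 - rho y) / cmod w0)"
  have sm: "sqrt m \<le> cmod w0" using m(3) by (simp add: real_le_lsqrt)
  obtain s1 s2 where seg: "s1 \<le> 0" "0 \<le> s2" "\<And>x. s1 \<le> x \<Longrightarrow> x \<le> s2 \<Longrightarrow> ray x < 1"
    "\<And>t. sqrt m / cmod w0 \<le> t \<Longrightarrow> t \<le> b \<Longrightarrow> \<exists>x. s1 \<le> x \<and> x \<le> s2 \<and> 1 - ray x = t"
    using ray_segment[of "sqrt m / cmod w0" b] sm m(1) w0(1) by (auto simp: b_def)
  have seg1: "pol (of_real x) 1 \<noteq> 1" if "s1 \<le> x" "x \<le> s2" for x
    using seg(3)[OF that] unfolding pol_ray of_real_eq_1_iff by simp
  have seg2: "0 < Re (deriv (\<lambda>s. pol s 1) (of_real x))" for x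
    using ray'_pos by (simp add: pol_ray_deriv)
  have reach: "\<exists>x. s1 \<le> x \<and> x \<le> s2 \<and> cmod w0 * Re (1 - pol (of_real x) 1) = sqrt (Re (1 - pol z (cnj z)))"
    if z: "z \<in> C" for z
  proof -
    have "sqrt m \<le> sqrt (1 - rho z)" using z by (simp add: C_def)
    then have "sqrt m / cmod w0 \<le> sqrt (1 - rho z) / cmod w0" by (rule divide_right_mono) simp
    moreover have "sqrt (1 - rho z) / cmod w0 \<le> sqrt (1 - rho y) / cmod w0"
      by (rule divide_right_mono[OF y[OF z]]) simp
    then have "sqrt (1 - rho z) / cmod w0 \<le> b" by (simp add: b_def)
    ultimately obtain x where "s1 \<le> x" "x \<le> s2" "1 - ray x = sqrt (1 - rho z) / cmod w0"
      using seg(4) by blast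
    then show ?thesis using w0(1) by (intro exI[of _ x]) (simp add: pol_ray pol_cnj)
  qed
  have "0 < 1 - m" using m(2) mult_pos_pos[OF e K_pos] by linarith
  then have "{z. cmod z < R \<and> rho z = 0} \<subseteq> {z \<in> D. pol z (cnj z) = 0}"
    by (auto simp: D_def pol_cnj)
  moreover have "infinite {z. cmod z < R \<and> rho z = 0}" by (rule infinite_zeros) (simp add: R_def)
  ultimately have inf: "infinite {z \<in> D. pol z (cnj z) = 0}" using finite_subset by blast
  have M: "on_M z0 w0" using w0(2) by (simp add: on_M_iff z0_def)
  have AB': "z0 \<in> A" "w0 \<in> B" using AB(3) by auto
  have P0: "pol z 0 = 0" for z by (simp add: pol_def)
  obtain d w1 where d: "d > 0" "ball z0 d \<subseteq> A" "ball w1 d \<subseteq> B"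
    "\<And>j z w. z \<in> ball z0 d \<Longrightarrow> w \<in> ball w1 d \<Longrightarrow> f j z w = f j z0 w1"
  proof (rule sphere_map_locally_constant[OF AB(1,2) f AB' z0 w0(1) M sph level P0 chord seg(1,2) seg1 seg2
        oD zD cC DC star pos reach inf])
  qed (assumption | rule that)+
  define V where "V = {Z :: complex ^ 2. Z $ 1 \<in> ball z0 d \<and> Z $ 2 \<in> ball w1 d}"
  have V: "V = (\<lambda>Z. Z $ 1) -` ball z0 d \<inter> (\<lambda>Z. Z $ 2) -` ball w1 d" by (auto simp: V_def)
  show ?thesis
  proof (rule holomorphic_map_identity[OF X(4,2)])
    show "open V" unfolding V by (intro open_Int open_vimage open_ball continuous_intros)
    show "V \<noteq> {}" using d(1) by (auto simp: V_def intro!: exI[of _ "pt z0 w1"])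
    have "Z \<in> X" if "Z \<in> V" for Z
    proof -
      have "Z $ 1 \<in> A" "Z $ 2 \<in> B" using that d(2,3) unfolding V_def by blast+
      from sub[OF this] show ?thesis by (simp add: pt_eta)
    qed
    then show "V \<subseteq> X" by blast
    fix Z assume "Z \<in> V"
    then have "f j (Z $ 1) (Z $ 2) = f j z0 w1" for j by (intro d(4)) (auto simp: V_def)
    then show "F Z = F (pt z0 w1)" by (simp add: f_def pt_eta vec_eq_iff)
  qed
qed

end

theorem theorem1p1:
  fixes c e0 :: real
  assumes "2 < c" and "c < 16 / 7" and "0 < e0"
    and "\<And>e. 0 \<le> e \<Longrightarrow> e < 1 \<Longrightarrow> smooth_hypersurface (hypersurface_M c e0 e)"
  shows "\<exists>eN. 0 < eN \<and> eN < 1 \<and>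
    (\<forall>e. 0 < e \<and> e < eN \<longrightarrow>
       \<not> locally_embeddable_into_sphere TYPE('n::finite) (hypersurface_M c e0 e) \<and>
       (\<forall>U X. \<forall>F :: complex ^ 2 \<Rightarrow> complex ^ 'n.
          open_piece (hypersurface_M c e0 e) U \<and> connected U \<and> maps_into_sphere U X F
            \<longrightarrow> F constant_on X))"
proof -
  define k where "k = e0 * (c - 1)"
  \<comment> \<open>\<open>1 / k\<close> gives star-shaped sublevel sets, \<open>k ^ 4 / 32\<close> gives negative values of \<open>\<rho>\<close>\<close>
  define eN where "eN = min (1 / 2) (min (1 / k) (k ^ 4 / 32))"
  have k: "0 < k" using assms(1,3) by (simp add: k_def)
  have eN: "0 < eN" "eN < 1" using k by (auto simp: eN_def)
  have const: "F constant_on X"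
    if e: "0 < e" "e < eN" and U: "open_piece (hypersurface_M c e0 e) U" and F: "maps_into_sphere U X F"
    for e U X and F :: "complex ^ 2 \<Rightarrow> complex ^ 'n"
  proof -
    have "e < 1 / k" "e < k ^ 4 / 32" using e by (auto simp: eN_def)
    then have "e * k < 1" "32 * e < k ^ 4" using k by (auto simp: field_simps)
    then interpret perturbed_octic c e0 e
      using assms(1,3) e(1) unfolding k_def by unfold_locales
    show ?thesis by (rule sphere_map_constant[OF U F])
  qed
  have "\<not> locally_embeddable_into_sphere TYPE('n) (hypersurface_M c e0 e)" if e: "0 < e" "e < eN" for e
  proof
    assume "locally_embeddable_into_sphere TYPE('n) (hypersurface_M c e0 e)"
    then obtain U X and F :: "complex ^ 2 \<Rightarrow> complex ^ 'n" where U: "open_piece (hypersurface_M c e0 e) U"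
      and F: "maps_into_sphere U X F" "holomorphic_embedding X F"
      unfolding locally_embeddable_into_sphere_def by blast
    obtain p where "p \<in> X" using U F(1) by (auto simp: open_piece_def maps_into_sphere_def)
    then show False using constant_holomorphic_map_not_embedding const[OF e U F(1)] F(2) by blast
  qed
  then show ?thesis using eN const by blast
qed

end
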